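(* Let $T>0$ and let $q_{ij}, b_i:\mathbb{R}^{1+d}\to\mathbb{R}$ ($i,j=1,\dots,d$) be $T$-periodic in the time variable and satisfy the following assumptions. (H1) $q_{ij}, b_i\in C^{\alpha/2,\alpha}_{loc}(\mathbb{R}^{1+d})$ for some $\alpha\in(0,1)$. (H2) For every $(s,x)\in\mathbb{R}^{1+d}$ the matrix $Q(s,x)=(q_{ij}(s,x))$ is symmetric, and there is a function $\eta:\mathbb{R}^{1+d}\to\mathbb{R}$ with $\inf_{\mathbb{R}^{1+d}}\eta>0$ such that $\langle Q(s,x)\xi,\xi\rangle\ge\eta(s,x)|\xi|^2$ for all $\xi\in\mathbb{R}^d$, $(s,x)\in\mathbb{R}^{1+d}$. (H3) There exist a positive function $W\in C^2(\mathbb{R}^d)$ and $\lambda\in\mathbb{R}$ such that $\lim_{|x|\to\infty}W(x)=\infty$ and $\sup_{s\in\mathbb{R},\,x\in\mathbb{R}^d}\big((\mathcal{A}(s)W)(x)-\lambda W(x)\big)<0$. Assume that $G(t,s)$ is compact in $C_b(\mathbb{R}^d)$ for all $t>s$. Then: (i) There exists a unique $T$-periodic evolution system of measures $\{\mu_s: s\in\mathbb{R}\}$ for $G(t,s)$. (ii) Setting $\omega_0=\frac{\log r}{T}$, where $$r:=\sup\{|\lambda|:\ \lambda\in\sigma(V(s)),\ |\lambda|<1,\ s\in\mathbb{R}\}<1,\qquad V(s):=G(s+T,s),$$ (with $\omega_0=-\infty$ if $r=0$), for each $\omega>\omega_0$ there exists $M=M(\omega)>0$ such that $$\Big\|G(t,s)\varphi-\int_{\mathbb{R}^d}\varphi\,d\mu_s\Big\|_\infty\le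 M e^{\omega(t-s)}\|\varphi\|_\infty,\qquad t>s,\ \varphi\in C_b(\mathbb{R}^d),$$ while for $\omega<\omega_0$ there is no $M$ such that this estimate holds.
   Context: $C_b(\mathbb{R}^d)$ is the space of bounded continuous functions $\mathbb{R}^d\to\mathbb{R}$ with the sup norm $\|\cdot\|_\infty$. For $0<\alpha<1$, $C^{\alpha/2,\alpha}_{loc}(\mathbb{R}^{1+d})$ is the space of continuous functions on $\mathbb{R}^{1+d}$ (variables $(s,x)\in\mathbb{R}\times\mathbb{R}^d$) whose restriction to $[a,b]\times B(0,R)$ belongs to the usual parabolic Hölder space $C^{\alpha/2,\alpha}([a,b]\times B(0,R))$ ($\alpha/2$-Hölder in time, $\alpha$-Hölder in space) for every $a<b$, $R>0$. The coefficients are allowed to be unbounded. For $s\in\mathbb{R}$ and $\varphi\in C^2(\mathbb{R}^d)$, $$(\mathcal{A}(s)\varphi)(x)=\sum_{i,j=1}^d q_{ij}(s,x)D_{ij}\varphi(x)+\sum_{i=1}^d b_i(s,x)D_i\varphi(x).$$ Evolution operator. Under (H1)-(H3) it is known that for every $s\in\mathbb{R}$, $\varphi\in C_b(\mathbb{R}^d)$ there is a unique bounded classical solution $u$ (bounded, continuous on $[s,\infty)\times\mathbb{R}^d$, $C^1$ in time and $C^2$ in space for $t>s$) of $D_tu(t,x)=(\mathcal{A}(t)u(t,\cdot))(x)$ for $t>s$, $x\in\mathbb{R}^d$, $u(s,x)=\varphi(x)$. One sets $G(t,s)\varphi:=u(t,\cdot)$, $t\ge s$; each $G(t,s)$ is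 a linear contraction in $C_b(\mathbb{R}^d)$. An evolution system of measures for $G(t,s)$ is a family $\{\mu_s:s\in\mathbb{R}\}$ of Borel probability measures on $\mathbb{R}^d$ such that $\int_{\mathbb{R}^d}G(t,s)\varphi\,d\mu_t=\int_{\mathbb{R}^d}\varphi\,d\mu_s$ for all $t>s$, $\varphi\in C_b(\mathbb{R}^d)$. It is $T$-periodic if $\mu_{s+T}=\mu_s$ for all $s\in\mathbb{R}$. $\sigma(V(s))$ is the spectrum of $V(s)$ in (the complexification of) $C_b(\mathbb{R}^d)$. When $G(t,s)$ is compact for $t>s$, $\sigma(V(s))\setminus\{0\}$ consists of isolated eigenvalues and does not depend on $s$, so that $r<1$. *)

theory Defs
  imports "HOL-Analysis.Analysis" "HOL-Probability.Probability_Measure"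
begin

text \<open>
  A function of time and space, such as \<open>q\<^sub>i\<^sub>j\<close>, \<open>b\<^sub>i\<close> or a solution \<open>u\<close>, is written in curried form,
  with values \<open>f s x\<close>.  The space \<open>C\<^sub>b(\<real>\<^sup>d)\<close> is the library type of bounded continuous functions,
  whose \<^const>\<open>norm\<close> is the sup norm; the dimension \<open>d \<ge> 1\<close> is \<open>CARD('n)\<close>.
\<close>

type_synonym 'n Cb = "(real ^ 'n, real) bcontfun"

section \<open>Partial derivatives and the operators \<open>A(s)\<close>\<close>

definition partial :: "'n::finite \<Rightarrow> (real ^ 'n \<Rightarrow> real) \<Rightarrow> real ^ 'n \<Rightarrow> real" where
  "partial i \<phi> x = deriv (\<lambda>h. \<phi> (x + h *\<^sub>R axis i 1)) 0"

definition C1_fun :: "(real ^ 'n::finite \<Rightarrow> real) \<Rightarrow> bool" where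
  "C1_fun \<phi> \<longleftrightarrow>
     (\<forall>i. (\<forall>x. (\<lambda>h::real. \<phi> (x + h *\<^sub>R axis i 1)) differentiable (at 0)) \<and>
          continuous_on UNIV (partial i \<phi>))"

definition C2_fun :: "(real ^ 'n::finite \<Rightarrow> real) \<Rightarrow> bool" where
  "C2_fun \<phi> \<longleftrightarrow> C1_fun \<phi> \<and> (\<forall>i. C1_fun (partial i \<phi>))"

definition diff_operator ::
  "(real \<Rightarrow> real ^ 'n \<Rightarrow> real ^ 'n ^ 'n) \<Rightarrow> (real \<Rightarrow> real ^ 'n \<Rightarrow> real ^ 'n) \<Rightarrow>
   real \<Rightarrow> (real ^ 'n::finite \<Rightarrow> real) \<Rightarrow> real ^ 'n \<Rightarrow> real" where
  "diff_operator q b s \<phi> x =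
     (\<Sum>i\<in>UNIV. \<Sum>j\<in>UNIV. q s x $ i $ j * partial i (partial j \<phi>) x) +
     (\<Sum>i\<in>UNIV. b s x $ i * partial i \<phi> x)"

section \<open>The assumptions on the coefficients\<close>

definition parabolic_Hoelder_loc ::
  "real \<Rightarrow> (real \<Rightarrow> real ^ 'n::finite \<Rightarrow> real) \<Rightarrow> bool" where
  "parabolic_Hoelder_loc \<alpha> f \<longleftrightarrow>
     continuous_on UNIV (\<lambda>(s, x). f s x) \<and>
     (\<forall>a b R. a < b \<longrightarrow> 0 < R \<longrightarrow>
       (\<exists>C. \<forall>s\<in>{a..b}. \<forall>t\<in>{a..b}. \<forall>x\<in>ball 0 R. \<forall>y\<in>ball 0 R.
          \<bar>f s x\<bar> \<le> C \<and>
          \<bar>f s x - f t x\<bar> \<le> C * \<bar>s - t\<bar> powr (\<alpha> / 2) \<and>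
          \<bar>f s x - f s y\<bar> \<le> C * dist x y powr \<alpha>))"

definition H1 ::
  "(real \<Rightarrow> real ^ 'n \<Rightarrow> real ^ 'n ^ 'n) \<Rightarrow> (real \<Rightarrow> real ^ 'n \<Rightarrow> real ^ 'n::finite) \<Rightarrow> bool" where
  "H1 q b \<longleftrightarrow>
     (\<exists>\<alpha>. 0 < \<alpha> \<and> \<alpha> < 1 \<and>
       (\<forall>i j. parabolic_Hoelder_loc \<alpha> (\<lambda>s x. q s x $ i $ j)) \<and>
       (\<forall>i. parabolic_Hoelder_loc \<alpha> (\<lambda>s x. b s x $ i)))"

text \<open>
  Infima and suprema of possibly unbounded real families are taken in the extended reals, since
  the infimum or supremum of an unbounded set of reals is an unspecified real number.
\<close>

definition H2 :: "(real \<Rightarrow> real ^ 'n \<Rightarrow> real ^ 'n ^ 'n::finite) \<Rightarrow> bool" where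
  "H2 q \<longleftrightarrow>
     (\<forall>s x. transpose (q s x) = q s x) \<and>
     (\<exists>\<eta>::real \<Rightarrow> real ^ 'n \<Rightarrow> real.
       (INF (s, x)\<in>UNIV. ereal (\<eta> s x)) > 0 \<and>
       (\<forall>s x \<xi>. (q s x *v \<xi>) \<bullet> \<xi> \<ge> \<eta> s x * (norm \<xi>)\<^sup>2))"

definition H3 ::
  "(real \<Rightarrow> real ^ 'n \<Rightarrow> real ^ 'n ^ 'n) \<Rightarrow> (real \<Rightarrow> real ^ 'n \<Rightarrow> real ^ 'n::finite) \<Rightarrow> bool" where
  "H3 q b \<longleftrightarrow>
     (\<exists>(W::real ^ 'n \<Rightarrow> real) (c::real).
       (\<forall>x. W x > 0) \<and> C2_fun W \<and> filterlim W at_top at_infinity \<and>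
       (SUP (s, x)\<in>UNIV. ereal (diff_operator q b s W x - c * W x)) < 0)"

section \<open>The evolution operator\<close>

text \<open>
  \<open>C\<^sup>1\<close> in time and \<open>C\<^sup>2\<close> in space means, as usual for parabolic equations, that the time
  derivative and the space derivatives up to order two exist and are jointly continuous.
\<close>

definition bounded_classical_solution ::
  "(real \<Rightarrow> real ^ 'n \<Rightarrow> real ^ 'n ^ 'n) \<Rightarrow> (real \<Rightarrow> real ^ 'n \<Rightarrow> real ^ 'n) \<Rightarrow>
   real \<Rightarrow> (real ^ 'n::finite \<Rightarrow> real) \<Rightarrow> (real \<Rightarrow> real ^ 'n \<Rightarrow> real) \<Rightarrow> bool" where
  "bounded_classical_solution q b s \<phi> u \<longleftrightarrow>
     bounded ((\<lambda>(t, x). u t x) ` ({s..} \<times> UNIV)) \<and>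
     continuous_on ({s..} \<times> UNIV) (\<lambda>(t, x). u t x) \<and>
     (\<forall>t>s. \<forall>x. (\<lambda>\<tau>. u \<tau> x) differentiable (at t)) \<and>
     continuous_on ({s<..} \<times> UNIV) (\<lambda>(t, x). deriv (\<lambda>\<tau>. u \<tau> x) t) \<and>
     (\<forall>t>s. C2_fun (u t)) \<and>
     (\<forall>i. continuous_on ({s<..} \<times> UNIV) (\<lambda>(t, x). partial i (u t) x)) \<and>
     (\<forall>i j. continuous_on ({s<..} \<times> UNIV) (\<lambda>(t, x). partial i (partial j (u t)) x)) \<and>
     (\<forall>t>s. \<forall>x. deriv (\<lambda>\<tau>. u \<tau> x) t = diff_operator q b t (u t) x) \<and>
     (\<forall>x. u s x = \<phi> x)"

text \<open>
  \<open>G t s \<phi>\<close> is the value at time \<open>t\<close> of the bounded classical solution that starts from \<open>\<phi>\<close> at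
  time \<open>s\<close>.  Under \<^const>\<open>H2\<close> and \<^const>\<open>H3\<close> there is at most one such solution, by the maximum
  principle with Lyapunov function \<open>W\<close>, so \<open>G t s\<close> is determined for \<open>t \<ge> s\<close>; under
  \<^const>\<open>H1\<close>, \<^const>\<open>H2\<close>, \<^const>\<open>H3\<close> it is known to exist.  For \<open>t < s\<close> nothing is said about
  \<open>G t s\<close>.  Linearity, contractivity and the evolution law are consequences and are not part of the
  definition.
\<close>

definition evolution_operator ::
  "(real \<Rightarrow> real ^ 'n \<Rightarrow> real ^ 'n ^ 'n) \<Rightarrow> (real \<Rightarrow> real ^ 'n \<Rightarrow> real ^ 'n) \<Rightarrow>
   (real \<Rightarrow> real \<Rightarrow> 'n::finite Cb \<Rightarrow> 'n Cb) \<Rightarrow> bool" where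
  "evolution_operator q b G \<longleftrightarrow>
     (\<forall>s \<phi>. bounded_classical_solution q b s (apply_bcontfun \<phi>)
              (\<lambda>t. apply_bcontfun (G t s \<phi>)))"

definition compact_map :: "('a::metric_space \<Rightarrow> 'b::metric_space) \<Rightarrow> bool" where
  "compact_map V \<longleftrightarrow> (\<forall>B. bounded B \<longrightarrow> compact (closure (V ` B)))"

section \<open>Evolution systems of measures\<close>

definition evolution_system_of_measures ::
  "(real \<Rightarrow> real \<Rightarrow> 'n::finite Cb \<Rightarrow> 'n Cb) \<Rightarrow> (real \<Rightarrow> (real ^ 'n) measure) \<Rightarrow> bool" where
  "evolution_system_of_measures G \<mu> \<longleftrightarrow>
     (\<forall>s. sets (\<mu> s) = sets borel \<and> prob_space (\<mu> s)) \<and>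
     (\<forall>s t. s < t \<longrightarrow>
       (\<forall>\<phi>. (\<integral>x. apply_bcontfun (G t s \<phi>) x \<partial>\<mu> t) = (\<integral>x. apply_bcontfun \<phi> x \<partial>\<mu> s)))"

definition periodic_evolution_system ::
  "real \<Rightarrow> (real \<Rightarrow> real \<Rightarrow> 'n::finite Cb \<Rightarrow> 'n Cb) \<Rightarrow> (real \<Rightarrow> (real ^ 'n) measure) \<Rightarrow> bool" where
  "periodic_evolution_system T G \<mu> \<longleftrightarrow>
     evolution_system_of_measures G \<mu> \<and> (\<forall>s. \<mu> (s + T) = \<mu> s)"

section \<open>The spectrum in the complexification\<close>

text \<open>
  The complexification \<open>X + iX\<close> of a real Banach space \<open>X\<close> is realised on \<open>X \<times> X\<close>, where \<open>(f, g)\<close>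
  stands for \<open>f + ig\<close>.  The complexified operator is \<open>map_prod V V\<close>.  The norm of the product type
  is equivalent to the complexification norms, so it yields the same bounded inverses, and an
  inverse of the complex-linear map \<open>z - V\<close> is automatically complex-linear.
\<close>

definition complex_scale :: "complex \<Rightarrow> 'a::real_vector \<times> 'a \<Rightarrow> 'a \<times> 'a" where
  "complex_scale z p =
     (Re z *\<^sub>R fst p - Im z *\<^sub>R snd p, Im z *\<^sub>R fst p + Re z *\<^sub>R snd p)"

definition complex_spectrum :: "('a::real_normed_vector \<Rightarrow> 'a) \<Rightarrow> complex set" where
  "complex_spectrum V =
     {z. \<not> (\<exists>R. bounded_linear R \<and>
              (\<forall>p. R (complex_scale z p - map_prod V V p) = p) \<and>
              (\<forall>p. complex_scale z (R p) - map_prod V V (R p) = p))}"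

text \<open>
  The supremum is over a subset of \<open>[0,1)\<close>; it is nonempty when the \<open>G (s + T) s\<close> are compact and
  linear, because 0 is then a spectral value (\<open>C\<^sub>b(\<real>\<^sup>d)\<close> is infinite-dimensional).
\<close>

definition spectral_r :: "real \<Rightarrow> (real \<Rightarrow> real \<Rightarrow> 'n::finite Cb \<Rightarrow> 'n Cb) \<Rightarrow> real" where
  "spectral_r T G =
     Sup {cmod z | z s. z \<in> complex_spectrum (G (s + T) s) \<and> cmod z < 1}"

definition omega0 :: "real \<Rightarrow> (real \<Rightarrow> real \<Rightarrow> 'n::finite Cb \<Rightarrow> 'n Cb) \<Rightarrow> ereal" where
  "omega0 T G = (if spectral_r T G = 0 then -\<infinity> else ereal (ln (spectral_r T G) / T))"

definition decay_estimate ::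
  "(real \<Rightarrow> real \<Rightarrow> 'n::finite Cb \<Rightarrow> 'n Cb) \<Rightarrow> (real \<Rightarrow> (real ^ 'n) measure) \<Rightarrow>
   real \<Rightarrow> real \<Rightarrow> bool" where
  "decay_estimate G \<mu> \<omega> M \<longleftrightarrow>
     (\<forall>s t. s < t \<longrightarrow>
       (\<forall>\<phi>. norm (G t s \<phi> - const_bcontfun (\<integral>x. apply_bcontfun \<phi> x \<partial>\<mu> s))
              \<le> M * exp (\<omega> * (t - s)) * norm \<phi>))"

end

theory Submission
  imports Defs "HOL-Complex_Analysis.Complex_Analysis"
begin

text \<open>
  The maximum principle, with \<open>W\<close> controlling infinity, makes \<open>G(t,s)\<close> linear, positive and
  contractive; a barrier argument gives \<open>G(t,s)\<phi> > 0\<close> for \<open>\<phi> \<ge> 0\<close>, \<open>\<phi> \<noteq> 0\<close>.  Together with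
  compactness this forces \<open>V = G(T,0)\<close> to contract oscillations: \<open>V\<^sup>3\<close> maps functions with values in
  \<open>[0,1]\<close> to functions of oscillation at most \<open>\<rho> < 1\<close>.  Hence \<open>V\<^sup>n \<phi>\<close> converges exponentially to a
  constant, and transporting this limit along \<open>G\<close> gives invariant positive functionals \<open>m\<^sub>s\<close>.  They
  are continuous along decreasing sequences, again by \<open>W\<close> and compactness, so a Daniell-type
  construction represents them by measures; every periodic evolution system must be this one.

  For the rate, \<open>V(s) - m\<^sub>s\<close> has the spectrum of \<open>V(s)\<close> without \<open>1\<close>.  Cauchy's estimate for the
  scalar functions \<open>w \<mapsto> ((1 - w N)\<^sup>-\<^sup>1 \<phi>)(x)\<close>, where \<open>N = V(0) - m\<^sub>0\<close>, bounds \<open>N\<^sup>n\<close> by every rate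
  above \<open>r\<close>; conversely a rate of decay yields the resolvent outside the corresponding disc through the
  Neumann series.  Riesz theory for compact operators is not needed.
\<close>

section \<open>Second-order conditions at a minimum\<close>

text \<open>\<open>C1_fun\<close> and \<open>C2_fun\<close> speak of coordinate derivatives only,
  while a minimum principle needs derivatives in all directions; hence the opening detour through
  total differentiability. The main obstacle is that the space is not compact: a strictly positive
  function such as \<open>V \<phi>\<close> may still have infimum 0. Compactness of
  \<open>G(t,s)\<close> repairs this, because it makes functions that are bounded by 1 and vanish on
  large balls small in norm after any positive time. The third power of \<open>V\<close> has this
  origin: one factor supplies a norm-convergent subsequence, the other two a uniform lower bound for
  the image of its limit. The geometric convergence obtained in this way is only qualitative, but it
  already separates 1 from the rest of the spectrum and so yields \<open>r < 1\<close>. The sharp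
  rate is proved at \<open>s = 0\<close> and carried to other times by contractions, at the cost of
  a constant; the converse is proved at whichever \<open>s\<close> carries a spectral value close to
  \<open>r\<close>.\<close>

lemma C1_fun_directional:
  assumes "C1_fun \<phi>"
  shows "((\<lambda>h. \<phi> (x + h *\<^sub>R axis i 1)) has_real_derivative partial i \<phi> (x + a *\<^sub>R axis i 1)) (at a)"
proof -
  have "(\<lambda>h. \<phi> ((x + a *\<^sub>R axis i 1) + h *\<^sub>R axis i 1)) differentiable (at (0::real))"
    using assms unfolding C1_fun_def by blast
  then have "((\<lambda>h. \<phi> ((x + a *\<^sub>R axis i 1) + h *\<^sub>R axis i 1)) has_real_derivative
      partial i \<phi> (x + a *\<^sub>R axis i 1)) (at 0)"
    unfolding partial_def by (metis DERIV_deriv_iff_real_differentiable)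
  then have "((\<lambda>h. \<phi> (x + (h + a) *\<^sub>R axis i 1)) has_real_derivative
      partial i \<phi> (x + a *\<^sub>R axis i 1)) (at 0)"
    by (simp add: algebra_simps)
  then show ?thesis
    using DERIV_shift[of "\<lambda>h. \<phi> (x + h *\<^sub>R axis i 1)" _ 0 a] by simp
qed

lemma has_real_derivative_imp_partial:
  assumes "((\<lambda>h. \<phi> (x + h *\<^sub>R axis i 1)) has_real_derivative d) (at 0)"
  shows "partial i \<phi> x = d"
  unfolding partial_def using assms by (rule DERIV_imp_deriv)

text \<open>This is the classical proof that continuous partial derivatives give differentiability,
  with the coordinates switched on one at a time: \<open>S\<close> collects those in which
  \<open>h\<close> may be nonzero. The l1 form of the error makes the induction additive.\<close>

lemma C1_fun_increment:
  fixes \<phi> :: "real ^ 'n::finite \<Rightarrow> real"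
  assumes C1: "C1_fun \<phi>" and "finite S" and e: "e > 0"
  shows "\<exists>d>0. \<forall>h. norm h < d \<longrightarrow> (\<forall>i. i \<notin> S \<longrightarrow> h $ i = 0) \<longrightarrow>
           \<bar>\<phi> (x + h) - \<phi> x - (\<Sum>i\<in>S. h $ i * partial i \<phi> x)\<bar> \<le> e * (\<Sum>i\<in>S. \<bar>h $ i\<bar>)"
  using \<open>finite S\<close>
proof induction
  case empty
  show ?case
  proof (intro exI[of _ 1] conjI allI impI)
    fix h :: "real ^ 'n" assume "\<forall>i. i \<notin> {} \<longrightarrow> h $ i = 0"
    then have "h = 0" by (simp add: vec_eq_iff)
    then show "\<bar>\<phi> (x + h) - \<phi> x - (\<Sum>i\<in>{}. h $ i * partial i \<phi> x)\<bar> \<le> e * (\<Sum>i\<in>{}. \<bar>h $ i\<bar>)" by simp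
  qed simp
next
  case (insert k S)
  then obtain d1 where d1: "d1 > 0" and
    IH: "\<And>h. norm h < d1 \<Longrightarrow> (\<And>i. i \<notin> S \<Longrightarrow> h $ i = 0) \<Longrightarrow>
           \<bar>\<phi> (x + h) - \<phi> x - (\<Sum>i\<in>S. h $ i * partial i \<phi> x)\<bar> \<le> e * (\<Sum>i\<in>S. \<bar>h $ i\<bar>)"
    by blast
  have "isCont (partial k \<phi>) x"
    using C1 unfolding C1_fun_def by (simp add: continuous_on_eq_continuous_at)
  then obtain d2 where d2: "d2 > 0" and
    cont: "\<And>y. dist y x < d2 \<Longrightarrow> \<bar>partial k \<phi> y - partial k \<phi> x\<bar> < e"
    using e unfolding continuous_at_eps_delta dist_real_def by blast
  show ?case
  \<comment> \<open>The points on the last segment differ from \<open>x\<close> by at most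
    \<open>norm h' + norm h\<close>, which is below \<open>d2\<close> because
    \<open>norm h < d2/2\<close>.\<close>
  proof (intro exI[of _ "min d1 (d2/2)"] conjI allI impI)
    show "min d1 (d2/2) > 0" using d1 d2 by simp
    fix h :: "real ^ 'n"
    assume h: "norm h < min d1 (d2/2)" and sup: "\<forall>i. i \<notin> insert k S \<longrightarrow> h $ i = 0"
    define h' where "h' = h - (h $ k) *\<^sub>R axis k 1"
    have h'k: "h' $ i = (if i = k then 0 else h $ i)" for i
      by (simp add: h'_def axis_def)
    have "norm h' \<le> norm h"
      by (rule norm_le_componentwise_cart) (simp add: h'k)
    have hsplit: "h = h' + (h $ k) *\<^sub>R axis k 1" by (simp add: h'_def)
    have 1: "\<bar>\<phi> (x + h') - \<phi> x - (\<Sum>i\<in>S. h $ i * partial i \<phi> x)\<bar> \<le> e * (\<Sum>i\<in>S. \<bar>h $ i\<bar>)"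
    proof -
      have "(\<Sum>i\<in>S. h' $ i * partial i \<phi> x) = (\<Sum>i\<in>S. h $ i * partial i \<phi> x)"
        and "(\<Sum>i\<in>S. \<bar>h' $ i\<bar>) = (\<Sum>i\<in>S. \<bar>h $ i\<bar>)"
        using insert.hyps by (auto intro!: sum.cong simp: h'k)
      moreover have "norm h' < d1" using h \<open>norm h' \<le> norm h\<close> by simp
      moreover have "\<And>i. i \<notin> S \<Longrightarrow> h' $ i = 0" using sup by (auto simp: h'k)
      ultimately show ?thesis using IH[of h'] by simp
    qed
    have 2: "\<bar>\<phi> (x + h) - \<phi> (x + h') - h $ k * partial k \<phi> x\<bar> \<le> e * \<bar>h $ k\<bar>"
    proof -
      define g where "g a = \<phi> ((x + h') + a *\<^sub>R axis k 1) - a * partial k \<phi> x" for a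
      have g': "(g has_real_derivative partial k \<phi> ((x + h') + a *\<^sub>R axis k 1) - partial k \<phi> x) (at a)" for a
        unfolding g_def by (auto intro!: derivative_eq_intros C1_fun_directional[OF C1])
      have "\<bar>g (h $ k) - g 0\<bar> \<le> e * \<bar>h $ k - 0\<bar>"
        unfolding real_norm_def[symmetric]
      proof (rule field_differentiable_bound[where S = "closed_segment 0 (h $ k)"])
        fix a assume "a \<in> closed_segment 0 (h $ k)"
        then have "\<bar>a\<bar> \<le> \<bar>h $ k\<bar>" by (auto simp: closed_segment_eq_real_ivl split: if_splits)
        also have "\<dots> \<le> norm h" by (rule component_le_norm_cart)
        finally have "norm (h' + a *\<^sub>R axis k 1) < d2"
          using h \<open>norm h' \<le> norm h\<close> norm_triangle_ineq[of h' "a *\<^sub>R axis k 1"] by simp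
        then show "norm (partial k \<phi> ((x + h') + a *\<^sub>R axis k 1) - partial k \<phi> x) \<le> e"
          unfolding real_norm_def by (intro less_imp_le cont) (simp add: dist_norm algebra_simps)
      qed (auto intro!: has_field_derivative_at_within g')
      then show ?thesis unfolding g_def hsplit[symmetric] 
        by (simp add: add.assoc hsplit[symmetric])
    qed
    have "\<phi> (x + h) - \<phi> x - (\<Sum>i\<in>insert k S. h $ i * partial i \<phi> x)
       = (\<phi> (x + h') - \<phi> x - (\<Sum>i\<in>S. h $ i * partial i \<phi> x)) + (\<phi> (x + h) - \<phi> (x + h') - h $ k * partial k \<phi> x)"
      using insert.hyps by simp
    then show "\<bar>\<phi> (x + h) - \<phi> x - (\<Sum>i\<in>insert k S. h $ i * partial i \<phi> x)\<bar> \<le> e * (\<Sum>i\<in>insert k S. \<bar>h $ i\<bar>)"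
      using 1 2 insert.hyps by (simp add: distrib_left)
  qed
qed

lemma C1_fun_has_derivative:
  fixes \<phi> :: "real ^ 'n::finite \<Rightarrow> real"
  assumes C1: "C1_fun \<phi>"
  shows "(\<phi> has_derivative (\<lambda>h. \<Sum>i\<in>UNIV. h $ i * partial i \<phi> x)) (at x)"
  unfolding has_derivative_at_alt
proof (intro conjI allI impI)
  show "bounded_linear (\<lambda>h::real^'n. \<Sum>i\<in>UNIV. h $ i * partial i \<phi> x)"
    by (intro bounded_linear_sum bounded_linear_mult_left bounded_linear_compose[OF bounded_linear_mult_left] bounded_linear_vec_nth)
  fix e :: real assume "e > 0"
  \<comment> \<open>\<open>N\<close> bounds the factor by which the l1 norm exceeds the Euclidean
    norm.\<close>
  define N where "N = real CARD('n)"
  have "N > 0" by (simp add: N_def)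
  then have "e / N > 0" using \<open>e > 0\<close> by simp
  from C1_fun_increment[OF C1 finite this, of UNIV x] obtain d where "d > 0" and
    d: "\<And>h. norm h < d \<Longrightarrow> \<bar>\<phi> (x + h) - \<phi> x - (\<Sum>i\<in>UNIV. h $ i * partial i \<phi> x)\<bar> \<le> e / N * (\<Sum>i\<in>UNIV. \<bar>h $ i\<bar>)"
    by auto
  show "\<exists>d>0. \<forall>y. norm (y - x) < d \<longrightarrow>
     norm (\<phi> y - \<phi> x - (\<Sum>i\<in>UNIV. (y - x) $ i * partial i \<phi> x)) \<le> e * norm (y - x)"
  proof (intro exI[of _ d] conjI \<open>d > 0\<close> allI impI)
    fix y assume y: "norm (y - x) < d"
    have "(\<Sum>i\<in>UNIV. \<bar>(y - x) $ i\<bar>) \<le> (\<Sum>i::'n\<in>UNIV. norm (y - x))"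
      by (intro sum_mono component_le_norm_cart)
    then have "(\<Sum>i\<in>UNIV. \<bar>(y - x) $ i\<bar>) \<le> N * norm (y - x)" by (simp add: N_def)
    then have "e / N * (\<Sum>i\<in>UNIV. \<bar>(y - x) $ i\<bar>) \<le> e / N * (N * norm (y - x))"
      using \<open>e / N > 0\<close> by (intro mult_left_mono) auto
    also have "\<dots> = e * norm (y - x)" using \<open>N > 0\<close> by simp
    finally show "norm (\<phi> y - \<phi> x - (\<Sum>i\<in>UNIV. (y - x) $ i * partial i \<phi> x)) \<le> e * norm (y - x)"
      using d[OF y] by simp
  qed
qed

lemma C1_fun_continuous_on: "C1_fun \<phi> \<Longrightarrow> continuous_on A \<phi>"
  by (meson C1_fun_has_derivative continuous_at_imp_continuous_on has_derivative_continuous)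

lemma C1_fun_line:
  fixes \<phi> :: "real ^ 'n::finite \<Rightarrow> real"
  assumes C1: "C1_fun \<phi>"
  shows "((\<lambda>t. \<phi> (x + t *\<^sub>R \<xi>)) has_real_derivative (\<Sum>i\<in>UNIV. \<xi> $ i * partial i \<phi> (x + a *\<^sub>R \<xi>))) (at a)"
proof -
  have "((\<lambda>t. \<phi> (x + t *\<^sub>R \<xi>)) has_derivative
      (\<lambda>t. \<Sum>i\<in>UNIV. (t *\<^sub>R \<xi>) $ i * partial i \<phi> (x + a *\<^sub>R \<xi>))) (at a)"
    by (rule has_derivative_compose[OF _ C1_fun_has_derivative[OF C1]])
       (auto intro!: derivative_eq_intros)
  moreover have "(\<lambda>t. \<Sum>i\<in>UNIV. (t *\<^sub>R \<xi>) $ i * partial i \<phi> (x + a *\<^sub>R \<xi>))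
      = (*) (\<Sum>i\<in>UNIV. \<xi> $ i * partial i \<phi> (x + a *\<^sub>R \<xi>))"
    by (simp add: fun_eq_iff sum_distrib_left sum_distrib_right mult_ac)
  ultimately show ?thesis by (simp add: has_field_derivative_def)
qed

lemma C2_fun_imp_C1_fun: "C2_fun \<phi> \<Longrightarrow> C1_fun \<phi>" "C2_fun \<phi> \<Longrightarrow> C1_fun (partial i \<phi>)"
  by (auto simp: C2_fun_def)

text \<open>A negative \<open>D\<close> makes \<open>g'\<close> negative just to the right of 0, and
  the mean value theorem then carries \<open>g\<close> below \<open>g 0\<close>.\<close>

lemma second_derivative_nonneg_at_min:
  fixes g :: "real \<Rightarrow> real"
  assumes g': "\<And>t. (g has_real_derivative g' t) (at t)"
    and g'': "(g' has_real_derivative D) (at 0)"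
    and min: "d > 0" "\<And>t. \<bar>t\<bar> < d \<Longrightarrow> g 0 \<le> g t"
  shows "g' 0 = 0" "D \<ge> 0"
proof -
  show 0: "g' 0 = 0"
    by (rule DERIV_local_min[OF g' min(1)]) (use min(2) in auto)
  show "D \<ge> 0"
  proof (rule ccontr)
    assume "\<not> D \<ge> 0"
    then obtain e where e: "e > 0" "\<And>h. 0 < h \<Longrightarrow> h < e \<Longrightarrow> g' h < g' 0"
      using DERIV_neg_dec_right[OF g''] by auto
    define t where "t = min e d / 2"
    have t: "0 < t" "t < e" "t < d" using e min(1) by (auto simp: t_def)
    obtain z where "z > 0" "z < t" "g t - g 0 = (t - 0) * g' z"
      using MVT2[OF t(1), of g g'] g' by blast
    then have "t * g' z < 0" "g t - g 0 = t * g' z" using e(2)[of z] t 0 by (auto intro: mult_pos_neg)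
    then have "g t < g 0" by linarith
    with min(2)[of t] t show False by simp
  qed
qed

text \<open>Restriction to the line through \<open>x\<close> in direction \<open>\<xi>\<close>
  reduces both claims to one variable: the second derivative along the line is the Hessian form, and
  the coordinate directions recover the gradient.\<close>

lemma C2_fun_local_min:
  fixes \<phi> :: "real ^ 'n::finite \<Rightarrow> real"
  assumes C2: "C2_fun \<phi>" and d: "d > 0" and min: "\<And>y. dist x y < d \<Longrightarrow> \<phi> x \<le> \<phi> y"
  shows "partial i \<phi> x = 0" "(\<Sum>i\<in>UNIV. \<Sum>j\<in>UNIV. partial i (partial j \<phi>) x * (\<xi> $ i * \<xi> $ j)) \<ge> 0"
proof -
  have *: "(\<Sum>i\<in>UNIV. \<xi> $ i * partial i \<phi> x) = 0 \<and>
     (\<Sum>i\<in>UNIV. \<Sum>j\<in>UNIV. partial i (partial j \<phi>) x * (\<xi> $ i * \<xi> $ j)) \<ge> 0" for \<xi>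
  proof -
    let ?g' = "\<lambda>t. \<Sum>j\<in>UNIV. \<xi> $ j * partial j \<phi> (x + t *\<^sub>R \<xi>)"
    let ?D = "\<Sum>j\<in>UNIV. \<xi> $ j * (\<Sum>i\<in>UNIV. \<xi> $ i * partial i (partial j \<phi>) x)"
    have 1: "((\<lambda>t. \<phi> (x + t *\<^sub>R \<xi>)) has_real_derivative ?g' t) (at t)" for t
      by (rule C1_fun_line[OF C2_fun_imp_C1_fun(1)[OF C2]])
    have 2: "(?g' has_real_derivative ?D) (at 0)"
      using C1_fun_line[OF C2_fun_imp_C1_fun(2)[OF C2], of _ x \<xi> 0]
      by (intro DERIV_sum DERIV_cmult) simp
    \<comment> \<open>The summand 1 keeps the radius \<open>d / (norm \<xi> + 1)\<close> meaningful
      for \<open>\<xi> = 0\<close>.\<close>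
    have n: "norm \<xi> + 1 > 0" by (simp add: add_nonneg_pos)
    have 3: "\<phi> (x + 0 *\<^sub>R \<xi>) \<le> \<phi> (x + t *\<^sub>R \<xi>)" if "\<bar>t\<bar> < d / (norm \<xi> + 1)" for t
    proof -
      have "\<bar>t\<bar> * norm \<xi> \<le> \<bar>t\<bar> * (norm \<xi> + 1)" by (intro mult_left_mono) auto
      also have "\<dots> < d" using that n by (simp add: pos_less_divide_eq)
      finally show ?thesis using min[of "x + t *\<^sub>R \<xi>"] by (simp add: dist_norm)
    qed
    have "?g' 0 = 0 \<and> ?D \<ge> 0"
      using second_derivative_nonneg_at_min[OF 1 2 divide_pos_pos[OF d n] 3] by blast
    moreover have "?D = (\<Sum>i\<in>UNIV. \<Sum>j\<in>UNIV. partial i (partial j \<phi>) x * (\<xi> $ i * \<xi> $ j))"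
      unfolding sum_distrib_left by (subst sum.swap) (simp add: mult_ac)
    ultimately show ?thesis by simp
  qed
  show "(\<Sum>i\<in>UNIV. \<Sum>j\<in>UNIV. partial i (partial j \<phi>) x * (\<xi> $ i * \<xi> $ j)) \<ge> 0"
    using * by blast
  have "(\<Sum>j\<in>UNIV. axis i 1 $ j * partial j \<phi> x) = partial i \<phi> x"
    by (simp add: axis_def if_distrib[of "\<lambda>c. c * _"] cong: if_cong)
  then show "partial i \<phi> x = 0" using *[of "axis i 1"] by simp
qed

text \<open>
  Eliminating one index by a Schur complement writes \<open>Q\<close> as a sum of rank-one forms, on each of
  which \<open>H\<close> is nonnegative; this avoids diagonalising \<open>Q\<close>.
\<close>

lemma trace_mult_nonneg:
  fixes Q H :: "'n \<Rightarrow> 'n \<Rightarrow> real"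
  assumes "finite S"
    and sym: "\<And>i j. Q i j = Q j i"
    and Q: "\<And>\<xi>. \<exists>i\<in>S. \<xi> i \<noteq> 0 \<Longrightarrow> (\<Sum>i\<in>S. \<Sum>j\<in>S. Q i j * (\<xi> i * \<xi> j)) > 0"
    and H: "\<And>\<xi>. (\<Sum>i\<in>S. \<Sum>j\<in>S. H i j * (\<xi> i * \<xi> j)) \<ge> 0"
  shows "(\<Sum>i\<in>S. \<Sum>j\<in>S. Q i j * H i j) \<ge> 0"
  using assms
proof (induction arbitrary: Q)
  case empty
  then show ?case by simp
next
  case (insert k F Q)
  note [simp] = \<open>finite F\<close>
  have exp: "(\<Sum>i\<in>insert k F. \<Sum>j\<in>insert k F. f i j) =
      f k k + (\<Sum>i\<in>F. f i k) + (\<Sum>i\<in>F. f k i) + (\<Sum>i\<in>F. \<Sum>j\<in>F. f i j)" for f :: "'n \<Rightarrow> 'n \<Rightarrow> real"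
    using insert.hyps by (simp add: sum.distrib)
  define c where "c = Q k k"
  have c: "c > 0"
  proof -
    \<comment> \<open>The coordinate vector of \<open>k\<close> yields positivity of the
      pivot.\<close>
    define \<xi> where "\<xi> = (\<lambda>i. if i = k then 1 else 0 :: real)"
    have z: "\<xi> i = 0" if "i \<in> F" for i using that insert.hyps by (auto simp: \<xi>_def)
    have "(\<Sum>i\<in>insert k F. \<Sum>j\<in>insert k F. Q i j * (\<xi> i * \<xi> j)) > 0"
      by (rule insert.prems) (simp add: \<xi>_def)
    then show ?thesis unfolding exp by (simp add: z c_def) (simp add: \<xi>_def)
  qed
  \<comment> \<open>The Schur complement of the pivot \<open>Q k k\<close>.\<close>
  define Q' where "Q' i j = Q i j - Q i k * Q j k / c" for i j
  have Hres: "(\<Sum>i\<in>F. \<Sum>j\<in>F. H i j * (\<xi> i * \<xi> j)) \<ge> 0" for \<xi>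
  proof -
    define \<xi>' where "\<xi>' = \<xi>(k := 0)"
    have "(\<Sum>i\<in>F. \<Sum>j\<in>F. H i j * (\<xi>' i * \<xi>' j)) = (\<Sum>i\<in>F. \<Sum>j\<in>F. H i j * (\<xi> i * \<xi> j))"
      using insert.hyps by (intro sum.cong refl) (auto simp: \<xi>'_def)
    then show ?thesis using insert.prems(3)[of \<xi>'] unfolding exp by (simp add: \<xi>'_def)
  qed
  have Q'pos: "(\<Sum>i\<in>F. \<Sum>j\<in>F. Q' i j * (\<xi> i * \<xi> j)) > 0" if "\<exists>i\<in>F. \<xi> i \<noteq> 0" for \<xi>
  proof -
    define m where "m = (\<Sum>i\<in>F. Q i k * \<xi> i)"
    \<comment> \<open>The value \<open>- m / c\<close> minimises the form of \<open>Q\<close> in the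
      \<open>k\<close>-th variable; the minimum is the form of \<open>Q'\<close>.\<close>
    define \<xi>' where "\<xi>' = \<xi>(k := - m / c)"
    have F: "\<xi>' i = \<xi> i" if "i \<in> F" for i using that insert.hyps by (auto simp: \<xi>'_def)
    have K: "\<xi>' k = - m / c" by (simp add: \<xi>'_def)
    have "0 < (\<Sum>i\<in>insert k F. \<Sum>j\<in>insert k F. Q i j * (\<xi>' i * \<xi>' j))"
      by (rule insert.prems) (use that F in auto)
    also have "\<dots> = c * (m/c)^2 - 2 * m * m / c + (\<Sum>i\<in>F. \<Sum>j\<in>F. Q i j * (\<xi> i * \<xi> j))"
    proof -
      have "(\<Sum>i\<in>F. Q i k * (\<xi>' i * \<xi>' k)) = - m * m / c"
        by (simp add: F K m_def sum_distrib_left sum_distrib_right sum_divide_distrib sum_negf mult_ac)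
      moreover have "(\<Sum>i\<in>F. Q k i * (\<xi>' k * \<xi>' i)) = (\<Sum>i\<in>F. Q i k * (\<xi>' i * \<xi>' k))"
        by (intro sum.cong refl) (metis insert.prems(1) mult.commute)
      moreover have "(\<Sum>i\<in>F. \<Sum>j\<in>F. Q i j * (\<xi>' i * \<xi>' j)) = (\<Sum>i\<in>F. \<Sum>j\<in>F. Q i j * (\<xi> i * \<xi> j))"
        by (intro sum.cong refl) (simp add: F)
      ultimately show ?thesis unfolding exp by (simp add: K c_def power2_eq_square)
    qed
    also have "c * (m/c)^2 - 2 * m * m / c = - (m * m / c)"
      using c by (simp add: field_simps power2_eq_square)
    also have "m * m / c = (\<Sum>i\<in>F. \<Sum>j\<in>F. Q i k * Q j k / c * (\<xi> i * \<xi> j))"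
      unfolding m_def sum_product sum_divide_distrib by (intro sum.cong refl) simp
    finally show ?thesis
      by (simp add: Q'_def left_diff_distrib sum_subtractf)
  qed
  have "(\<Sum>i\<in>F. \<Sum>j\<in>F. Q' i j * H i j) \<ge> 0"
    by (rule insert.IH) (use Q'pos Hres insert.prems(1) in \<open>auto simp: Q'_def\<close>)
  \<comment> \<open>The rank-one part removed from \<open>Q\<close> contributes the form of
    \<open>H\<close> at the \<open>k\<close>-th column of \<open>Q\<close>, divided by the
    pivot.\<close>
  moreover have "(\<Sum>i\<in>insert k F. \<Sum>j\<in>insert k F. H i j * (Q i k * Q j k)) / c \<ge> 0"
    using insert.prems(3)[of "\<lambda>i. Q i k"] c by simp
  moreover have "(\<Sum>i\<in>insert k F. \<Sum>j\<in>insert k F. Q i j * H i j) =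
     (\<Sum>i\<in>F. \<Sum>j\<in>F. Q' i j * H i j) + (\<Sum>i\<in>insert k F. \<Sum>j\<in>insert k F. H i j * (Q i k * Q j k)) / c"
  proof -
    have 1: "(\<Sum>i\<in>F. \<Sum>j\<in>F. Q' i j * H i j) =
      (\<Sum>i\<in>F. \<Sum>j\<in>F. Q i j * H i j) - (\<Sum>i\<in>F. \<Sum>j\<in>F. H i j * (Q i k * Q j k)) / c"
      by (simp add: Q'_def left_diff_distrib right_diff_distrib sum_subtractf sum_divide_distrib mult_ac)
    have 2: "(\<Sum>i\<in>F. H i k * (Q i k * Q k k)) / c = (\<Sum>i\<in>F. Q i k * H i k)"
      using c by (simp add: sum_divide_distrib c_def mult_ac)
    have 3: "(\<Sum>i\<in>F. H k i * (Q k k * Q i k)) / c = (\<Sum>i\<in>F. Q k i * H k i)"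
      unfolding sum_divide_distrib
    proof (intro sum.cong refl)
      fix i
      show "H k i * (Q k k * Q i k) / c = Q k i * H k i"
        using c insert.prems(1)[of k i] by (simp add: c_def)
    qed
    show ?thesis unfolding exp 1 using c
      by (simp add: add_divide_distrib 2 3) (simp add: c_def)
  qed
  ultimately show ?case by simp
qed

lemma diff_operator_nonneg_at_min:
  fixes q :: "real \<Rightarrow> real ^ 'n \<Rightarrow> real ^ 'n ^ 'n::finite"
  assumes H2: "H2 q" and C2: "C2_fun \<phi>"
    and d: "d > 0" and min: "\<And>y. dist x y < d \<Longrightarrow> \<phi> x \<le> \<phi> y"
  shows "diff_operator q b s \<phi> x \<ge> 0"
proof -
  have "transpose (q s x) = q s x"
    using H2 by (simp add: H2_def)
  then have sym: "q s x $ i $ j = q s x $ j $ i" for i j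
    by (simp add: transpose_def vec_eq_iff)
  have pos: "(\<Sum>i\<in>UNIV. \<Sum>j\<in>UNIV. q s x $ i $ j * (\<xi> i * \<xi> j)) > 0" if "\<exists>i\<in>UNIV. \<xi> i \<noteq> 0" for \<xi>
  proof -
    obtain \<eta> where \<eta>: "(INF (s, x)\<in>UNIV. ereal (\<eta> s x)) > 0"
      "\<forall>s x \<xi>. (q s x *v \<xi>) \<bullet> \<xi> \<ge> \<eta> s x * (norm \<xi>)\<^sup>2"
      using H2 unfolding H2_def by blast
    have "\<eta> s x > 0"
      using less_INF_D[OF \<eta>(1), of "(s, x)"] by simp
    moreover have "(\<chi> i. \<xi> i) \<noteq> 0" using that by (auto simp: vec_eq_iff)
    ultimately have "(q s x *v (\<chi> i. \<xi> i)) \<bullet> (\<chi> i. \<xi> i) > 0"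
      using \<eta>(2)[rule_format, where s = s and x = x and \<xi> = "\<chi> i. \<xi> i"]
      by (meson less_le_trans mult_pos_pos zero_less_norm_iff zero_less_power)
    then show ?thesis
      by (simp add: inner_vec_def matrix_vector_mult_def sum_distrib_left mult_ac)
  qed
  have "(\<Sum>i\<in>UNIV. \<Sum>j\<in>UNIV. q s x $ i $ j * partial i (partial j \<phi>) x) \<ge> 0"
  proof (rule trace_mult_nonneg[OF finite])
    fix \<xi> :: "'n \<Rightarrow> real"
    show "(\<Sum>i\<in>UNIV. \<Sum>j\<in>UNIV. partial i (partial j \<phi>) x * (\<xi> i * \<xi> j)) \<ge> 0"
      using C2_fun_local_min(2)[OF C2 d min, of "\<chi> i. \<xi> i"] by simp
  qed (use sym pos in auto)
  then show ?thesis
    using C2_fun_local_min(1)[OF C2 d min] by (simp add: diff_operator_def)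
qed

text \<open>The time comparison looks backwards only, so a minimum attained at the final time of a
  cylinder is admissible. At such a point the time derivative is nonpositive and the elliptic
  operator is nonnegative.\<close>

lemma diff_operator_ge_at_parabolic_min:
  fixes q :: "real \<Rightarrow> real ^ 'n \<Rightarrow> real ^ 'n ^ 'n::finite"
  assumes "H2 q" and "C2_fun (z t)"
    and z': "((\<lambda>\<tau>. z \<tau> x) has_real_derivative D) (at t)"
    and d: "d > 0" and min_space: "\<And>y. dist x y < d \<Longrightarrow> z t x \<le> z t y"
    and min_time: "\<And>\<tau>. t - d < \<tau> \<Longrightarrow> \<tau> \<le> t \<Longrightarrow> z t x \<le> z \<tau> x"
  shows "D \<le> diff_operator q b t (z t) x"
proof -
  have "D \<le> 0"
  proof (rule ccontr)
    assume "\<not> D \<le> 0"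
    then obtain e where e: "e > 0" "\<And>h. 0 < h \<Longrightarrow> h < e \<Longrightarrow> z (t - h) x < z t x"
      using DERIV_pos_inc_left[OF z'] by auto
    define h where "h = min e d / 2"
    have "0 < h" "h < e" "h < d" using e(1) d by (auto simp: h_def)
    then show False using e(2)[of h] min_time[of "t - h"] by auto
  qed
  also have "0 \<le> diff_operator q b t (z t) x"
    by (rule diff_operator_nonneg_at_min[OF assms(1,2) d min_space])
  finally show ?thesis .
qed

section \<open>Bounded classical solutions and comparison\<close>

text \<open>The shape \<open>\<phi> + a * \<psi>\<close> covers sums, differences and multiples at
  once; it is kept up to the linearity of \<open>G\<close> and of the limiting functionals.\<close>

lemma partial_add_scale:
  assumes "C1_fun \<phi>" "C1_fun \<psi>"
  shows "partial i (\<lambda>x. \<phi> x + a * \<psi> x) = (\<lambda>x. partial i \<phi> x + a * partial i \<psi> x)"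
proof
  fix x
  show "partial i (\<lambda>x. \<phi> x + a * \<psi> x) x = partial i \<phi> x + a * partial i \<psi> x"
    using C1_fun_directional[OF assms(1), of x i 0] C1_fun_directional[OF assms(2), of x i 0]
    by (intro has_real_derivative_imp_partial) (auto intro!: derivative_eq_intros)
qed

lemma C1_fun_add_scale:
  assumes "C1_fun \<phi>" "C1_fun \<psi>"
  shows "C1_fun (\<lambda>x. \<phi> x + a * \<psi> x)"
proof -
  have "(\<lambda>h. \<phi> (x + h *\<^sub>R axis i 1) + a * \<psi> (x + h *\<^sub>R axis i 1)) differentiable (at 0)" for x i
    using assms unfolding C1_fun_def by (intro derivative_intros) auto
  moreover have "continuous_on UNIV (\<lambda>x. partial i \<phi> x + a * partial i \<psi> x)" for i
    using assms unfolding C1_fun_def by (intro continuous_intros) auto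
  ultimately show ?thesis
    unfolding C1_fun_def partial_add_scale[OF assms] by blast
qed

lemma C2_fun_add_scale:
  assumes "C2_fun \<phi>" "C2_fun \<psi>"
  shows "C2_fun (\<lambda>x. \<phi> x + a * \<psi> x)"
  using assms unfolding C2_fun_def by (simp add: partial_add_scale C1_fun_add_scale)

lemma partial_partial_add_scale:
  assumes "C2_fun \<phi>" "C2_fun \<psi>"
  shows "partial i (partial j (\<lambda>x. \<phi> x + a * \<psi> x)) = (\<lambda>x. partial i (partial j \<phi>) x + a * partial i (partial j \<psi>) x)"
  using assms unfolding C2_fun_def by (simp add: partial_add_scale)

lemma diff_operator_add_scale:
  assumes "C2_fun \<phi>" "C2_fun \<psi>"
  shows "diff_operator q b s (\<lambda>x. \<phi> x + a * \<psi> x) x = diff_operator q b s \<phi> x + a * diff_operator q b s \<psi> x"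
  using assms unfolding diff_operator_def
  by (simp add: partial_partial_add_scale partial_add_scale C2_fun_imp_C1_fun distrib_left sum.distrib sum_distrib_left mult_ac)

lemma partial_const: "partial i (\<lambda>_. c) = (\<lambda>_. 0)"
  by (auto simp: partial_def)

lemma C1_fun_const: "C1_fun (\<lambda>_. c)"
  by (simp add: C1_fun_def partial_const)

lemma C2_fun_const: "C2_fun (\<lambda>_. c)"
  by (simp add: C2_fun_def partial_const C1_fun_const)

lemma bounded_classical_solutionD:
  assumes "bounded_classical_solution q b s \<phi> u"
  shows "bounded ((\<lambda>(t, x). u t x) ` ({s..} \<times> UNIV))"
    and "continuous_on ({s..} \<times> UNIV) (\<lambda>(t, x). u t x)"
    and "t > s \<Longrightarrow> (\<lambda>\<tau>. u \<tau> x) differentiable (at t)"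
    and "continuous_on ({s<..} \<times> UNIV) (\<lambda>(t, x). deriv (\<lambda>\<tau>. u \<tau> x) t)"
    and "t > s \<Longrightarrow> C2_fun (u t)"
    and "continuous_on ({s<..} \<times> UNIV) (\<lambda>(t, x). partial i (u t) x)"
    and "continuous_on ({s<..} \<times> UNIV) (\<lambda>(t, x). partial i (partial j (u t)) x)"
    and "t > s \<Longrightarrow> deriv (\<lambda>\<tau>. u \<tau> x) t = diff_operator q b t (u t) x"
    and "u s x = \<phi> x"
  using assms by (simp_all add: bounded_classical_solution_def)

lemma bounded_classical_solution_has_derivative:
  assumes "bounded_classical_solution q b s \<phi> u" "t > s"
  shows "((\<lambda>\<tau>. u \<tau> x) has_real_derivative diff_operator q b t (u t) x) (at t)"
  using bounded_classical_solutionD(3,8)[OF assms] by (metis DERIV_deriv_iff_real_differentiable)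

lemma bounded_classical_solution_add_scale:
  assumes u: "bounded_classical_solution q b s \<phi> u" and v: "bounded_classical_solution q b s \<psi> v"
  shows "bounded_classical_solution q b s (\<lambda>x. \<phi> x + a * \<psi> x) (\<lambda>t x. u t x + a * v t x)"
proof -
  note U = bounded_classical_solutionD[OF u] and V = bounded_classical_solutionD[OF v]
  have der: "((\<lambda>\<tau>. u \<tau> x + a * v \<tau> x) has_real_derivative
      diff_operator q b t (u t) x + a * diff_operator q b t (v t) x) (at t)" if "t > s" for t x
    by (intro DERIV_add DERIV_cmult bounded_classical_solution_has_derivative[OF u that]
        bounded_classical_solution_has_derivative[OF v that])
  have cont: "continuous_on A (\<lambda>(t, x). f t x + a * g t x)"
    if "continuous_on A (\<lambda>(t, x). f t x)" "continuous_on A (\<lambda>(t, x). g t x)"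
    for f g :: "real \<Rightarrow> real ^ 'a \<Rightarrow> real" and A
    using that by (auto simp: case_prod_beta' intro!: continuous_intros)
  have congr: "continuous_on ({s<..} \<times> UNIV) (\<lambda>(t, x). f t x)"
    if "continuous_on ({s<..} \<times> UNIV) (\<lambda>(t, x). g t x)" "\<And>t x. t > s \<Longrightarrow> f t x = g t x"
    for f g :: "real \<Rightarrow> real ^ 'a \<Rightarrow> real"
    by (rule continuous_on_eq[OF that(1)]) (auto simp: that(2))
  show ?thesis
    unfolding bounded_classical_solution_def
  proof (intro conjI allI impI)
    have "bounded ((\<lambda>p. (case p of (t, x) \<Rightarrow> u t x) + a * (case p of (t, x) \<Rightarrow> v t x)) ` ({s..} \<times> UNIV))"
      using bounded_plus_comp[OF U(1) bounded_scaleR_comp[OF V(1), of a]] by simp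
    then show "bounded ((\<lambda>(t, x). u t x + a * v t x) ` ({s..} \<times> UNIV))"
      by (simp add: case_prod_beta')
    show "continuous_on ({s..} \<times> UNIV) (\<lambda>(t, x). u t x + a * v t x)"
      by (intro cont U V)
    show "(\<lambda>\<tau>. u \<tau> x + a * v \<tau> x) differentiable at t" if "s < t" for t x
      using der[OF that] by (auto simp: real_differentiable_def)
    show "continuous_on ({s<..} \<times> UNIV) (\<lambda>(t, x). deriv (\<lambda>\<tau>. u \<tau> x + a * v \<tau> x) t)"
      by (rule congr[OF cont[OF U(4) V(4)]]) (simp add: DERIV_imp_deriv[OF der] U(8) V(8))
    show "C2_fun (\<lambda>x. u t x + a * v t x)" if "s < t" for t
      by (intro C2_fun_add_scale U V that)
    show "continuous_on ({s<..} \<times> UNIV) (\<lambda>(t, x). partial i (\<lambda>x. u t x + a * v t x) x)" for i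
      by (rule congr[OF cont[OF U(6)[of i] V(6)[of i]]])
         (simp add: partial_add_scale C2_fun_imp_C1_fun U V)
    show "continuous_on ({s<..} \<times> UNIV) (\<lambda>(t, x). partial i (partial j (\<lambda>x. u t x + a * v t x)) x)" for i j
      by (rule congr[OF cont[OF U(7)[of i j] V(7)[of i j]]])
         (simp add: partial_partial_add_scale U V)
    show "deriv (\<lambda>\<tau>. u \<tau> x + a * v \<tau> x) t = diff_operator q b t (\<lambda>x. u t x + a * v t x) x" if "s < t" for t x
      using DERIV_imp_deriv[OF der[OF that]] by (simp add: diff_operator_add_scale U V that)
    show "u s x + a * v s x = \<phi> x + a * \<psi> x" for x
      by (simp add: U V)
  qed
qed

lemma bounded_classical_solution_const: "bounded_classical_solution q b s (\<lambda>_. c) (\<lambda>_ _. c)"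
  unfolding bounded_classical_solution_def
  by (auto simp: C2_fun_const partial_const diff_operator_def case_prod_beta' image_constant_conv)

lemma bounded_classical_solution_restrict:
  assumes u: "bounded_classical_solution q b s \<phi> u" and "s \<le> r"
  shows "bounded_classical_solution q b r (u r) u"
proof -
  note U = bounded_classical_solutionD[OF u]
  have sub: "{r..} \<times> UNIV \<subseteq> {s..} \<times> UNIV" "{r<..} \<times> UNIV \<subseteq> {s<..} \<times> UNIV"
    using \<open>s \<le> r\<close> by auto
  show ?thesis
    unfolding bounded_classical_solution_def
  proof (intro conjI allI impI)
    show "bounded ((\<lambda>(t, x). u t x) ` ({r..} \<times> UNIV))"
      by (rule bounded_subset[OF U(1) image_mono[OF sub(1)]])
    show "continuous_on ({r..} \<times> UNIV) (\<lambda>(t, x). u t x)"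
      by (rule continuous_on_subset[OF U(2) sub(1)])
    show "(\<lambda>\<tau>. u \<tau> x) differentiable at t" if "r < t" for t x
      using that \<open>s \<le> r\<close> by (intro U(3)) simp
    show "continuous_on ({r<..} \<times> UNIV) (\<lambda>(t, x). deriv (\<lambda>\<tau>. u \<tau> x) t)"
      by (rule continuous_on_subset[OF U(4) sub(2)])
    show "C2_fun (u t)" if "r < t" for t
      using that \<open>s \<le> r\<close> by (intro U(5)) simp
    show "continuous_on ({r<..} \<times> UNIV) (\<lambda>(t, x). partial i (u t) x)" for i
      by (rule continuous_on_subset[OF U(6) sub(2)])
    show "continuous_on ({r<..} \<times> UNIV) (\<lambda>(t, x). partial i (partial j (u t)) x)" for i j
      by (rule continuous_on_subset[OF U(7) sub(2)])
    show "deriv (\<lambda>\<tau>. u \<tau> x) t = diff_operator q b t (u t) x" if "r < t" for t x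
      using that \<open>s \<le> r\<close> by (intro U(8)) simp
  qed (rule refl)
qed

lemma bounded_classical_solution_shift:
  assumes u: "bounded_classical_solution q b (s + T) \<phi> u"
    and q: "\<And>t x. q (t + T) x = q t x" and b: "\<And>t x. b (t + T) x = b t x"
  shows "bounded_classical_solution q b s \<phi> (\<lambda>t. u (t + T))"
proof -
  note U = bounded_classical_solutionD[OF u]
  have der: "((\<lambda>\<tau>. u (\<tau> + T) x) has_real_derivative diff_operator q b (t + T) (u (t + T)) x) (at t)"
    if "t > s" for t x
    using bounded_classical_solution_has_derivative[OF u, of "t + T" x] that by (simp add: DERIV_shift)
  have A: "diff_operator q b (t + T) = diff_operator q b t" for t
    by (intro ext) (simp add: diff_operator_def q b)
  have cont: "continuous_on (X \<times> UNIV) (\<lambda>(t, x). f (t + T) x)"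
    if "continuous_on (Y \<times> UNIV) (\<lambda>(t, x). f t x)" "\<And>t. t \<in> X \<Longrightarrow> t + T \<in> Y"
    for f :: "real \<Rightarrow> real ^ 'a \<Rightarrow> real" and X Y
    using that by (auto simp: case_prod_beta' intro!: continuous_on_compose2[OF that(1)[unfolded case_prod_beta'], of _ "\<lambda>p. (fst p + T, snd p)", simplified] continuous_intros)
  show ?thesis
    unfolding bounded_classical_solution_def
  proof (intro conjI allI impI)
    have "(\<lambda>(t, x). u (t + T) x) ` ({s..} \<times> UNIV) \<subseteq> (\<lambda>(t, x). u t x) ` ({s + T..} \<times> UNIV)"
      by (auto intro!: image_eqI[where x = "(_ + T, _)"])
    then show "bounded ((\<lambda>(t, x). u (t + T) x) ` ({s..} \<times> UNIV))"
      by (rule bounded_subset[OF U(1)])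
    show "continuous_on ({s..} \<times> UNIV) (\<lambda>(t, x). u (t + T) x)"
      by (rule cont[OF U(2)]) auto
    show "(\<lambda>\<tau>. u (\<tau> + T) x) differentiable at t" if "s < t" for t x
      using der[OF that] by (auto simp: real_differentiable_def)
    have "continuous_on ({s<..} \<times> UNIV) (\<lambda>(t, x). (\<lambda>t x. deriv (\<lambda>\<tau>. u \<tau> x) t) (t + T) x)"
      by (rule cont[OF U(4)]) auto
    moreover have "deriv (\<lambda>\<tau>. u (\<tau> + T) x) t = deriv (\<lambda>\<tau>. u \<tau> x) (t + T)" if "s < t" for t x
      using DERIV_imp_deriv[OF der[OF that]] U(8) that by simp
    ultimately show "continuous_on ({s<..} \<times> UNIV) (\<lambda>(t, x). deriv (\<lambda>\<tau>. u (\<tau> + T) x) t)"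
      by (elim continuous_on_eq) auto
    show "continuous_on ({s<..} \<times> UNIV) (\<lambda>(t, x). partial i (u (t + T)) x)" for i
      by (rule cont[OF U(6)]) auto
    show "continuous_on ({s<..} \<times> UNIV) (\<lambda>(t, x). partial i (partial j (u (t + T))) x)" for i j
      by (rule cont[OF U(7)]) auto
    show "deriv (\<lambda>\<tau>. u (\<tau> + T) x) t = diff_operator q b t (u (t + T)) x" if "s < t" for t x
      using DERIV_imp_deriv[OF der[OF that]] by (simp add: A)
    show "C2_fun (u (t + T))" if "s < t" for t
      using that by (intro U(5)) simp
  qed (rule U(9))
qed

section \<open>Lyapunov functions and the maximum principle\<close>

definition lyapunov ::
  "(real \<Rightarrow> real ^ 'n \<Rightarrow> real ^ 'n ^ 'n) \<Rightarrow> (real \<Rightarrow> real ^ 'n \<Rightarrow> real ^ 'n) \<Rightarrow>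
   (real ^ 'n::finite \<Rightarrow> real) \<Rightarrow> real \<Rightarrow> bool" where
  "lyapunov q b W c \<longleftrightarrow> (\<forall>x. W x > 0) \<and> C2_fun W \<and> filterlim W at_top at_infinity \<and>
     (\<forall>s x. diff_operator q b s W x < c * W x)"

lemma H3_lyapunov:
  assumes "H3 q b"
  obtains W c where "lyapunov q b W c"
proof -
  obtain W c where W: "\<forall>x. W x > 0" "C2_fun W" "filterlim W at_top at_infinity"
    "(SUP (s, x)\<in>UNIV. ereal (diff_operator q b s W x - c * W x)) < 0"
    using assms unfolding H3_def by blast
  have "diff_operator q b s W x < c * W x" for s x
    using SUP_lessD[OF W(4), of "(s, x)"] by simp
  with W show ?thesis by (intro that[of W c]) (simp add: lyapunov_def)
qed

text \<open>\<open>Z = u + \<delta> e^(c(t-s)) W\<close> is positive outside a ball, because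
  \<open>u\<close> is bounded and \<open>W\<close> tends to infinity; so a negative value forces a
  negative minimum on a compact cylinder, at a time after \<open>s\<close>. There the equation for
  \<open>u\<close> cancels and leaves \<open>c W \<le> A W\<close>, against \<open>lyapunov\<close>.
  The term with \<open>\<delta>\<close> is kept in the conclusion because the later estimates at
  infinity use a fixed \<open>\<delta>\<close>.\<close>

lemma comparison_lyapunov:
  fixes q :: "real \<Rightarrow> real ^ 'n \<Rightarrow> real ^ 'n ^ 'n::finite"
  assumes H2: "H2 q" and W: "lyapunov q b W c"
    and u: "bounded_classical_solution q b s \<phi> u"
    and \<delta>: "\<delta> > 0" and init: "\<And>x. \<phi> x + \<delta> * W x \<ge> 0" and "t1 \<ge> s"
  shows "u t1 x1 + \<delta> * exp (c * (t1 - s)) * W x1 \<ge> 0"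
proof (rule ccontr)
  define Z where "Z t x = u t x + (\<delta> * exp (c * (t - s))) * W x" for t x
  assume "\<not> ?thesis"
  then have neg: "Z t1 x1 < 0" by (simp add: Z_def)
  note U = bounded_classical_solutionD[OF u]
  have W0: "W x > 0" "C2_fun W" "filterlim W at_top at_infinity" "diff_operator q b r W x < c * W x" for r x
    using W by (auto simp: lyapunov_def)
  obtain M where M: "\<And>t x. t \<ge> s \<Longrightarrow> \<bar>u t x\<bar> \<le> M"
    using U(1) unfolding bounded_iff by auto
  \<comment> \<open>A lower bound for \<open>\<delta> * exp (c * (t - s))\<close> on the whole time
    interval, whatever the sign of \<open>c\<close>.\<close>
  define m where "m = \<delta> * exp (- \<bar>c\<bar> * (t1 - s))"
  have m: "m > 0" using \<delta> by (simp add: m_def)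
  have mle: "m \<le> \<delta> * exp (c * (t - s))" if "s \<le> t" "t \<le> t1" for t
  proof -
    have "- (c * (t - s)) \<le> \<bar>c\<bar> * \<bar>t - s\<bar>" using abs_ge_minus_self[of "c * (t - s)"] by (simp add: abs_mult)
    also have "\<dots> \<le> \<bar>c\<bar> * (t1 - s)" using that by (intro mult_left_mono) auto
    finally show ?thesis using \<delta> by (simp add: m_def)
  qed
  have "\<forall>\<^sub>F x in at_infinity. W x > M / m"
    using W0(3) by (simp add: filterlim_at_top_dense)
  then obtain R where R: "\<And>x. norm x \<ge> R \<Longrightarrow> W x > M / m"
    unfolding eventually_at_infinity by blast
  have outside: "Z t x > 0" if "s \<le> t" "t \<le> t1" "norm x \<ge> R" for t x
  proof -
    have "M < m * W x" using R[OF that(3)] m by (simp add: field_simps)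
    also have "\<dots> \<le> \<delta> * exp (c * (t - s)) * W x"
      using mle[OF that(1,2)] W0(1)[of x] by (intro mult_right_mono) auto
    finally show ?thesis using M[of t x] that by (auto simp: Z_def)
  qed
  have contZ: "continuous_on ({s..} \<times> UNIV) (\<lambda>p. Z (fst p) (snd p))"
    unfolding Z_def
    by (intro continuous_intros U(2)[unfolded case_prod_beta']
        continuous_on_compose2[OF C1_fun_continuous_on[OF C2_fun_imp_C1_fun(1)[OF W0(2)], of UNIV]]) auto
  define K where "K = {s..t1} \<times> cball (0::real^'n) R"
  have K: "compact K" by (simp add: K_def compact_Times)
  have inK: "(t1, x1) \<in> K"
  proof -
    have "norm x1 < R" using outside[of t1 x1] neg \<open>t1 \<ge> s\<close> by linarith
    then show ?thesis using \<open>t1 \<ge> s\<close> by (simp add: K_def)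
  qed
  have "\<exists>p\<in>K. \<forall>p'\<in>K. Z (fst p) (snd p) \<le> Z (fst p') (snd p')"
  proof (rule continuous_attains_inf[OF K])
    show "K \<noteq> {}" using inK by blast
    show "continuous_on K (\<lambda>p. Z (fst p) (snd p))"
      by (rule continuous_on_subset[OF contZ]) (auto simp: K_def)
  qed
  then obtain p where p: "p \<in> K" "\<forall>p'\<in>K. Z (fst p) (snd p) \<le> Z (fst p') (snd p')" ..
  obtain t x where "p = (t, x)" by (cases p)
  with p have tx: "(t, x) \<in> K" and tx_min: "\<And>t' x'. (t', x') \<in> K \<Longrightarrow> Z t x \<le> Z t' x'"
    by auto
  have Zneg: "Z t x < 0" using tx_min[OF inK] neg by simp
  have t: "s \<le> t" "t \<le> t1" using tx by (auto simp: K_def)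
  have min: "Z t x \<le> Z t' x'" if "s \<le> t'" "t' \<le> t1" for t' x'
  proof (cases "norm x' \<ge> R")
    case True
    then show ?thesis using outside[OF that True] Zneg by linarith
  next
    case False
    then show ?thesis using that by (intro tx_min) (simp add: K_def)
  qed
  have "t \<noteq> s"
    using Zneg init[of x] by (auto simp: Z_def U(9))
  then have "t > s" using t by simp
  have "diff_operator q b t (u t) x + \<delta> * (c * exp (c * (t - s))) * W x \<le> diff_operator q b t (Z t) x"
  proof (rule diff_operator_ge_at_parabolic_min[OF H2])
    show "C2_fun (Z t)" unfolding Z_def by (intro C2_fun_add_scale U W0 \<open>t > s\<close>)
    show "((\<lambda>\<tau>. Z \<tau> x) has_real_derivative diff_operator q b t (u t) x + \<delta> * (c * exp (c * (t - s))) * W x) (at t)"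
      unfolding Z_def
      by (rule derivative_eq_intros bounded_classical_solution_has_derivative[OF u \<open>t > s\<close>] refl)+ simp
    show "t - s > 0" using \<open>t > s\<close> by simp
    show "Z t x \<le> Z t y" for y using t by (rule min)
    show "Z t x \<le> Z \<tau> x" if "t - (t - s) < \<tau>" "\<tau> \<le> t" for \<tau> using that t by (intro min) auto
  qed
  also have "\<dots> = diff_operator q b t (u t) x + (\<delta> * exp (c * (t - s))) * diff_operator q b t W x"
    unfolding Z_def by (intro diff_operator_add_scale U W0 \<open>t > s\<close>)
  finally have "(\<delta> * exp (c * (t - s))) * (c * W x) \<le> (\<delta> * exp (c * (t - s))) * diff_operator q b t W x"
    by (simp add: mult_ac)
  then have "c * W x \<le> diff_operator q b t W x"
    using \<delta> by (subst (asm) mult_le_cancel_left_pos) auto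
  then show False using W0(4)[of t x] by simp
qed

lemma bounded_classical_solution_nonneg:
  assumes H2: "H2 q" and H3: "H3 q b"
    and u: "bounded_classical_solution q b s \<phi> u"
    and init: "\<And>x. \<phi> x \<ge> 0" and "t \<ge> s"
  shows "u t x \<ge> 0"
proof (rule ccontr)
  obtain W c where W: "lyapunov q b W c" using H3_lyapunov[OF H3] .
  then have W0: "W x > 0" for x by (auto simp: lyapunov_def)
  define k where "k = exp (c * (t - s)) * W x"
  have k: "k > 0" using W0 by (simp add: k_def)
  assume "\<not> u t x \<ge> 0"
  \<comment> \<open>With this \<open>\<delta>\<close> the Lyapunov correction at
    \<open>(t, x)\<close> is half of \<open>- u t x\<close>, too little to offset the negative
    value.\<close>
  then have \<delta>: "- u t x / (2 * k) > 0" using k by (intro divide_pos_pos) auto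
  have "u t x + (- u t x / (2 * k)) * exp (c * (t - s)) * W x \<ge> 0"
    by (rule comparison_lyapunov[OF H2 W u \<delta> _ \<open>t \<ge> s\<close>])
       (meson \<delta> W0 add_nonneg_nonneg init less_imp_le mult_nonneg_nonneg)
  then have "u t x + (- u t x / (2 * k)) * k \<ge> 0" by (simp add: k_def mult.assoc)
  then show False using \<open>\<not> u t x \<ge> 0\<close> k by (simp add: field_simps)
qed

lemma bounded_classical_solution_unique:
  assumes H2: "H2 q" and H3: "H3 q b"
    and u: "bounded_classical_solution q b s \<phi> u" and v: "bounded_classical_solution q b s \<phi> v" and "t \<ge> s"
  shows "u t x = v t x"
proof (rule antisym)
  show "u t x \<le> v t x"
    using bounded_classical_solution_nonneg[OF H2 H3 bounded_classical_solution_add_scale[OF v u, of "-1"] _ \<open>t \<ge> s\<close>, of x] by simp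
  show "v t x \<le> u t x"
    using bounded_classical_solution_nonneg[OF H2 H3 bounded_classical_solution_add_scale[OF u v, of "-1"] _ \<open>t \<ge> s\<close>, of x] by simp
qed

section \<open>Strong positivity\<close>

text \<open>
  With \<open>w = R\<^sup>2 - |x - \<xi>(t)|\<^sup>2\<close> and \<open>r = R\<^sup>2\<close>, this inequality makes \<open>e\<^sup>-\<^sup>\<beta>\<^sup>t w\<^sup>2\<close> a strict
  subsolution: near the lateral boundary ellipticity wins, in the interior the time decay.
\<close>

lemma quartic_bump_arith:
  fixes C h r w :: real
  assumes "C > 0" "h > 0" "r > 0" "0 < w" "w \<le> r"
  defines "\<beta> \<equiv> 2 * C / r + C\<^sup>2 / (8 * h * r) + 1"
  shows "- \<beta> * w\<^sup>2 + C * w - 8 * h * (r - w) < 0"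
proof (cases "w \<le> r / 2")
  case True
  \<comment> \<open>For small \<open>w\<close> the elliptic term is at least
    \<open>4 * h * r\<close>. Completing the square bounds the remaining terms by
    \<open>C\<^sup>2 / (4 * \<beta>) < 2 * h * r\<close>, which is the purpose of the second summand
    of \<open>\<beta>\<close>.\<close>
  have "\<beta> > 0" unfolding \<beta>_def using assms by (intro add_pos_pos divide_pos_pos) auto
  have "C\<^sup>2 / (8 * h * r) < \<beta>" unfolding \<beta>_def using assms by (simp add: add_pos_pos)
  then have "C\<^sup>2 < \<beta> * (8 * h * r)" using assms by (simp add: divide_less_eq)
  then have "C\<^sup>2 / (4 * \<beta>) < 2 * h * r" using \<open>\<beta> > 0\<close> by (simp add: divide_less_eq mult_ac)
  moreover have "\<beta> * w\<^sup>2 - C * w + C\<^sup>2 / (4 * \<beta>) = \<beta> * (w - C / (2 * \<beta>))\<^sup>2"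
    using \<open>\<beta> > 0\<close> by (simp add: power2_eq_square field_simps)
  moreover have "\<beta> * (w - C / (2 * \<beta>))\<^sup>2 \<ge> 0" using \<open>\<beta> > 0\<close> by simp
  moreover have "8 * h * (r - w) \<ge> 8 * h * (r / 2)" using True assms by (intro mult_left_mono) auto
  moreover have "h * r > 0" using assms by simp
  ultimately show ?thesis by (simp add: algebra_simps)
next
  case False
  \<comment> \<open>Here \<open>w > r / 2\<close>, and the first summand of \<open>\<beta>\<close>
    makes \<open>\<beta> * w\<close> exceed \<open>C\<close>.\<close>
  have "C\<^sup>2 / (8 * h * r) \<ge> 0" using assms by simp
  then have "\<beta> > 2 * C / r" by (simp add: \<beta>_def)
  then have "\<beta> * w > 2 * C / r * w" using \<open>w > 0\<close> by (rule mult_strict_right_mono)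
  moreover have "2 * C / r * w \<ge> 2 * C / r * (r / 2)" using False assms by (intro mult_left_mono) auto
  moreover have "2 * C / r * (r / 2) = C" using assms by simp
  ultimately have "C < \<beta> * w" by linarith
  then have "C * w < \<beta> * w * w" using \<open>w > 0\<close> by (rule mult_strict_right_mono)
  moreover have "8 * h * (r - w) \<ge> 0" using assms by simp
  ultimately show ?thesis by (simp add: power2_eq_square)
qed

text \<open>A polynomial, hence \<open>C2_fun\<close> on the whole space, although it serves as a
  barrier only inside the ball, on whose boundary it vanishes. The outer square produces the term
  \<open>8 * ((q s x *v (x - a)) \<bullet> (x - a))\<close> in the operator, which stays positive at
  the boundary.\<close>

definition bump :: "real \<Rightarrow> real ^ 'n \<Rightarrow> real ^ 'n::finite \<Rightarrow> real" where
  "bump R a x = (R\<^sup>2 - (norm (x - a))\<^sup>2)\<^sup>2"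

lemma norm_add_axis_power2:
  "(norm (y + h *\<^sub>R axis i 1))\<^sup>2 = (norm y)\<^sup>2 + 2 * h * y $ i + h\<^sup>2"
  unfolding power2_norm_eq_inner
  by (simp add: inner_add_left inner_add_right inner_axis inner_axis' inner_axis_axis power2_eq_square distrib_left)

lemma partial_bump_line:
  "((\<lambda>h. bump R a (x + h *\<^sub>R axis i 1)) has_real_derivative - 4 * (R\<^sup>2 - (norm (x - a))\<^sup>2) * (x - a) $ i) (at 0)"
proof -
  have *: "bump R a (x + h *\<^sub>R axis i 1) = (R\<^sup>2 - ((norm (x - a))\<^sup>2 + 2 * h * (x - a) $ i + h\<^sup>2))\<^sup>2" for h
  proof -
    have "x + h *\<^sub>R axis i 1 - a = (x - a) + h *\<^sub>R axis i 1" by simp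
    then show ?thesis by (simp only: bump_def norm_add_axis_power2)
  qed
  show ?thesis unfolding * by (auto intro!: derivative_eq_intros simp: algebra_simps)
qed

lemma partial_bump: "partial i (bump R a) = (\<lambda>x. - 4 * (R\<^sup>2 - (norm (x - a))\<^sup>2) * (x - a) $ i)"
  by (intro ext has_real_derivative_imp_partial partial_bump_line)

lemma partial_partial_bump_line:
  "((\<lambda>h. partial j (bump R a) (x + h *\<^sub>R axis i 1)) has_real_derivative
     8 * (x - a) $ i * (x - a) $ j - (if i = j then 4 * (R\<^sup>2 - (norm (x - a))\<^sup>2) else 0)) (at 0)"
proof -
  have *: "partial j (bump R a) (x + h *\<^sub>R axis i 1) =
     - 4 * (R\<^sup>2 - ((norm (x - a))\<^sup>2 + 2 * h * (x - a) $ i + h\<^sup>2)) * ((x - a) $ j + h * (if i = j then 1 else 0))" for h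
  proof -
    have "x + h *\<^sub>R axis i 1 - a = (x - a) + h *\<^sub>R axis i 1" by simp
    moreover have "((x - a) + h *\<^sub>R axis i 1) $ j = (x - a) $ j + h * (if i = j then 1 else 0)"
      by (simp add: axis_def)
    ultimately show ?thesis by (simp only: partial_bump norm_add_axis_power2)
  qed
  show ?thesis unfolding * by (auto intro!: derivative_eq_intros)
qed

lemma partial_partial_bump:
  "partial i (partial j (bump R a)) =
     (\<lambda>x. 8 * (x - a) $ i * (x - a) $ j - (if i = j then 4 * (R\<^sup>2 - (norm (x - a))\<^sup>2) else 0))"
  by (intro ext has_real_derivative_imp_partial partial_partial_bump_line)

lemma C2_fun_bump: "C2_fun (bump R a)"
proof -
  have "continuous_on UNIV (\<lambda>x. - 4 * (R\<^sup>2 - (norm (x - a))\<^sup>2) * (x - a) $ i)" for i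
    by (intro continuous_intros)
  moreover have "continuous_on UNIV (\<lambda>x. 8 * (x - a) $ i * (x - a) $ j - (if i = j then 4 * (R\<^sup>2 - (norm (x - a))\<^sup>2) else 0))" for i j
    by (cases "i = j") (auto intro!: continuous_intros)
  moreover have "(\<lambda>h. bump R a (x + h *\<^sub>R axis i 1)) differentiable (at 0)" for x i
    unfolding real_differentiable_def by (rule exI, rule partial_bump_line)
  moreover have "(\<lambda>h. partial j (bump R a) (x + h *\<^sub>R axis i 1)) differentiable (at 0)" for x i j
    unfolding real_differentiable_def by (rule exI, rule partial_partial_bump_line)
  ultimately show ?thesis
    by (simp only: C2_fun_def C1_fun_def partial_partial_bump) (simp add: partial_bump)
qed

lemma diff_operator_bump:
  "diff_operator q b s (bump R a) x = 8 * ((q s x *v (x - a)) \<bullet> (x - a))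
     - 4 * (R\<^sup>2 - (norm (x - a))\<^sup>2) * ((\<Sum>i\<in>UNIV. q s x $ i $ i) + b s x \<bullet> (x - a))"
proof -
  have "(\<Sum>i\<in>UNIV. \<Sum>j\<in>UNIV. q s x $ i $ j * partial i (partial j (bump R a)) x) =
     8 * (\<Sum>i\<in>UNIV. \<Sum>j\<in>UNIV. q s x $ i $ j * (x - a) $ j * (x - a) $ i)
     - 4 * (R\<^sup>2 - (norm (x - a))\<^sup>2) * (\<Sum>i\<in>UNIV. q s x $ i $ i)"
    by (simp add: partial_partial_bump right_diff_distrib sum_subtractf sum_distrib_left mult_ac
        if_distrib[of "\<lambda>c. _ * c"] cong: if_cong)
  moreover have "(\<Sum>i\<in>UNIV. \<Sum>j\<in>UNIV. q s x $ i $ j * (x - a) $ j * (x - a) $ i) = (q s x *v (x - a)) \<bullet> (x - a)"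
    by (simp add: inner_vec_def matrix_vector_mult_def sum_distrib_right)
  moreover have "(\<Sum>i\<in>UNIV. b s x $ i * partial i (bump R a) x) = - 4 * (R\<^sup>2 - (norm (x - a))\<^sup>2) * (b s x \<bullet> (x - a))"
    by (simp add: partial_bump inner_vec_def sum_distrib_left sum_distrib_right mult_ac)
  ultimately show ?thesis by (simp add: diff_operator_def algebra_simps)
qed

lemma parabolic_Hoelder_loc_bounded:
  fixes f :: "real \<Rightarrow> real ^ 'n::finite \<Rightarrow> real"
  assumes "parabolic_Hoelder_loc \<alpha> f" "a < b" "0 < R"
  shows "\<exists>C. \<forall>s\<in>{a..b}. \<forall>x\<in>ball 0 R. \<bar>f s x\<bar> \<le> C"
proof -
  obtain C where *: "\<forall>s\<in>{a..b}. \<forall>t\<in>{a..b}. \<forall>x\<in>ball 0 R. \<forall>y\<in>ball 0 R.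
          \<bar>f s x\<bar> \<le> C \<and> \<bar>f s x - f t x\<bar> \<le> C * \<bar>s - t\<bar> powr (\<alpha> / 2) \<and>
          \<bar>f s x - f s y\<bar> \<le> C * dist x y powr \<alpha>"
    using assms unfolding parabolic_Hoelder_loc_def by (elim conjE allE impE exE)
  show ?thesis
  proof (intro exI[of _ C] ballI)
    fix s and x :: "real ^ 'n" assume s: "s \<in> {a..b}" and x: "x \<in> ball 0 R"
    show "\<bar>f s x\<bar> \<le> C"
      using bspec[OF bspec[OF bspec[OF bspec[OF * s] s] x] x] by (rule conjunct1)
  qed
qed

text \<open>The trace and the drift are what multiplies
  \<open>R\<^sup>2 - (norm (x - a))\<^sup>2\<close> in \<open>diff_operator_bump\<close>; the
  quadratic form of \<open>q\<close> is controlled from below by ellipticity instead.\<close>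

lemma H1_bounded:
  fixes q :: "real \<Rightarrow> real ^ 'n \<Rightarrow> real ^ 'n ^ 'n::finite"
  assumes H1: "H1 q b" and "a < a'" and "0 < R"
  obtains C where "\<And>s x. s \<in> {a..a'} \<Longrightarrow> x \<in> ball 0 R \<Longrightarrow> \<bar>\<Sum>i\<in>UNIV. q s x $ i $ i\<bar> + norm (b s x) \<le> C"
proof -
  obtain \<alpha> where H: "\<forall>i j. parabolic_Hoelder_loc \<alpha> (\<lambda>s x. q s x $ i $ j)"
       "\<forall>i. parabolic_Hoelder_loc \<alpha> (\<lambda>s x. b s x $ i)"
    using H1 unfolding H1_def by blast
  have "\<forall>i. \<exists>C. \<forall>s\<in>{a..a'}. \<forall>x\<in>ball 0 R. \<bar>q s x $ i $ i\<bar> \<le> C"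
    using parabolic_Hoelder_loc_bounded[OF H(1)[rule_format] assms(2,3)] by simp
  then obtain Cq where Cq': "\<forall>i. \<forall>s\<in>{a..a'}. \<forall>x\<in>ball 0 R. \<bar>q s x $ i $ i\<bar> \<le> Cq i"
    by (rule choice[THEN exE])
  have "\<forall>i. \<exists>C. \<forall>s\<in>{a..a'}. \<forall>x\<in>ball 0 R. \<bar>b s x $ i\<bar> \<le> C"
    using parabolic_Hoelder_loc_bounded[OF H(2)[rule_format] assms(2,3)] by simp
  then obtain Cb where Cb': "\<forall>i. \<forall>s\<in>{a..a'}. \<forall>x\<in>ball 0 R. \<bar>b s x $ i\<bar> \<le> Cb i"
    by (rule choice[THEN exE])
  note Cq = Cq'[rule_format] and Cb = Cb'[rule_format]
  show ?thesis
  proof (rule that[of "sum Cq UNIV + sum Cb UNIV"])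
    fix s x assume *: "s \<in> {a..a'}" "x \<in> ball (0::real^'n) R"
    have "\<bar>\<Sum>i\<in>UNIV. q s x $ i $ i\<bar> \<le> (\<Sum>i\<in>UNIV. \<bar>q s x $ i $ i\<bar>)" by (rule sum_abs)
    also have "\<dots> \<le> sum Cq UNIV" by (intro sum_mono Cq *)
    finally have "\<bar>\<Sum>i\<in>UNIV. q s x $ i $ i\<bar> \<le> sum Cq UNIV" .
    moreover have "norm (b s x) \<le> (\<Sum>i\<in>UNIV. \<bar>b s x $ i\<bar>)" by (rule norm_le_l1_cart)
    moreover have "(\<Sum>i\<in>UNIV. \<bar>b s x $ i\<bar>) \<le> sum Cb UNIV" by (intro sum_mono Cb *)
    ultimately show "\<bar>\<Sum>i\<in>UNIV. q s x $ i $ i\<bar> + norm (b s x) \<le> sum Cq UNIV + sum Cb UNIV" by linarith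
  qed
qed

lemma H2_elliptic:
  assumes "H2 q"
  shows "\<exists>h>0. \<forall>s x \<xi>. (q s x *v \<xi>) \<bullet> \<xi> \<ge> h * (norm \<xi>)\<^sup>2"
proof -
  obtain \<eta> where \<eta>: "(INF (s, x)\<in>UNIV. ereal (\<eta> s x)) > 0"
      "\<forall>s x \<xi>. (q s x *v \<xi>) \<bullet> \<xi> \<ge> \<eta> s x * (norm \<xi>)\<^sup>2"
    using assms unfolding H2_def by blast
  \<comment> \<open>The infimum is an extended real; a real number strictly between 0 and it serves
    as the ellipticity constant.\<close>
  from ereal_dense2[OF \<eta>(1)]
  obtain h where h: "0 < ereal h" "ereal h < (INF (s, x)\<in>UNIV. ereal (\<eta> s x))"
    by (elim exE conjE)
  have "h * (norm \<xi>)\<^sup>2 \<le> (q s x *v \<xi>) \<bullet> \<xi>" for s x \<xi>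
  proof -
    have "h \<le> \<eta> s x" using less_INF_D[OF h(2), of "(s, x)"] by simp
    then have "h * (norm \<xi>)\<^sup>2 \<le> \<eta> s x * (norm \<xi>)\<^sup>2" by (intro mult_right_mono) auto
    then show ?thesis using \<eta>(2) by (meson order_trans)
  qed
  then show ?thesis using h(1) by auto
qed

text \<open>
  The barrier lives on the tilted cylinder of radius \<open>R\<close> around the segment from \<open>(s, x0)\<close> to
  \<open>(t1, x1)\<close>, so that positivity is carried from \<open>x0\<close> to \<open>x1\<close> in a single step.
\<close>

lemma bounded_classical_solution_pos:
  fixes q :: "real \<Rightarrow> real ^ 'n \<Rightarrow> real ^ 'n ^ 'n::finite"
  assumes H1: "H1 q b" and H2: "H2 q" and H3: "H3 q b"
    and u: "bounded_classical_solution q b s \<phi> u"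
    and init: "\<And>x. \<phi> x \<ge> 0" and pos: "\<phi> x0 > 0" and cont: "continuous_on UNIV \<phi>" and "t1 > s"
  shows "u t1 x1 > 0"
proof -
  note U = bounded_classical_solutionD[OF u]
  have nonneg: "u t x \<ge> 0" if "t \<ge> s" for t x
    by (rule bounded_classical_solution_nonneg[OF H2 H3 u init that])
  obtain h where h: "h > 0" "\<forall>s x \<xi>. (q s x *v \<xi>) \<bullet> \<xi> \<ge> h * (norm \<xi>)\<^sup>2"
    using H2_elliptic[OF H2] by (elim exE conjE)
  define \<epsilon> where "\<epsilon> = \<phi> x0 / 2"
  have \<epsilon>: "\<epsilon> > 0" using pos by (simp add: \<epsilon>_def)
  have "isCont \<phi> x0" using cont by (simp add: continuous_on_eq_continuous_at)
  then obtain R0 where R0: "R0 > 0" "\<And>x. dist x x0 < R0 \<Longrightarrow> \<bar>\<phi> x - \<phi> x0\<bar> < \<epsilon>"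
    using \<epsilon> unfolding continuous_at_eps_delta dist_real_def by blast
  define R where "R = R0 / 2"
  have R: "R > 0" using R0(1) by (simp add: R_def)
  have \<phi>_low: "\<phi> x \<ge> \<epsilon>" if "norm (x - x0) \<le> R" for x
    using R0(2)[of x] that R0(1) by (simp add: dist_norm R_def \<epsilon>_def abs_if split: if_splits)
  \<comment> \<open>The velocity of the axis \<open>\<xi>\<close> of the tilted cylinder.\<close>
  define e where "e = (1 / (t1 - s)) *\<^sub>R (x1 - x0)"
  define \<xi> where "\<xi> t = x0 + (t - s) *\<^sub>R e" for t
  have \<xi>1: "\<xi> t1 = x1" using \<open>t1 > s\<close> by (simp add: \<xi>_def e_def)
  have \<xi>s: "\<xi> s = x0" by (simp add: \<xi>_def)
  \<comment> \<open>\<open>ball 0 L\<close> contains the whole cylinder, so the coefficients are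
    bounded there; the final 1 is present because the ball is open.\<close>
  define L where "L = norm x0 + (t1 - s) * norm e + R + 1"
  have L: "L > 0" unfolding L_def using R \<open>t1 > s\<close> by (intro add_nonneg_pos add_nonneg_nonneg) auto
  have \<xi>_bound: "norm (\<xi> t) \<le> norm x0 + (t1 - s) * norm e" if "s \<le> t" "t \<le> t1" for t
  proof -
    have "norm (\<xi> t) \<le> norm x0 + (t - s) * norm e"
      unfolding \<xi>_def using that norm_triangle_ineq[of x0 "(t - s) *\<^sub>R e"] by simp
    also have "\<dots> \<le> norm x0 + (t1 - s) * norm e" using that by (intro add_left_mono mult_right_mono) auto
    finally show ?thesis .
  qed
  have inball: "x \<in> ball 0 L" if "s \<le> t" "t \<le> t1" "norm (x - \<xi> t) \<le> R" for t x
    using \<xi>_bound[OF that(1,2)] norm_triangle_ineq[of "\<xi> t" "x - \<xi> t"] that(3) by (simp add: L_def)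
  obtain C0 where C0: "\<And>t x. t \<in> {s..t1} \<Longrightarrow> x \<in> ball 0 L \<Longrightarrow> \<bar>\<Sum>i\<in>UNIV. q t x $ i $ i\<bar> + norm (b t x) \<le> C0"
    using H1_bounded[OF H1 \<open>t1 > s\<close> L] by metis
  have "C0 \<ge> 0"
    by (rule order_trans[OF _ C0[of s 0]]) (use L \<open>t1 > s\<close> in auto)
  \<comment> \<open>\<open>C\<close> bounds the coefficient of \<open>w\<close> in the barrier
    inequality, made up of trace, drift and the motion of the axis. The final 1 makes it
    positive.\<close>
  define C where "C = 4 * (C0 + C0 * R + R * norm e) + 1"
  have C: "C > 0" unfolding C_def using \<open>C0 \<ge> 0\<close> R by (intro add_nonneg_pos mult_nonneg_nonneg add_nonneg_nonneg) auto
  define \<beta> where "\<beta> = 2 * C / R\<^sup>2 + C\<^sup>2 / (8 * h * R\<^sup>2) + 1"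
  have \<beta>: "\<beta> > 0" unfolding \<beta>_def using C R h by (intro add_nonneg_pos add_nonneg_nonneg) auto
  \<comment> \<open>Inside the cylinder \<open>bump\<close> is at most \<open>R^4\<close>, so the
    factor \<open>\<epsilon> / R^4\<close> keeps the barrier below \<open>\<epsilon>\<close>, hence
    below \<open>\<phi>\<close>, at the initial time.\<close>
  define k where "k t = \<epsilon> / R^4 * exp (- \<beta> * (t - s))" for t
  have k: "k t > 0" for t using \<epsilon> R by (simp add: k_def)
  define v where "v t x = k t * bump R (\<xi> t) x" for t x
  define Z where "Z t x = u t x + (-1) * v t x" for t x
  define D where "D = {(t, x). s \<le> t \<and> t \<le> t1 \<and> norm (x - \<xi> t) \<le> R}"
  have cont_\<xi>: "continuous_on A (\<lambda>p. \<xi> (fst p))" for A :: "(real \<times> (real ^ 'n)) set"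
    unfolding \<xi>_def by (intro continuous_intros)
  have "compact D"
  proof -
    have "D = {p. s \<le> fst p} \<inter> {p. fst p \<le> t1} \<inter> {p. norm (snd p - \<xi> (fst p)) \<le> R}"
      by (auto simp: D_def)
    moreover have "closed {p :: real \<times> (real ^ 'n). s \<le> fst p}" "closed {p :: real \<times> (real ^ 'n). fst p \<le> t1}"
      "closed {p. norm (snd p - \<xi> (fst p)) \<le> R}"
      by (intro closed_Collect_le continuous_intros cont_\<xi>)+
    moreover have "D \<subseteq> {s..t1} \<times> cball 0 L"
      using inball by (force simp: D_def)
    then have "bounded D"
      by (rule bounded_subset[rotated]) (auto intro: bounded_Times)
    ultimately show ?thesis by (auto simp: compact_eq_bounded_closed)
  qed
  have contZ: "continuous_on D (\<lambda>p. Z (fst p) (snd p))"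
  proof -
    have "continuous_on D (\<lambda>p. u (fst p) (snd p))"
      by (rule continuous_on_subset[OF U(2)[unfolded case_prod_beta']]) (auto simp: D_def)
    then show ?thesis
      unfolding Z_def v_def bump_def k_def by (intro continuous_intros cont_\<xi>)
  qed
  have top: "(t1, x1) \<in> D" using \<open>t1 > s\<close> R by (simp add: D_def \<xi>1)
  obtain t x where tx: "(t, x) \<in> D" "\<And>t' x'. (t', x') \<in> D \<Longrightarrow> Z t x \<le> Z t' x'"
    using continuous_attains_inf[OF \<open>compact D\<close> _ contZ] top by force
  have "Z t x \<ge> 0"
  proof (rule ccontr)
    assume Z: "\<not> Z t x \<ge> 0"
    have t: "s \<le> t" "t \<le> t1" and xR: "norm (x - \<xi> t) \<le> R" using tx(1) by (auto simp: D_def)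
    define w where "w = R\<^sup>2 - (norm (x - \<xi> t))\<^sup>2"
    have w: "0 \<le> w" "w \<le> R\<^sup>2" using xR by (auto simp: w_def power_mono)
    \<comment> \<open>On the lateral boundary the barrier vanishes and \<open>u\<close> is
      nonnegative, so a negative minimum lies inside.\<close>
    have "w \<noteq> 0"
      using Z nonneg[OF t(1), of x] by (auto simp: Z_def v_def bump_def w_def)
    with w have w0: "w > 0" by simp
    then have "(norm (x - \<xi> t))\<^sup>2 < R\<^sup>2" by (simp add: w_def)
    then have xR': "norm (x - \<xi> t) < R" using R by (simp add: power_less_imp_less_base)
    have "t \<noteq> s"
    proof
      assume [simp]: "t = s"
      have "w\<^sup>2 \<le> (R\<^sup>2)\<^sup>2" using w by (intro power_mono) auto
      then have "v t x \<le> \<epsilon> / R^4 * (R\<^sup>2)\<^sup>2"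
        unfolding v_def k_def bump_def w_def using \<epsilon> R by (intro mult_mono) auto
      also have "\<dots> = \<epsilon>" using R by (simp flip: power_mult)
      also have "\<epsilon> \<le> u t x" using \<phi>_low[of x] xR by (simp add: \<xi>s U(9))
      finally show False using Z by (simp add: Z_def)
    qed
    then have ts: "t > s" using t by simp
    define \<gamma> where "\<gamma> = R - norm (x - \<xi> t)"
    have \<gamma>: "\<gamma> > 0" using xR' by (simp add: \<gamma>_def)
    \<comment> \<open>\<open>\<gamma>\<close> is the distance to the lateral boundary; going back
      from \<open>t\<close> to \<open>\<tau>\<close> moves the axis by
      \<open>(t - \<tau>) * norm e\<close>, which must not use up this distance.\<close>
    define d where "d = min (t - s) (min \<gamma> (\<gamma> / (norm e + 1)))"
    have ne: "norm e + 1 > 0" by (simp add: add_nonneg_pos)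
    have d: "d > 0" using ts \<gamma> ne by (simp add: d_def)
    have min_space: "Z t x \<le> Z t y" if "dist x y < d" for y
    proof (rule tx(2))
      have "norm (y - \<xi> t) \<le> norm (x - \<xi> t) + norm (y - x)"
        using norm_triangle_ineq[of "x - \<xi> t" "y - x"] by simp
      then show "(t, y) \<in> D" using that t by (simp add: D_def d_def dist_norm norm_minus_commute \<gamma>_def)
    qed
    have min_time: "Z t x \<le> Z \<tau> x" if "t - d < \<tau>" "\<tau> \<le> t" for \<tau>
    proof (rule tx(2))
      have "norm (x - \<xi> \<tau>) \<le> norm (x - \<xi> t) + (t - \<tau>) * norm e"
      proof -
        have "x - \<xi> \<tau> = (x - \<xi> t) + (t - \<tau>) *\<^sub>R e" by (simp add: \<xi>_def algebra_simps)
        then have "norm (x - \<xi> \<tau>) \<le> norm (x - \<xi> t) + norm ((t - \<tau>) *\<^sub>R e)"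
          by (simp only: norm_triangle_ineq)
        then show ?thesis using that by simp
      qed
      moreover have "(t - \<tau>) * norm e \<le> (t - \<tau>) * (norm e + 1)" using that by (intro mult_left_mono) auto
      moreover have "(t - \<tau>) * (norm e + 1) \<le> \<gamma>"
      proof -
        have "t - \<tau> \<le> \<gamma> / (norm e + 1)" using that by (simp add: d_def)
        then show ?thesis using ne by (simp add: pos_le_divide_eq)
      qed
      ultimately show "(\<tau>, x) \<in> D" using that t by (simp add: D_def d_def \<gamma>_def)
    qed
    let ?B = "(\<Sum>i\<in>UNIV. q t x $ i $ i) + b t x \<bullet> (x - \<xi> t)"
    have vt: "((\<lambda>\<tau>. v \<tau> x) has_real_derivative k t * (- \<beta> * w\<^sup>2 + 4 * w * ((x - \<xi> t) \<bullet> e))) (at t)"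
    proof -
      have eq: "bump R (\<xi> \<tau>) x = (R\<^sup>2 - (x - \<xi> \<tau>) \<bullet> (x - \<xi> \<tau>))\<^sup>2" for \<tau>
        by (simp add: bump_def power2_norm_eq_inner)
      have w_eq: "w = R\<^sup>2 - (x - \<xi> t) \<bullet> (x - \<xi> t)" by (simp add: w_def power2_norm_eq_inner)
      have 1: "(k has_real_derivative - \<beta> * k t) (at t)"
      proof -
        have "((\<lambda>t. K * exp (- \<beta> * (t - s))) has_real_derivative - \<beta> * (K * exp (- \<beta> * (t - s)))) (at t)" for K
          by (auto intro!: derivative_eq_intros)
        then show ?thesis unfolding k_def .
      qed
      have "((\<lambda>\<tau>. x - \<xi> \<tau>) has_vector_derivative - e) (at t)"
        unfolding \<xi>_def by (auto intro!: derivative_eq_intros)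
      then have "((\<lambda>\<tau>. x - \<xi> \<tau>) has_derivative (\<lambda>h. h *\<^sub>R - e)) (at t)"
        by (simp add: has_vector_derivative_def)
      from has_derivative_inner[OF this this]
      have "((\<lambda>\<tau>. (x - \<xi> \<tau>) \<bullet> (x - \<xi> \<tau>)) has_derivative (*) (- 2 * ((x - \<xi> t) \<bullet> e))) (at t)"
        by (rule has_derivative_eq_rhs) (auto simp: fun_eq_iff inner_commute)
      then have "((\<lambda>\<tau>. (x - \<xi> \<tau>) \<bullet> (x - \<xi> \<tau>)) has_real_derivative - 2 * ((x - \<xi> t) \<bullet> e)) (at t)"
        by (simp add: has_field_derivative_def)
      then have 2: "((\<lambda>\<tau>. bump R (\<xi> \<tau>) x) has_real_derivative 4 * w * ((x - \<xi> t) \<bullet> e)) (at t)"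
        unfolding eq w_eq by (auto intro!: derivative_eq_intros)
      show ?thesis
        unfolding v_def using DERIV_mult[OF 1 2] by (simp add: eq w_eq algebra_simps)
    qed
    have "diff_operator q b t (u t) x - k t * (- \<beta> * w\<^sup>2 + 4 * w * ((x - \<xi> t) \<bullet> e)) \<le> diff_operator q b t (Z t) x"
    proof (rule diff_operator_ge_at_parabolic_min[OF H2, where z = Z])
      show "d > 0" by (rule d)
      show "Z t x \<le> Z t y" if "dist x y < d" for y using that by (rule min_space)
      show "Z t x \<le> Z \<tau> x" if "t - d < \<tau>" "\<tau> \<le> t" for \<tau> using that by (rule min_time)
      show "C2_fun (Z t)"
        unfolding Z_def v_def
        using C2_fun_add_scale[OF U(5)[OF ts] C2_fun_bump, of "- k t" R "\<xi> t"] by simp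
      show "((\<lambda>\<tau>. Z \<tau> x) has_real_derivative diff_operator q b t (u t) x - k t * (- \<beta> * w\<^sup>2 + 4 * w * ((x - \<xi> t) \<bullet> e))) (at t)"
        unfolding Z_def
        by (rule derivative_eq_intros bounded_classical_solution_has_derivative[OF u ts] vt refl)+ simp
    qed
    also have "diff_operator q b t (Z t) x = diff_operator q b t (u t) x - k t * (8 * ((q t x *v (x - \<xi> t)) \<bullet> (x - \<xi> t)) - 4 * w * ?B)"
      unfolding Z_def v_def
      using diff_operator_add_scale[OF U(5)[OF ts] C2_fun_bump, of q b t "- k t" R "\<xi> t" x]
      by (simp add: diff_operator_bump w_def)
    finally have "k t * (8 * ((q t x *v (x - \<xi> t)) \<bullet> (x - \<xi> t)) - 4 * w * ?B) \<le> k t * (- \<beta> * w\<^sup>2 + 4 * w * ((x - \<xi> t) \<bullet> e))"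
      by simp
    then have main: "8 * ((q t x *v (x - \<xi> t)) \<bullet> (x - \<xi> t)) - 4 * w * ?B \<le> - \<beta> * w\<^sup>2 + 4 * w * ((x - \<xi> t) \<bullet> e)"
      using k[of t] by simp
    have "4 * ((x - \<xi> t) \<bullet> e) + 4 * ?B \<le> C"
    proof -
      have "(x - \<xi> t) \<bullet> e \<le> norm (x - \<xi> t) * norm e" by (rule norm_cauchy_schwarz)
      also have "\<dots> \<le> R * norm e" using xR by (intro mult_right_mono) auto
      finally have 1: "(x - \<xi> t) \<bullet> e \<le> R * norm e" .
      have C0': "\<bar>\<Sum>i\<in>UNIV. q t x $ i $ i\<bar> + norm (b t x) \<le> C0"
        by (rule C0) (use t inball[OF t xR] in auto)
      have "b t x \<bullet> (x - \<xi> t) \<le> norm (b t x) * norm (x - \<xi> t)" by (rule norm_cauchy_schwarz)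
      also have "\<dots> \<le> C0 * R" using C0' xR \<open>C0 \<ge> 0\<close> by (intro mult_mono) auto
      finally have "b t x \<bullet> (x - \<xi> t) \<le> C0 * R" .
      moreover have "(\<Sum>i\<in>UNIV. q t x $ i $ i) \<le> C0"
        using C0' abs_ge_self[of "\<Sum>i\<in>UNIV. q t x $ i $ i"] norm_ge_zero[of "b t x"] by linarith
      ultimately show ?thesis using 1 by (simp add: C_def)
    qed
    then have "w * (4 * ((x - \<xi> t) \<bullet> e) + 4 * ?B) \<le> w * C" using w0 by (intro mult_left_mono) auto
    moreover have "(q t x *v (x - \<xi> t)) \<bullet> (x - \<xi> t) \<ge> h * (R\<^sup>2 - w)" using h(2)[rule_format, where s = t and x = x and \<xi> = "x - \<xi> t"] by (simp add: w_def)
    moreover have "- \<beta> * w\<^sup>2 + C * w - 8 * h * (R\<^sup>2 - w) < 0"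
      unfolding \<beta>_def by (rule quartic_bump_arith) (use C h R w0 w in auto)
    ultimately show False using main by (simp add: algebra_simps)
  qed
  then have "v t1 x1 \<le> u t1 x1" using tx(2)[OF top] by (simp add: Z_def)
  moreover have "v t1 x1 > 0" using k[of t1] R by (simp add: v_def bump_def \<xi>1)
  ultimately show ?thesis by simp
qed

section \<open>The periodic evolution operator\<close>

text \<open>Dini's theorem: the open sets \<open>{x. f n x < e}\<close> increase with
  \<open>n\<close> and cover \<open>K\<close>, so a single one of them contains
  \<open>K\<close>.\<close>

lemma dini_zero:
  fixes f :: "nat \<Rightarrow> 'a::topological_space \<Rightarrow> real"
  assumes cont: "\<And>n. continuous_on UNIV (f n)" and dec: "\<And>n x. f (Suc n) x \<le> f n x"
    and lim: "\<And>x. (\<lambda>n. f n x) \<longlonglongrightarrow> 0" and K: "compact K"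
  shows "uniform_limit K f (\<lambda>_. 0) sequentially"
proof (rule uniform_limitI)
  fix e :: real assume e: "e > 0"
  have anti: "decseq (\<lambda>n. f n x)" for x by (rule decseq_SucI) (rule dec)
  have nonneg: "f n x \<ge> 0" for n x using decseq_ge[OF anti lim] .
  define U where "U n = {x. f n x < e}" for n
  have open_U: "open (U n)" for n
    unfolding U_def by (intro open_Collect_less cont continuous_on_const)
  have cover: "K \<subseteq> (\<Union>n\<in>UNIV. U n)"
  proof
    fix x
    have "\<forall>\<^sub>F n in sequentially. f n x < e" by (rule order_tendstoD(2)[OF lim e])
    then obtain n where "f n x < e" by (meson eventually_sequentially order_refl)
    then show "x \<in> (\<Union>n\<in>UNIV. U n)" by (auto simp: U_def)
  qed
  obtain N where N: "finite N" "K \<subseteq> (\<Union>n\<in>N. U n)"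
    by (rule compactE_image[OF K open_U cover]) (rule that)
  show "\<forall>\<^sub>F n in sequentially. \<forall>x\<in>K. dist (f n x) 0 < e"
    unfolding eventually_sequentially
  proof (intro exI[of _ "Max (insert 0 N)"] allI impI ballI)
    fix n x assume n: "n \<ge> Max (insert 0 N)" and "x \<in> K"
    then obtain k where k: "k \<in> N" "f k x < e" using N by (auto simp: U_def)
    have "k \<le> Max (insert 0 N)" using k N by (intro Max_ge) auto
    with n have "f n x \<le> f k x" by (intro decseqD[OF anti]) simp
    then show "dist (f n x) 0 < e" using k nonneg[of n x] by simp
  qed
qed

lemma bcontfun_le_norm: "apply_bcontfun f x \<le> norm f" "- norm f \<le> apply_bcontfun f x"
  for f :: "'a::topological_space \<Rightarrow>\<^sub>C real"
  using norm_bounded[of f x] by (auto simp: abs_le_iff)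

lemma compact_map_subsequence:
  fixes F :: "'a::real_normed_vector \<Rightarrow> 'b::metric_space"
  assumes "compact_map F" and M: "\<And>n. norm (f n) \<le> M"
  obtains l r where "strict_mono (r :: nat \<Rightarrow> nat)" "(\<lambda>n. F (f (r n))) \<longlonglongrightarrow> l"
proof -
  have "bounded (range f)" using M by (intro boundedI[where B = M]) auto
  then have "compact (closure (F ` range f))"
    using assms(1) by (simp add: compact_map_def)
  then have c: "seq_compact (closure (F ` range f))" by (rule compact_imp_seq_compact)
  have mem: "\<forall>n. F (f n) \<in> closure (F ` range f)"
    by (intro allI closure_subset[THEN subsetD] imageI rangeI)
  obtain l r where "strict_mono (r :: nat \<Rightarrow> nat)" "((\<lambda>n. F (f n)) \<circ> r) \<longlonglongrightarrow> l"
    by (rule seq_compactE[OF c mem])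
  then show thesis by (intro that) (simp_all add: o_def)
qed

text \<open>Zero on the ball of radius \<open>n\<close> and one outside radius \<open>n + 1\<close>.
  There are two uses: \<open>G t s (cutoff n)\<close> measures the mass that goes to infinity, and
  on \<open>real ^ 'n\<close> the cutoffs are a bounded sequence without norm-convergent
  subsequence, which obstructs inverting a compact operator.\<close>

definition cutoff :: "nat \<Rightarrow> 'a::real_normed_vector \<Rightarrow>\<^sub>C real" where
  "cutoff n = Bcontfun (\<lambda>x. min 1 (max 0 (norm x - n)))"

lemma apply_cutoff: "apply_bcontfun (cutoff n) x = min 1 (max 0 (norm x - n))"
proof -
  have "(\<lambda>x::'a. min 1 (max 0 (norm x - n))) \<in> bcontfun"
    by (rule bcontfun_normI[where b = 1]) (auto intro!: continuous_intros)
  then show ?thesis by (simp add: cutoff_def Bcontfun_inverse)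
qed

locale periodic_parabolic =
  fixes q :: "real \<Rightarrow> real ^ 'n \<Rightarrow> real ^ 'n ^ 'n::finite"
    and b :: "real \<Rightarrow> real ^ 'n \<Rightarrow> real ^ 'n"
    and G :: "real \<Rightarrow> real \<Rightarrow> 'n Cb \<Rightarrow> 'n Cb"
    and T :: real
  assumes T_pos: "T > 0"
    and q_periodic: "\<And>s x. q (s + T) x = q s x"
    and b_periodic: "\<And>s x. b (s + T) x = b s x"
    and H1: "H1 q b" and H2: "H2 q" and H3: "H3 q b"
    and evolution: "evolution_operator q b G"
    and compact: "\<And>s t. s < t \<Longrightarrow> compact_map (G t s)"
begin

section \<open>Evolution law, periodicity and positivity\<close>

lemma solution: "bounded_classical_solution q b s (apply_bcontfun \<phi>) (\<lambda>t. apply_bcontfun (G t s \<phi>))"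
  using evolution by (simp add: evolution_operator_def)

text \<open>The algebraic laws of \<open>G\<close> follow from it by exhibiting a second solution
  with the same datum.\<close>

lemma G_unique:
  assumes "bounded_classical_solution q b s (apply_bcontfun \<phi>) u" "t \<ge> s"
  shows "apply_bcontfun (G t s \<phi>) x = u t x"
  by (rule bounded_classical_solution_unique[OF H2 H3 solution assms])

lemma G_refl: "G s s \<phi> = \<phi>"
  by (rule bcontfun_eqI) (rule bounded_classical_solutionD(9)[OF solution])

lemma G_add_scale: "t \<ge> s \<Longrightarrow> G t s (\<phi> + a *\<^sub>R \<psi>) = G t s \<phi> + a *\<^sub>R G t s \<psi>"
  using G_unique[of s "\<phi> + a *\<^sub>R \<psi>" "\<lambda>t x. G t s \<phi> x + a * G t s \<psi> x" t]
    bounded_classical_solution_add_scale[OF solution[of s \<phi>] solution[of s \<psi>], of a]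
  by (intro bcontfun_eqI) simp

lemma G_const: "t \<ge> s \<Longrightarrow> G t s (const_bcontfun c) = const_bcontfun c"
  using G_unique[of s "const_bcontfun c" "\<lambda>_ _. c" t] bounded_classical_solution_const[of q b s c]
  by (intro bcontfun_eqI) simp

lemma G_comp:
  assumes "s \<le> r" "r \<le> t"
  shows "G t r (G r s \<phi>) = G t s \<phi>"
proof (rule bcontfun_eqI)
  fix x
  have "bounded_classical_solution q b r (apply_bcontfun (G r s \<phi>)) (\<lambda>t. apply_bcontfun (G t s \<phi>))"
    by (rule bounded_classical_solution_restrict[OF solution assms(1)])
  then show "apply_bcontfun (G t r (G r s \<phi>)) x = apply_bcontfun (G t s \<phi>) x"
    by (rule G_unique[OF _ assms(2)])
qed

lemma G_shift:
  assumes "s \<le> t"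
  shows "G (t + T) (s + T) \<phi> = G t s \<phi>"
proof (rule bcontfun_eqI)
  fix x
  have "bounded_classical_solution q b s (apply_bcontfun \<phi>) (\<lambda>t. apply_bcontfun (G (t + T) (s + T) \<phi>))"
    by (rule bounded_classical_solution_shift[where u = "\<lambda>t. apply_bcontfun (G t (s + T) \<phi>)"])
       (rule solution q_periodic b_periodic)+
  from G_unique[OF this assms, of x]
  show "apply_bcontfun (G (t + T) (s + T) \<phi>) x = apply_bcontfun (G t s \<phi>) x" by (rule sym)
qed

lemma G_shift_nat: "s \<le> t \<Longrightarrow> G (t + real k * T) (s + real k * T) \<phi> = G t s \<phi>"
proof (induction k)
  case (Suc k)
  then show ?case
    using G_shift[of "s + real k * T" "t + real k * T" \<phi>] by (simp add: algebra_simps)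
qed simp

lemma G_shift_int: "s \<le> t \<Longrightarrow> G (t + of_int k * T) (s + of_int k * T) \<phi> = G t s \<phi>"
proof (cases "k \<ge> 0")
  case True
  then show "s \<le> t \<Longrightarrow> ?thesis" using G_shift_nat[of s t "nat k" \<phi>] by simp
next
  case False
  then show "s \<le> t \<Longrightarrow> ?thesis"
    using G_shift_nat[of "s + of_int k * T" "t + of_int k * T" "nat (- k)" \<phi>] by simp
qed

lemma G_nonneg: "t \<ge> s \<Longrightarrow> (\<And>x. \<phi> x \<ge> 0) \<Longrightarrow> G t s \<phi> x \<ge> 0"
  for \<phi> :: "'n Cb"
  by (rule bounded_classical_solution_nonneg[OF H2 H3 solution])

lemma G_diff: "t \<ge> s \<Longrightarrow> G t s (\<phi> - \<psi>) = G t s \<phi> - G t s \<psi>"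
  using G_add_scale[of s t \<phi> "-1" \<psi>] by simp

lemma G_scale: "t \<ge> s \<Longrightarrow> G t s (a *\<^sub>R \<psi>) = a *\<^sub>R G t s \<psi>"
  using G_add_scale[of s t 0 a \<psi>] G_const[of s t 0] by simp

lemma G_mono: "t \<ge> s \<Longrightarrow> (\<And>x. \<phi> x \<le> \<psi> x) \<Longrightarrow> G t s \<phi> x \<le> G t s \<psi> x"
  for \<phi> \<psi> :: "'n Cb"
  using G_nonneg[of s t "\<psi> - \<phi>" x] by (simp add: G_diff)

lemma G_norm_le: 
  assumes "t \<ge> s"
  shows "norm (G t s \<phi>) \<le> norm \<phi>"
proof (rule norm_bound)
  fix x
  show "norm (G t s \<phi> x) \<le> norm \<phi>"
    using G_mono[OF assms, of \<phi> "const_bcontfun (norm \<phi>)" x] G_mono[OF assms, of "const_bcontfun (- norm \<phi>)" \<phi> x]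
    by (simp add: G_const[OF assms] bcontfun_le_norm abs_le_iff)
qed

lemma G_bounded_linear: "t \<ge> s \<Longrightarrow> bounded_linear (G t s)"
  using G_add_scale[of s t _ 1] G_scale[of s t] G_norm_le[of s t]
  by (intro bounded_linear_intro[where K = 1]) auto

lemma G_pos:
  fixes \<phi> :: "'n Cb"
  assumes "s < t" "\<And>x. \<phi> x \<ge> 0" "\<phi> x0 > 0"
  shows "G t s \<phi> x > 0"
proof (rule bounded_classical_solution_pos[OF H1 H2 H3 solution])
  show "0 \<le> apply_bcontfun \<phi> x" for x by (rule assms(2))
  show "0 < apply_bcontfun \<phi> x0" by (rule assms(3))
qed (simp_all add: assms(1))

text \<open>Inside a large ball \<open>\<phi> n\<close> is small, outside it the bound
  \<open>M\<close> is below \<open>\<delta> * W\<close>; hence \<open>\<phi> n\<close> and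
  \<open>- \<phi> n\<close> are both at most \<open>e2 + \<delta> * W\<close>, and the comparison
  principle carries this to time \<open>t\<close>. The choice of \<open>\<delta>\<close> depends on
  \<open>W x\<close>, so the argument gives no uniformity in \<open>x\<close>.\<close>

lemma G_tendsto_zero_pointwise:
  fixes \<phi> :: "nat \<Rightarrow> 'n Cb"
  assumes "s \<le> t" and M: "\<And>n. norm (\<phi> n) \<le> M"
    and lim: "\<And>R. uniform_limit (cball 0 R) (\<lambda>n. apply_bcontfun (\<phi> n)) (\<lambda>_. 0) sequentially"
  shows "(\<lambda>n. G t s (\<phi> n) x) \<longlonglongrightarrow> 0"
proof (rule tendstoI)
  fix e :: real assume "e > 0"
  define e2 where "e2 = e / 3"
  have e2: "e2 > 0" using \<open>e > 0\<close> by (simp add: e2_def)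
  obtain W c where W: "lyapunov q b W c" using H3_lyapunov[OF H3] .
  then have W0: "W x > 0" "filterlim W at_top at_infinity" for x by (simp_all add: lyapunov_def)
  define k where "k = exp (c * (t - s)) * W x"
  have k: "k > 0" using W0 by (simp add: k_def)
  \<comment> \<open>The contribution \<open>\<delta> * k\<close> of \<open>W\<close> at
    \<open>x\<close> becomes exactly \<open>e2\<close>.\<close>
  define \<delta> where "\<delta> = e2 / k"
  have \<delta>: "\<delta> > 0" using k e2 by (simp add: \<delta>_def)
  have "\<forall>\<^sub>F x in at_infinity. W x > M / \<delta>"
    using W0(2) by (simp add: filterlim_at_top_dense)
  then obtain R where R: "\<And>x. norm x \<ge> R \<Longrightarrow> W x > M / \<delta>"
    unfolding eventually_at_infinity by blast
  show "\<forall>\<^sub>F n in sequentially. dist (G t s (\<phi> n) x) 0 < e"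
    using uniform_limitD[OF lim e2, of R]
  proof eventually_elim
    case (elim n)
    have low: "\<bar>\<phi> n y\<bar> \<le> e2 + \<delta> * W y" for y
    proof (cases "norm y \<le> R")
      case True
      then have "\<bar>\<phi> n y\<bar> < e2" using elim by (simp add: dist_norm)
      moreover have "\<delta> * W y > 0" using \<delta> W0(1) by simp
      ultimately show ?thesis by linarith
    next
      case False
      then have "M < \<delta> * W y" using R[of y] \<delta> by (simp add: field_simps)
      moreover have "\<bar>\<phi> n y\<bar> \<le> M" using norm_bounded[of "\<phi> n" y] M[of n] by simp
      ultimately show ?thesis using e2 by linarith
    qed
    have "(e2 + a * G t s (\<phi> n) x) + \<delta> * exp (c * (t - s)) * W x \<ge> 0" if "\<bar>a\<bar> = 1" for a
    proof (rule comparison_lyapunov[OF H2 W bounded_classical_solution_add_scale[OF bounded_classical_solution_const solution] \<delta> _ \<open>s \<le> t\<close>])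
      fix y
      have "\<bar>a * \<phi> n y\<bar> = \<bar>\<phi> n y\<bar>" using that by (simp add: abs_mult)
      then show "0 \<le> e2 + a * \<phi> n y + \<delta> * W y" using low[of y] by linarith
    qed
    from this[of 1] this[of "-1"]
    have "\<bar>G t s (\<phi> n) x\<bar> \<le> e2 + \<delta> * k" by (simp add: k_def mult_ac)
    also have "\<delta> * k = e2" using k by (simp add: \<delta>_def)
    finally show ?case using e2 by (simp add: e2_def)
  qed
qed

text \<open>Compactness upgrades pointwise to norm convergence: a subsequence that stays away from 0
  would have a norm-convergent subsequence, whose limit must be the pointwise limit 0.\<close>

lemma G_tendsto_zero:
  fixes \<phi> :: "nat \<Rightarrow> 'n Cb"
  assumes "s < t" and M: "\<And>n. norm (\<phi> n) \<le> M"
    and lim: "\<And>R. uniform_limit (cball 0 R) (\<lambda>n. apply_bcontfun (\<phi> n)) (\<lambda>_. 0) sequentially"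
  shows "(\<lambda>n. G t s (\<phi> n)) \<longlonglongrightarrow> 0"
proof (rule ccontr)
  assume "\<not> ?thesis"
  then obtain e where e: "e > 0" "\<not> (\<forall>\<^sub>F n in sequentially. dist (G t s (\<phi> n)) 0 < e)"
    unfolding tendsto_iff by blast
  then have "infinite {n. \<not> dist (G t s (\<phi> n)) 0 < e}"
    by (simp add: eventually_cofinite flip: cofinite_eq_sequentially)
  then obtain r :: "nat \<Rightarrow> nat" where r: "strict_mono r" "\<And>n. \<not> dist (G t s (\<phi> (r n))) 0 < e"
    using infinite_enumerate by blast
  obtain l r' where l: "strict_mono r'" "(\<lambda>n. G t s (\<phi> (r (r' n)))) \<longlonglongrightarrow> l"
    using compact_map_subsequence[OF compact[OF \<open>s < t\<close>], of "\<lambda>n. \<phi> (r n)" M] M by blast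
  have "l x = 0" for x
  proof -
    have "(\<lambda>n. G t s (\<phi> n) x) \<longlonglongrightarrow> 0"
      using assms by (intro G_tendsto_zero_pointwise) auto
    then have "((\<lambda>n. G t s (\<phi> n) x) \<circ> (r \<circ> r')) \<longlonglongrightarrow> 0"
      by (rule LIMSEQ_subseq_LIMSEQ[OF _ strict_mono_o[OF r(1) l(1)]])
    moreover have "(\<lambda>n. apply_bcontfun (G t s (\<phi> (r (r' n)))) x) \<longlonglongrightarrow> apply_bcontfun l x"
      by (rule tendsto_uniform_limitI[OF tendsto_bcontfun_uniform_limit[OF l(2)]]) simp
    ultimately show ?thesis
      unfolding o_def by (rule LIMSEQ_unique[rotated])
  qed
  then have "l = 0" by (intro bcontfun_eqI) simp
  then have "(\<lambda>n. dist (G t s (\<phi> (r (r' n)))) 0) \<longlonglongrightarrow> 0"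
    using tendsto_dist[OF l(2) tendsto_const[of 0]] by (simp add: o_def)
  then have "\<forall>\<^sub>F n in sequentially. dist (G t s (\<phi> (r (r' n)))) 0 < e"
    by (rule order_tendstoD(2)) (rule e)
  then show False using r(2) by simp
qed

section \<open>The period map and its contraction of oscillations\<close>

definition V :: "'n Cb \<Rightarrow> 'n Cb" where "V = G T 0"

lemma V_G: "V = G (of_int k * T + T) (of_int k * T)"
  using G_shift_int[of 0 T k] T_pos by (auto simp: V_def fun_eq_iff add_ac)

lemma
  fixes \<phi> \<psi> :: "'n Cb"
  shows V_linear: "bounded_linear V"
  and V_const: "V (const_bcontfun c) = const_bcontfun c"
  and V_mono: "(\<And>x. \<phi> x \<le> \<psi> x) \<Longrightarrow> V \<phi> x \<le> V \<psi> x"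
  and V_norm_le: "norm (V \<phi>) \<le> norm \<phi>"
  and V_compact: "compact_map V"
  unfolding V_def using T_pos
  by (auto intro!: G_bounded_linear G_const G_mono G_norm_le compact)

text \<open>Norm convergence here expresses tightness: the mass moved beyond radius \<open>n\<close>
  between \<open>s\<close> and \<open>t\<close> is small uniformly in the starting point.\<close>

lemma cutoff_tendsto_zero: "s < t \<Longrightarrow> (\<lambda>n. G t s (cutoff n)) \<longlonglongrightarrow> 0"
proof (rule G_tendsto_zero)
  show "norm (cutoff n :: 'n Cb) \<le> 1" for n
    by (rule norm_bound) (simp add: apply_cutoff)
  show "uniform_limit (cball 0 R) (\<lambda>n. apply_bcontfun (cutoff n :: 'n Cb)) (\<lambda>_. 0) sequentially" for R
  proof (rule uniform_limitI)
    fix e :: real assume "e > 0"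
    obtain N where N: "R \<le> real N" using real_arch_simple by blast
    show "\<forall>\<^sub>F n in sequentially. \<forall>x\<in>cball 0 R. dist (apply_bcontfun (cutoff n :: 'n Cb) x) 0 < e"
      unfolding eventually_sequentially
    proof (intro exI[of _ N] allI impI ballI)
      fix n and x :: "real ^ 'n" assume "n \<ge> N" "x \<in> cball 0 R"
      then have "norm x \<le> real n" using N by simp
      then show "dist (apply_bcontfun (cutoff n :: 'n Cb) x) 0 < e" using \<open>e > 0\<close> by (simp add: apply_cutoff)
    qed
  qed
qed

text \<open>
  \<open>V\<close> maps the cutoff functions to a null sequence in norm, hence sees at least half of the mass of
  a fixed ball from every point; this makes the pointwise lower bound uniform.
\<close>

lemma V_V_uniformly_pos:
  fixes \<phi> :: "'n Cb"
  assumes nonneg: "\<And>x. \<phi> x \<ge> 0" and "\<phi> x0 > 0"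
  shows "\<exists>\<delta>>0. \<forall>x. V (V \<phi>) x \<ge> \<delta>"
proof -
  have "(\<lambda>n. V (cutoff n)) \<longlonglongrightarrow> 0" unfolding V_def by (rule cutoff_tendsto_zero[OF T_pos])
  then have "\<forall>\<^sub>F n in sequentially. dist (V (cutoff n)) 0 < 1 / 2" by (rule tendstoD) simp
  then obtain n where n: "norm (V (cutoff n)) < 1 / 2"
    by (auto simp: eventually_sequentially)
  have pos: "V \<phi> x > 0" for x unfolding V_def by (rule G_pos[OF T_pos assms])
  have "\<exists>y\<in>cball 0 (real n + 1). \<forall>x\<in>cball 0 (real n + 1). V \<phi> y \<le> V \<phi> x"
    by (rule continuous_attains_inf) auto
  then obtain y where y: "\<forall>x\<in>cball 0 (real n + 1). V \<phi> y \<le> V \<phi> x" by blast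
  define \<delta> where "\<delta> = V \<phi> y"
  have \<delta>: "\<delta> > 0" using pos by (simp add: \<delta>_def)
  \<comment> \<open>Radius \<open>n + 1\<close> is where the cutoff reaches 1: outside it the
    minorant \<open>\<delta> * (1 - cutoff n)\<close> vanishes, inside it the minimum
    \<open>\<delta>\<close> of \<open>V \<phi>\<close> suffices.\<close>
  have low: "(const_bcontfun \<delta> - \<delta> *\<^sub>R cutoff n) x \<le> V \<phi> x" for x
  proof (cases "norm x \<le> real n + 1")
    case True
    have "\<delta> * apply_bcontfun (cutoff n) x \<ge> 0" using \<delta> by (simp add: apply_cutoff)
    moreover have "\<delta> \<le> V \<phi> x" using y True by (simp add: \<delta>_def)
    ultimately show ?thesis by simp
  next
    case False
    then have "apply_bcontfun (cutoff n) x = 1" by (simp add: apply_cutoff)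
    then show ?thesis using pos[of x] by simp
  qed
  have "\<delta> / 2 \<le> V (V \<phi>) x" for x
  proof -
    have "V (cutoff n) x \<le> 1 / 2" using bcontfun_le_norm(1)[of "V (cutoff n)" x] n by simp
    then have "\<delta> * V (cutoff n) x \<le> \<delta> * (1 / 2)" using \<delta> by (intro mult_left_mono) auto
    moreover have "V (const_bcontfun \<delta> - \<delta> *\<^sub>R cutoff n) x \<le> V (V \<phi>) x" by (rule V_mono[OF low])
    moreover have "V (const_bcontfun \<delta> - \<delta> *\<^sub>R cutoff n) x = \<delta> - \<delta> * V (cutoff n) x"
      by (simp add: bounded_linear.linear[OF V_linear] linear_diff linear_scale V_const)
    ultimately show ?thesis by simp
  qed
  then show ?thesis using \<delta> by (intro exI[of _ "\<delta> / 2"]) simp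
qed

text \<open>
  For a sequence of counterexamples a limit point \<open>g\<close> of \<open>V \<phi>\<^sub>n\<close> either vanishes, so that
  \<open>V\<^sup>3 \<phi>\<^sub>n\<close> tends to \<open>0\<close>, or \<open>V\<^sup>2 g\<close> is bounded below; both contradict oscillations close to \<open>1\<close>.
\<close>

lemma V_oscillation:
  "\<exists>\<rho>>0. \<rho> < 1 \<and>
    (\<forall>\<phi>::'n Cb. (\<forall>x. 0 \<le> apply_bcontfun \<phi> x \<and> apply_bcontfun \<phi> x \<le> 1) \<longrightarrow>
      (\<exists>a. \<forall>x. a \<le> apply_bcontfun (V (V (V \<phi>))) x \<and> apply_bcontfun (V (V (V \<phi>))) x \<le> a + \<rho>))"
proof (rule ccontr)
  assume neg: "\<not> ?thesis"
  define P where "P \<rho> \<phi> \<longleftrightarrow> (\<forall>x. 0 \<le> apply_bcontfun \<phi> x \<and> apply_bcontfun \<phi> x \<le> 1) \<and>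
     (\<forall>a. \<exists>x. \<not> (a \<le> apply_bcontfun (V (V (V \<phi>))) x \<and> apply_bcontfun (V (V (V \<phi>))) x \<le> a + \<rho>))" for \<rho> and \<phi> :: "'n Cb"
  have ex: "\<exists>\<phi>. P \<rho> \<phi>" if "0 < \<rho>" "\<rho> < 1" for \<rho>
  proof (rule ccontr)
    assume nP: "\<not> (\<exists>\<phi>. P \<rho> \<phi>)"
    have osc: "\<forall>\<phi>. (\<forall>x. 0 \<le> apply_bcontfun \<phi> x \<and> apply_bcontfun \<phi> x \<le> 1) \<longrightarrow>
        (\<exists>a. \<forall>x. a \<le> apply_bcontfun (V (V (V \<phi>))) x \<and> apply_bcontfun (V (V (V \<phi>))) x \<le> a + \<rho>)"
    proof (intro allI impI, rule ccontr)
      fix \<phi>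
      assume "\<forall>x. 0 \<le> apply_bcontfun \<phi> x \<and> apply_bcontfun \<phi> x \<le> 1"
        "\<not> (\<exists>a. \<forall>x. a \<le> apply_bcontfun (V (V (V \<phi>))) x \<and> apply_bcontfun (V (V (V \<phi>))) x \<le> a + \<rho>)"
      then have "P \<rho> \<phi>" unfolding P_def by simp
      with nP show False by blast
    qed
    show False by (rule notE[OF neg]) (intro exI[of _ \<rho>] conjI that osc)
  qed
  \<comment> \<open>Counterexamples for \<open>\<rho>\<close> tending to 1; the shift by 2 keeps
    \<open>\<rho>\<close> inside \<open>(0, 1)\<close> from \<open>n = 0\<close> on.\<close>
  have "\<forall>n. \<exists>\<phi>. P (1 - 1 / real (n + 2)) \<phi>"
    by (intro allI ex) (simp_all add: field_simps)
  then obtain \<phi> where \<phi>: "\<forall>n. P (1 - 1 / real (n + 2)) (\<phi> n)" by (rule choice[THEN exE])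
  then have \<phi>01: "0 \<le> apply_bcontfun (\<phi> n) x" "apply_bcontfun (\<phi> n) x \<le> 1" for n x by (simp_all add: P_def)
  have "norm (\<phi> n) \<le> 1" for n
    using \<phi>01[of n] by (intro norm_bound) simp
  then obtain g r where r: "strict_mono r" and g: "(\<lambda>n. V (\<phi> (r n))) \<longlonglongrightarrow> g"
    using compact_map_subsequence[OF V_compact, of \<phi> 1] by blast
  have glim: "(\<lambda>n. apply_bcontfun (V (\<phi> (r n))) x) \<longlonglongrightarrow> apply_bcontfun g x" for x
    using tendsto_uniform_limitI[OF tendsto_bcontfun_uniform_limit[OF g], of x] by (simp add: o_def)
  have V01: "0 \<le> apply_bcontfun (V (\<phi> n)) x" for n x
    using V_mono[of "const_bcontfun 0" "\<phi> n" x] \<phi>01 by (simp add: V_const del: const_bcontfun_0_eq_0)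
  have V3_le: "apply_bcontfun (V (V (V (\<phi> n)))) x \<le> 1" and V3_ge: "0 \<le> apply_bcontfun (V (V (V (\<phi> n)))) x" for n x
  proof -
    have 1: "\<And>x. apply_bcontfun (V (\<phi> n)) x \<le> 1" using V_mono[of "\<phi> n" "const_bcontfun 1"] \<phi>01 by (simp add: V_const)
    have 2: "\<And>x. apply_bcontfun (V (V (\<phi> n))) x \<le> 1" using V_mono[of "V (\<phi> n)" "const_bcontfun 1"] 1 by (simp add: V_const)
    show "apply_bcontfun (V (V (V (\<phi> n)))) x \<le> 1" using V_mono[of "V (V (\<phi> n))" "const_bcontfun 1"] 2 by (simp add: V_const)
    have 2: "\<And>x. apply_bcontfun (V (V (\<phi> n))) x \<ge> 0" using V_mono[of "const_bcontfun 0" "V (\<phi> n)"] V01 by (simp add: V_const del: const_bcontfun_0_eq_0)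
    show "0 \<le> apply_bcontfun (V (V (V (\<phi> n)))) x" using V_mono[of "const_bcontfun 0" "V (V (\<phi> n))"] 2 by (simp add: V_const del: const_bcontfun_0_eq_0)
  qed
  have g0: "apply_bcontfun g x \<ge> 0" for x
    by (rule LIMSEQ_le_const[OF glim]) (use V01 in auto)
  have no: False if "\<eta> > 0" "\<And>x. a \<le> apply_bcontfun (V (V (V (\<phi> n)))) x"
      "\<And>x. apply_bcontfun (V (V (V (\<phi> n)))) x \<le> a + (1 - \<eta>)" "1 / real (n + 2) < \<eta>" for \<eta> a n
  proof -
    obtain x where "\<not> (a \<le> apply_bcontfun (V (V (V (\<phi> n)))) x \<and> apply_bcontfun (V (V (V (\<phi> n)))) x \<le> a + (1 - 1 / real (n + 2)))"
      using \<phi>[rule_format, of n, unfolded P_def, THEN conjunct2, THEN spec, of a] by (rule exE)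
    then show False using that(2)[of x] that(3)[of x] that(4) by linarith
  qed
  have small: "\<forall>\<^sub>F n in sequentially. 1 / real (r n + 2) < \<eta>" if "\<eta> > 0" for \<eta>
  proof -
    have "(\<lambda>n. 1 / real (n + 2)) \<longlonglongrightarrow> 0" 
      using LIMSEQ_ignore_initial_segment[OF lim_1_over_n, of 2] by simp
    then have "((\<lambda>n. 1 / real (n + 2)) \<circ> r) \<longlonglongrightarrow> 0" by (rule LIMSEQ_subseq_LIMSEQ[OF _ r])
    then show ?thesis using order_tendstoD(2)[OF _ that] by (simp add: o_def)
  qed
  \<comment> \<open>Two applications of the contraction \<open>V\<close> carry the closeness of
    \<open>V (\<phi> (r n))\<close> and \<open>g\<close> to the third power.\<close>
  have dist: "\<bar>apply_bcontfun (V (V (V (\<phi> (r n))))) x - apply_bcontfun (V (V g)) x\<bar> \<le> norm (V (\<phi> (r n)) - g)" for n x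
  proof -
    have "V (V (V (\<phi> (r n)))) - V (V g) = V (V (V (\<phi> (r n)) - g))"
      by (simp add: bounded_linear.linear[OF V_linear] linear_diff)
    then have "norm (V (V (V (\<phi> (r n)))) - V (V g)) \<le> norm (V (\<phi> (r n)) - g)"
      using order_trans[OF V_norm_le V_norm_le] by simp
    then show ?thesis
      using norm_bounded[of "V (V (V (\<phi> (r n)))) - V (V g)" x] by simp
  qed
  have close: "\<forall>\<^sub>F n in sequentially. norm (V (\<phi> (r n)) - g) < \<eta>" if "\<eta> > 0" for \<eta>
    using tendstoD[OF g that] by (simp add: o_def dist_norm)
  show False
  proof (cases "\<exists>x0. apply_bcontfun g x0 > 0")
    case True
    then obtain \<delta> where \<delta>: "\<delta> > 0" "\<And>x. apply_bcontfun (V (V g)) x \<ge> \<delta>"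
      using V_V_uniformly_pos[OF g0] by blast
    then have "\<delta> / 2 > 0" by simp
    obtain n where n: "norm (V (\<phi> (r n)) - g) < \<delta> / 2" "1 / real (r n + 2) < \<delta> / 2"
      using eventually_conj[OF close[OF \<open>\<delta> / 2 > 0\<close>] small[OF \<open>\<delta> / 2 > 0\<close>]] by (auto simp: eventually_sequentially)
    show False
    \<comment> \<open>All values lie in \<open>[\<delta> / 2, 1]\<close>, a band of width
      \<open>1 - \<delta> / 2\<close>.\<close>
    proof (rule no[of "\<delta> / 2" "\<delta> / 2" "r n"])
      fix x show "\<delta> / 2 \<le> apply_bcontfun (V (V (V (\<phi> (r n))))) x"
        using dist[of n x] n(1) \<delta>(2)[of x] by linarith
      show "apply_bcontfun (V (V (V (\<phi> (r n))))) x \<le> \<delta> / 2 + (1 - \<delta> / 2)" using V3_le by simp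
    qed (use n \<delta> in auto)
  next
    case False
    then have "g = 0" using g0 by (intro bcontfun_eqI) (simp add: antisym not_less)
    then have Vg: "apply_bcontfun (V (V g)) x = 0" for x
      by (simp add: bounded_linear.linear[OF V_linear] linear_0)
    obtain n where n: "norm (V (\<phi> (r n)) - g) < 1 / 2" "1 / real (r n + 2) < 1 / 2"
      using eventually_conj[OF close[of "1/2"] small[of "1/2"]] by (auto simp: eventually_sequentially)
    show False
    proof (rule no[of "1 / 2" 0 "r n"])
      fix x show "apply_bcontfun (V (V (V (\<phi> (r n))))) x \<le> 0 + (1 - 1 / 2)"
        using dist[of n x] n(1) Vg[of x] by linarith
    qed (use n V3_ge in auto)
  qed
qed

end

section \<open>Measures representing functionals on bounded continuous functions\<close>

lemma apply_Bcontfun: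
  fixes f :: "'a::topological_space \<Rightarrow> 'b::real_normed_vector"
  assumes "continuous_on UNIV f" "\<And>x. norm (f x) \<le> B"
  shows "apply_bcontfun (Bcontfun f) = f"
  using bcontfun_normI[OF assms] by (simp add: Bcontfun_inverse)

text \<open>The whole space is a special case because \<^term>\<open>infdist x {}\<close> is \<open>0\<close>.\<close>

definition open_approx :: "'a::metric_space set \<Rightarrow> nat \<Rightarrow> 'a \<Rightarrow>\<^sub>C real" where
  "open_approx U k = Bcontfun (\<lambda>x. min 1 (real k * (if U = UNIV then 1 else infdist x (- U))))"

lemma apply_open_approx:
  "apply_bcontfun (open_approx U k) x = min 1 (real k * (if U = UNIV then 1 else infdist x (- U)))"
proof -
  have "continuous_on UNIV (\<lambda>x. min 1 (real k * (if U = UNIV then 1 else infdist x (- U))))"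
    by (cases "U = UNIV") (auto intro!: continuous_intros)
  from apply_Bcontfun[OF this, of 1] show ?thesis
    by (simp add: open_approx_def infdist_nonneg)
qed

lemma open_approx_nonneg: "0 \<le> apply_bcontfun (open_approx U k) x"
  by (simp add: apply_open_approx infdist_nonneg)

lemma open_approx_le_indicator: "apply_bcontfun (open_approx U k) x \<le> indicator U x"
  by (cases "x \<in> U") (auto simp: apply_open_approx)

lemma open_approx_mono:
  assumes "k \<le> l" shows "apply_bcontfun (open_approx U k) x \<le> apply_bcontfun (open_approx U l) x"
proof -
  have "real k * (if U = UNIV then 1 else infdist x (- U)) \<le> real l * (if U = UNIV then 1 else infdist x (- U))"
    using assms by (intro mult_right_mono) (auto simp: infdist_nonneg)
  then show ?thesis by (simp add: apply_open_approx)
qed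

lemma open_approx_eventually:
  assumes "open U" "x \<in> U"
  shows "\<forall>\<^sub>F k in sequentially. apply_bcontfun (open_approx U k) x = 1"
proof -
  define h where "h = (if U = UNIV then 1 else infdist x (- U))"
  have "h > 0"
    unfolding h_def using assms infdist_pos_not_in_closed[of "- U" x] by (auto simp: closed_def)
  then obtain N where N: "real N * h > 1"
    using reals_Archimedean3[of h] by blast
  show ?thesis
    unfolding eventually_sequentially
  proof (intro exI[of _ N] allI impI)
    fix k assume "k \<ge> N"
    then have "real N * h \<le> real k * h" using \<open>h > 0\<close> by (intro mult_right_mono) auto
    then show "apply_bcontfun (open_approx U k) x = 1" using N by (simp add: apply_open_approx h_def[symmetric])
  qed
qed

lemma open_approx_tendsto:
  assumes "open U"
  shows "(\<lambda>k. apply_bcontfun (open_approx U k) x) \<longlonglongrightarrow> indicator U x"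
proof (cases "x \<in> U")
  case True
  show ?thesis
    by (rule tendsto_eventually, rule eventually_mono[OF open_approx_eventually[OF assms True]]) (use True in simp)
next
  case False
  then have "apply_bcontfun (open_approx U k) x = 0" for k
    using open_approx_le_indicator[of U k x] open_approx_nonneg[of U k x] by simp
  then show ?thesis using False by simp
qed

text \<open>The open sets form an intersection-stable generator, and dominated convergence along
  \<open>open_approx\<close> recovers their measures from integrals of bounded continuous
  functions.\<close>

lemma prob_measure_eqI_bcontfun:
  fixes M N :: "'a::metric_space measure"
  assumes M: "sets M = sets borel" "prob_space M" and N: "sets N = sets borel" "prob_space N"
    and eq: "\<And>f :: 'a \<Rightarrow>\<^sub>C real. (\<integral>x. apply_bcontfun f x \<partial>M) = (\<integral>x. apply_bcontfun f x \<partial>N)"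
  shows "M = N"
proof (rule measure_eqI_generator_eq[where E = "{U. open U}" and \<Omega> = UNIV and A = "\<lambda>_. UNIV"])
  interpret M: prob_space M by (rule M)
  interpret N: prob_space N by (rule N)
  show "Int_stable {U::'a set. open U}" by (auto simp: Int_stable_def)
  show "sets M = sigma_sets UNIV {U. open U}" "sets N = sigma_sets UNIV {U. open U}"
    using M N by (simp_all add: borel_def)
  show "emeasure M U = emeasure N U" if "U \<in> {U. open U}" for U
  proof -
    have U: "open U" using that by simp
    then have sets: "U \<in> sets M" "U \<in> sets N" using M N by simp_all
    have lim: "(\<lambda>k. \<integral>x. apply_bcontfun (open_approx U k) x \<partial>K) \<longlonglongrightarrow> (\<integral>x. indicator U x \<partial>K)"
      if K: "sets K = sets borel" "prob_space K" for K :: "'a measure"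
    proof -
      interpret K: prob_space K by (rule K)
      show ?thesis
      proof (rule integral_dominated_convergence[where w = "\<lambda>_. 1"])
        show "AE x in K. (\<lambda>k. apply_bcontfun (open_approx U k) x) \<longlonglongrightarrow> indicator U x"
          using open_approx_tendsto[OF U] by simp
        show "AE x in K. norm (apply_bcontfun (open_approx U k) x) \<le> 1" for k
          by (simp add: open_approx_nonneg apply_open_approx infdist_nonneg)
        show "(\<lambda>x. apply_bcontfun (open_approx U k) x) \<in> borel_measurable K" for k
          by (subst measurable_cong_sets[OF K(1) refl]) (intro borel_measurable_continuous_onI continuous_on_apply_bcontfun)
        show "indicator U \<in> borel_measurable K"
          using U K(1) by (intro borel_measurable_indicator) simp
      qed simp
    qed
    have "(\<lambda>k. \<integral>x. apply_bcontfun (open_approx U k) x \<partial>M) \<longlonglongrightarrow> (\<integral>x. indicator U x \<partial>N)"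
      unfolding eq by (rule lim[OF N])
    then have "(\<integral>x. indicator U x \<partial>M) = (\<integral>x. indicator U x \<partial>N :: real)"
      by (rule LIMSEQ_unique[OF lim[OF M]])
    then have "measure M U = measure N U" using sets by simp
    then show ?thesis by (simp add: M.emeasure_eq_measure N.emeasure_eq_measure)
  qed
  show "emeasure M ((\<lambda>_. UNIV) i) \<noteq> \<infinity>" for i :: nat
    by (simp add: M.emeasure_eq_measure)
qed auto

text \<open>On a space that is not compact, a normalised positive functional on bounded continuous
  functions may sit at infinity, like a generalised limit. The assumption \<open>continuous\<close>,
  Daniell's condition on decreasing null sequences, excludes this and gives countable subadditivity
  below.\<close>

locale daniell_functional =
  fixes c :: "('a::metric_space \<Rightarrow>\<^sub>C real) \<Rightarrow> real"
  assumes add_scale: "c (f + a *\<^sub>R g) = c f + a * c g"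
    and nonneg: "(\<And>x. 0 \<le> apply_bcontfun f x) \<Longrightarrow> 0 \<le> c f"
    and unit: "c (const_bcontfun 1) = 1"
    and continuous: "(\<And>n x. apply_bcontfun (F (Suc n)) x \<le> apply_bcontfun (F n) x) \<Longrightarrow>
      (\<And>x. (\<lambda>n. apply_bcontfun (F n) x) \<longlonglongrightarrow> 0) \<Longrightarrow> (\<lambda>n. c (F n)) \<longlonglongrightarrow> 0"
begin

lemma add: "c (f + g) = c f + c g" using add_scale[of f 1 g] by simp
lemma zero: "c 0 = 0" using add[of 0 0] by simp
lemma scale: "c (a *\<^sub>R g) = a * c g" using add_scale[of 0 a g] zero by simp
lemma diff: "c (f - g) = c f - c g" using add_scale[of f "-1" g] by simp
lemma sum: "c (\<Sum>i\<in>I. f i) = (\<Sum>i\<in>I. c (f i))"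
  by (induction I rule: infinite_finite_induct) (auto simp: zero add)
lemma const: "c (const_bcontfun a) = a"
proof -
  have "const_bcontfun a = a *\<^sub>R (const_bcontfun 1 :: 'a \<Rightarrow>\<^sub>C real)" by (rule bcontfun_eqI) simp
  then show ?thesis by (simp add: scale unit)
qed
lemma mono: "(\<And>x. apply_bcontfun f x \<le> apply_bcontfun g x) \<Longrightarrow> c f \<le> c g"
  using nonneg[of "g - f"] by (simp add: diff)

definition below :: "'a set \<Rightarrow> ('a \<Rightarrow>\<^sub>C real) set" where
  "below U = {f. \<forall>x. 0 \<le> apply_bcontfun f x \<and> apply_bcontfun f x \<le> indicator U x}"

lemma belowD: "f \<in> below U \<Longrightarrow> 0 \<le> apply_bcontfun f x" "f \<in> below U \<Longrightarrow> apply_bcontfun f x \<le> indicator U x"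
  by (auto simp: below_def)

text \<open>The value of an open set as in the Riesz representation theorem, with domination by the
  indicator in place of compact support.\<close>

definition inner :: "'a set \<Rightarrow> ennreal" where
  "inner U = (SUP f\<in>below U. ennreal (c f))"

definition outer :: "'a set \<Rightarrow> ennreal" where
  "outer A = (INF U\<in>{U. open U \<and> A \<subseteq> U}. inner U)"

lemma below_le_one:
  assumes "f \<in> below U"
  shows "apply_bcontfun f x \<le> 1"
  by (rule order_trans[OF belowD(2)[OF assms] indicator_le_1])

lemma below_nonempty: "below U \<noteq> {}"
  by (auto simp: below_def intro!: exI[of _ 0])

lemma below_mono: "U \<subseteq> U' \<Longrightarrow> below U \<subseteq> below U'"
proof
  fix f assume "U \<subseteq> U'" "f \<in> below U"
  moreover have "indicator U x \<le> (indicator U' x :: real)" for x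
    using \<open>U \<subseteq> U'\<close> by (simp add: indicator_def subset_eq)
  ultimately show "f \<in> below U'" unfolding below_def by (blast intro: order_trans)
qed

lemma inner_mono: "U \<subseteq> U' \<Longrightarrow> inner U \<le> inner U'"
  unfolding inner_def by (intro SUP_subset_mono below_mono) auto

lemma le_inner: "f \<in> below U \<Longrightarrow> ennreal (c f) \<le> inner U"
  unfolding inner_def by (rule SUP_upper)

lemma inner_le_one: "inner U \<le> 1"
  unfolding inner_def
proof (rule SUP_least)
  fix f assume f: "f \<in> below U"
  have "apply_bcontfun f x \<le> 1" for x using f by (rule below_le_one)
  then have "c f \<le> 1" using mono[of f "const_bcontfun 1"] by (simp add: unit)
  then show "ennreal (c f) \<le> 1" by simp
qed

lemma outer_open: "open U \<Longrightarrow> outer U = inner U"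
  unfolding outer_def by (intro antisym INF_greatest INF_lower inner_mono) auto

lemma outer_le_inner: "open U \<Longrightarrow> A \<subseteq> U \<Longrightarrow> outer A \<le> inner U"
  unfolding outer_def by (intro INF_lower) simp

lemma outer_mono: "A \<subseteq> B \<Longrightarrow> outer A \<le> outer B"
  unfolding outer_def by (intro INF_superset_mono) auto

lemma outer_le_one: "outer A \<le> 1"
  using outer_le_inner[of UNIV A] inner_le_one[of UNIV] by (simp add: order_trans)

text \<open>For \<open>f\<close> below the union, subtracting sums of approximations leaves positive
  parts that decrease pointwise to 0. This is the one place where the Daniell condition
  enters.\<close>

lemma inner_countably_subadditive:
  fixes U :: "nat \<Rightarrow> 'a set"
  assumes U: "\<And>i. open (U i)"
  shows "inner (\<Union>i. U i) \<le> (\<Sum>i. inner (U i))"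
  unfolding inner_def[of "\<Union>i. U i"]
proof (rule SUP_least)
  fix f assume f: "f \<in> below (\<Union>i. U i)"
  \<comment> \<open>A diagonal choice, \<open>N\<close> sets each at level \<open>N\<close>:
    \<open>S N\<close> increases with \<open>N\<close> and is eventually at least 1 at every point
    of the union.\<close>
  define S where "S N = (\<Sum>i<N. open_approx (U i) N)" for N
  have S: "apply_bcontfun (S N) x = (\<Sum>i<N. apply_bcontfun (open_approx (U i) N) x)" for N x
  proof -
    have "apply_bcontfun (\<Sum>i<M. open_approx (U i) N) x = (\<Sum>i<M. apply_bcontfun (open_approx (U i) N) x)" for M
      by (induction M) simp_all
    then show ?thesis by (simp add: S_def)
  qed
  have S_nonneg: "0 \<le> apply_bcontfun (S N) x" for N x
    unfolding S by (intro sum_nonneg open_approx_nonneg)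
  have S_mono: "apply_bcontfun (S N) x \<le> apply_bcontfun (S (Suc N)) x" for N x
  proof -
    have "(\<Sum>i<N. apply_bcontfun (open_approx (U i) N) x) \<le> (\<Sum>i<N. apply_bcontfun (open_approx (U i) (Suc N)) x)"
      by (intro sum_mono open_approx_mono) simp
    then show ?thesis unfolding S using open_approx_nonneg[of "U N" "Suc N" x] by simp
  qed
  define g where "g N = Bcontfun (\<lambda>x. max 0 (apply_bcontfun f x - apply_bcontfun (S N) x))" for N
  have g: "apply_bcontfun (g N) x = max 0 (apply_bcontfun f x - apply_bcontfun (S N) x)" for N x
  proof -
    have "norm (max 0 (apply_bcontfun f x - apply_bcontfun (S N) x)) \<le> 1" for x
      using below_le_one[OF f, of x] S_nonneg[of N x] by simp
    moreover have "continuous_on UNIV (\<lambda>x. max 0 (apply_bcontfun f x - apply_bcontfun (S N) x))"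
      by (intro continuous_intros) auto
    ultimately show ?thesis unfolding g_def by (subst apply_Bcontfun[where B = 1]) auto
  qed
  have g_lim: "(\<lambda>N. c (g N)) \<longlonglongrightarrow> 0"
  proof (rule continuous)
    show "apply_bcontfun (g (Suc N)) x \<le> apply_bcontfun (g N) x" for N x
      unfolding g using S_mono[of N x] by simp
    show "(\<lambda>N. apply_bcontfun (g N) x) \<longlonglongrightarrow> 0" for x
    proof (cases "x \<in> (\<Union>i. U i)")
      case False
      then have "apply_bcontfun f x \<le> 0" using belowD(2)[OF f, of x] by (simp add: indicator_def split: if_splits)
      then have "apply_bcontfun (g N) x = 0" for N unfolding g using S_nonneg[of N x] by simp
      then show ?thesis by simp
    next
      case True
      then obtain i where i: "x \<in> U i" by blast
      have "\<forall>\<^sub>F N in sequentially. apply_bcontfun (g N) x = 0"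
        using open_approx_eventually[OF U i] eventually_gt_at_top[of i]
      proof eventually_elim
        case (elim N)
        have "apply_bcontfun (open_approx (U i) N) x \<le> apply_bcontfun (S N) x"
          unfolding S using elim by (intro member_le_sum) (auto simp: open_approx_nonneg)
        moreover have "apply_bcontfun f x \<le> 1" using f by (rule below_le_one)
        ultimately show ?case unfolding g using elim by simp
      qed
      then show ?thesis by (rule tendsto_eventually)
    qed
  qed
  show "ennreal (c f) \<le> (\<Sum>i. inner (U i))"
  proof (rule ennreal_le_epsilon)
    fix e :: real assume "e > 0"
    have "\<forall>\<^sub>F N in sequentially. c (g N) < e" by (rule order_tendstoD(2)[OF g_lim \<open>e > 0\<close>])
    then obtain N where N: "c (g N) < e" by (auto simp: eventually_sequentially)
    have "c f \<le> c (S N + g N)" by (rule mono) (simp add: g)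
    then have "c f \<le> (\<Sum>i<N. c (open_approx (U i) N)) + e"
      using N by (simp add: add S_def sum)
    moreover have "0 \<le> c (open_approx (U i) N)" for i by (rule nonneg) (rule open_approx_nonneg)
    ultimately have "ennreal (c f) \<le> (\<Sum>i<N. ennreal (c (open_approx (U i) N))) + ennreal e"
      using \<open>e > 0\<close> by (subst sum_ennreal) (auto simp flip: ennreal_plus simp: sum_nonneg intro!: ennreal_leI)
    also have "(\<Sum>i<N. ennreal (c (open_approx (U i) N))) \<le> (\<Sum>i<N. inner (U i))"
      by (intro sum_mono le_inner) (simp add: below_def open_approx_nonneg open_approx_le_indicator)
    also have "(\<Sum>i<N. inner (U i)) \<le> (\<Sum>i. inner (U i))" by (rule sum_le_suminf) auto
    finally show "ennreal (c f) \<le> (\<Sum>i. inner (U i)) + ennreal e" by (simp add: add_right_mono)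
  qed
qed

lemma outer_countably_subadditive:
  fixes A :: "nat \<Rightarrow> 'a set"
  shows "outer (\<Union>i. A i) \<le> (\<Sum>i. outer (A i))"
proof (rule ennreal_le_epsilon)
  fix e :: real assume "0 < e"
  have "\<exists>U. open U \<and> A n \<subseteq> U \<and> inner U \<le> outer (A n) + ennreal (e * (1/2)^Suc n)" for n
  proof -
    have "outer (A n) < outer (A n) + ennreal (e * (1/2)^Suc n)"
      using outer_le_one[of "A n"] \<open>0 < e\<close>
      by (cases "outer (A n)") (auto simp flip: ennreal_plus simp: ennreal_less_iff top_unique)
    then show ?thesis
      unfolding outer_def[of "A n"] INF_less_iff by (auto intro: less_imp_le)
  qed
  then have "\<forall>n. \<exists>U. open U \<and> A n \<subseteq> U \<and> inner U \<le> outer (A n) + ennreal (e * (1/2)^Suc n)" by blast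
  then obtain U where U: "\<forall>n. open (U n) \<and> A n \<subseteq> U n \<and> inner (U n) \<le> outer (A n) + ennreal (e * (1/2)^Suc n)"
    by (rule choice[THEN exE])
  have "outer (\<Union>i. A i) \<le> inner (\<Union>i. U i)" using U by (intro outer_le_inner) (auto simp: subset_eq)
  also have "\<dots> \<le> (\<Sum>i. inner (U i))" using U by (intro inner_countably_subadditive) simp
  also have "\<dots> \<le> (\<Sum>n. outer (A n) + ennreal (e * (1/2) ^ Suc n))"
    using U by (intro suminf_le) auto
  also have "\<dots> = (\<Sum>n. outer (A n)) + (\<Sum>n. ennreal e * ennreal ((1/2) ^ Suc n))"
    using \<open>0 < e\<close> by (subst suminf_add[symmetric])
                     (auto simp del: ennreal_suminf_cmult simp add: ennreal_mult[symmetric])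
  also have "\<dots> = (\<Sum>n. outer (A n)) + ennreal e"
    unfolding ennreal_suminf_cmult
    by (subst suminf_ennreal_eq[OF zero_le_power power_half_series]) auto
  finally show "outer (\<Union>i. A i) \<le> (\<Sum>i. outer (A i)) + ennreal e" .
qed

lemma outer_empty: "outer {} = 0"
proof -
  have "inner {} \<le> 0"
    unfolding inner_def
  proof (rule SUP_least)
    fix f assume f: "f \<in> below {}"
    have "c f \<le> c 0" by (rule mono) (use belowD(2)[OF f] in simp)
    then show "ennreal (c f) \<le> 0" by (simp add: zero ennreal_neg)
  qed
  then show ?thesis using outer_open[of "{}"] by simp
qed

lemma outer_measure_space_outer: "outer_measure_space (Pow UNIV) outer"
  unfolding outer_measure_space_def positive_def increasing_def countably_subadditive_def
  using outer_empty outer_mono outer_countably_subadditive by auto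

text \<open>The superlevel set \<open>F = {x. e \<le> f x}\<close> is closed and contained in
  \<open>B \<inter> U\<close>. The truncation \<open>max 0 (f - e)\<close> lives on
  \<open>F\<close>, so it can be added to any \<open>g\<close> below the open set
  \<open>B - F\<close>, which contains \<open>B - U\<close>, without exceeding the indicator of
  \<open>B\<close>. The truncation costs only \<open>e\<close>.\<close>

lemma inner_split:
  assumes B: "open B" and U: "open U"
  shows "inner (B \<inter> U) + outer (B - U) \<le> inner B"
proof -
  have "ennreal (c f) + outer (B - U) \<le> inner B" if f: "f \<in> below (B \<inter> U)" for f
  proof (rule ennreal_le_epsilon)
    fix e :: real assume "e > 0"
    define F where "F = {x. e \<le> apply_bcontfun f x}"
    have "closed F" unfolding F_def by (intro closed_Collect_le) auto
    then have open_BF: "open (B - F)" using B by (rule open_Diff[rotated])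
    have "B - U \<subseteq> B - F"
    proof
      fix x assume x: "x \<in> B - U"
      then have "apply_bcontfun f x \<le> 0" using belowD(2)[OF f, of x] by (simp add: indicator_def)
      then show "x \<in> B - F" using x \<open>e > 0\<close> by (simp add: F_def)
    qed
    then have 1: "outer (B - U) \<le> inner (B - F)" by (rule outer_le_inner[OF open_BF])
    define f' where "f' = Bcontfun (\<lambda>x. max 0 (apply_bcontfun f x - e))"
    have f': "apply_bcontfun f' x = max 0 (apply_bcontfun f x - e)" for x
    proof -
      have "norm (max 0 (apply_bcontfun f x - e)) \<le> 1" for x
        using below_le_one[OF f, of x] \<open>e > 0\<close> by simp
      moreover have "continuous_on UNIV (\<lambda>x. max 0 (apply_bcontfun f x - e))"
        by (intro continuous_intros) auto
      ultimately show ?thesis unfolding f'_def by (subst apply_Bcontfun[where B = 1]) auto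
    qed
    have f'0: "0 \<le> c f'" by (rule nonneg) (simp add: f')
    have f_le: "c f \<le> c f' + e"
      using mono[of f "f' + const_bcontfun e"] by (simp add: f' add const)
    have "ennreal (c f') + ennreal (c g) \<le> inner B" if g: "g \<in> below (B - F)" for g
    proof -
      have "f' + g \<in> below B"
        unfolding below_def
      proof (intro CollectI allI conjI)
        fix x
        show "0 \<le> apply_bcontfun (f' + g) x" using belowD(1)[OF g, of x] by (simp add: f')
        have fx: "apply_bcontfun f x \<le> indicator (B \<inter> U) x" and gx: "apply_bcontfun g x \<le> indicator (B - F) x"
          using belowD(2)[OF f] belowD(2)[OF g] by auto
        show "apply_bcontfun (f' + g) x \<le> indicator B x"
        proof (cases "x \<in> F")
          case True
          then have "apply_bcontfun g x \<le> 0" using gx by simp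
          moreover have "apply_bcontfun f' x \<le> indicator B x"
            using fx below_le_one[OF f, of x] \<open>e > 0\<close> by (auto simp: f' indicator_def split: if_splits)
          ultimately show ?thesis by simp
        next
          case False
          then have "apply_bcontfun f' x = 0" by (simp add: f' F_def)
          then show ?thesis using gx False by (auto simp: indicator_def split: if_splits)
        qed
      qed
      then have "ennreal (c f' + c g) \<le> inner B" using le_inner by (simp add: add[symmetric])
      moreover have "0 \<le> c g" by (rule nonneg) (rule belowD(1)[OF g])
      ultimately show ?thesis using f'0 by (simp add: ennreal_plus)
    qed
    then have 2: "ennreal (c f') + inner (B - F) \<le> inner B"
      unfolding inner_def[of "B - F"]
      by (subst ennreal_SUP_add_right[OF below_nonempty]) (rule SUP_least)
    have "ennreal (c f) + outer (B - U) \<le> (ennreal (c f') + ennreal e) + inner (B - F)"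
      using f_le f'0 \<open>e > 0\<close> 1 by (intro add_mono) (auto simp flip: ennreal_plus intro!: ennreal_leI)
    also have "\<dots> = (ennreal (c f') + inner (B - F)) + ennreal e" by (simp add: ac_simps)
    also have "\<dots> \<le> inner B + ennreal e" using 2 by (rule add_right_mono)
    finally show "ennreal (c f) + outer (B - U) \<le> inner B + ennreal e" .
  qed
  then show ?thesis
    unfolding inner_def[of "B \<inter> U"] ennreal_SUP_add_left[OF below_nonempty, symmetric]
    by (rule SUP_least)
qed

text \<open>Caratheodory measurability of open sets. For the nontrivial inequality \<open>A\<close>
  is replaced by its open supersets, to which \<open>inner_split\<close> applies.\<close>

lemma outer_split:
  assumes U: "open U"
  shows "outer (A \<inter> U) + outer (A - U) = outer A"
proof (rule antisym)
  show "outer (A \<inter> U) + outer (A - U) \<le> outer A"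
    unfolding outer_def[of A]
  proof (rule INF_greatest)
    fix B assume "B \<in> {B. open B \<and> A \<subseteq> B}"
    then have B: "open B" "A \<subseteq> B" by auto
    have "outer (A \<inter> U) \<le> inner (B \<inter> U)" using B U by (intro outer_le_inner open_Int) auto
    moreover have "outer (A - U) \<le> outer (B - U)" using B by (intro outer_mono) auto
    ultimately show "outer (A \<inter> U) + outer (A - U) \<le> inner B"
      using inner_split[OF B(1) U] add_mono order_trans by blast
  qed
  define S where "S i = (if i = 0 then A \<inter> U else if i = 1 then A - U else {})" for i :: nat
  have "A = (\<Union>i. S i)" by (force simp: S_def split: if_splits)
  then have "outer A \<le> (\<Sum>i. outer (S i))" using outer_countably_subadditive[of S] by simp
  also have "\<dots> = (\<Sum>i\<in>{0, 1}. outer (S i))"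
    by (rule suminf_finite) (auto simp: S_def outer_empty)
  finally show "outer A \<le> outer (A \<inter> U) + outer (A - U)" by (simp add: S_def)
qed

section \<open>The representing measure and its integrals\<close>

definition repr :: "'a measure" where
  "repr = measure_of UNIV (sets borel) outer"

lemma measure_space_outer: "measure_space UNIV (sets borel) outer"
proof -
  have "sigma_algebra (UNIV :: 'a set) (Pow UNIV)" by (rule sigma_algebra_Pow)
  then interpret P: sigma_algebra "UNIV :: 'a set" "Pow UNIV" .
  have L: "measure_space UNIV (lambda_system UNIV (Pow UNIV) outer) outer"
    by (rule P.caratheodory_lemma[OF outer_measure_space_outer])
  have "{U. open U} \<subseteq> lambda_system UNIV (Pow UNIV) outer"
    unfolding P.lambda_system_eq using outer_split by auto
  then have "sigma_sets UNIV {U. open U} \<subseteq> lambda_system UNIV (Pow UNIV) outer"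
    using L by (intro sigma_algebra.sigma_sets_subset) (auto simp: measure_space_def)
  then have "sets borel \<subseteq> lambda_system UNIV (Pow UNIV) outer" by (simp add: borel_def)
  moreover have "sigma_algebra (UNIV :: 'a set) (sets borel)"
    using sets.sigma_algebra_axioms[of borel] by simp
  ultimately show ?thesis
    using L by (intro measure_down[OF L]) auto
qed

lemma sets_repr: "sets repr = sets borel" and space_repr: "space repr = UNIV"
  unfolding repr_def by (simp_all add: sets.sigma_sets_eq[of borel, simplified])

lemma emeasure_repr: "A \<in> sets borel \<Longrightarrow> emeasure repr A = outer A"
  using measure_space_outer unfolding repr_def measure_space_def
  by (intro emeasure_measure_of_sigma) auto

lemma prob_space_repr: "prob_space repr"
proof
  have "emeasure repr (space repr) = inner UNIV" by (simp add: space_repr emeasure_repr outer_open)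
  moreover have "inner UNIV \<ge> 1"
    using le_inner[of "const_bcontfun 1" UNIV] by (simp add: below_def unit)
  ultimately show "emeasure repr (space repr) = 1" using inner_le_one[of UNIV] by simp
qed

sublocale repr: prob_space repr by (rule prob_space_repr)

lemma borel_measurable_repr[measurable]: "apply_bcontfun f \<in> borel_measurable repr"
  by (subst measurable_cong_sets[OF sets_repr refl]) (intro borel_measurable_continuous_onI continuous_on_apply_bcontfun)

lemma integrable_repr: "integrable repr (apply_bcontfun f)" for f :: "'a \<Rightarrow>\<^sub>C real"
  by (rule repr.integrable_const_bound[where B = "norm f"]) (auto simp: norm_bounded[of f, simplified])

text \<open>\<open>f\<close> is sliced into layers \<open>s k\<close> of height \<open>d\<close>.
  Divided by \<open>d\<close>, layer \<open>k + 1\<close> is below the open set where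
  \<open>f\<close> exceeds \<open>(k + 1) * d\<close>, and there the previous layer is full; so
  \<open>c\<close> of each layer is at most the integral of its predecessor. The shift leaves over
  only the bottom layer, worth at most \<open>d\<close>.\<close>

lemma c_le_integral:
  assumes f: "\<And>x. 0 \<le> apply_bcontfun f x" "\<And>x. apply_bcontfun f x \<le> 1"
  shows "c f \<le> (\<integral>x. apply_bcontfun f x \<partial>repr)"
proof (rule field_le_epsilon)
  fix e :: real assume "e > 0"
  obtain n where "inverse (real (Suc n)) < e" using reals_Archimedean[OF \<open>e > 0\<close>] by blast
  define d where "d = inverse (real (Suc n))"
  have d: "d > 0" "d < e" "real (Suc n) * d = 1" using \<open>inverse (real (Suc n)) < e\<close> by (simp_all add: d_def)
  define s where "s k = Bcontfun (\<lambda>x. min d (max 0 (apply_bcontfun f x - real k * d)))" for k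
  have s: "apply_bcontfun (s k) x = min d (max 0 (apply_bcontfun f x - real k * d))" for k x
  proof -
    have "continuous_on UNIV (\<lambda>x. min d (max 0 (apply_bcontfun f x - real k * d)))"
      by (intro continuous_intros) auto
    then show ?thesis unfolding s_def using d by (subst apply_Bcontfun[where B = d]) auto
  qed
  have sum_s: "(\<Sum>k<m. apply_bcontfun (s k) x) = min (apply_bcontfun f x) (real m * d)" for m x
  proof (induction m)
    case 0 then show ?case using f(1)[of x] by simp
  next
    case (Suc m)
    then show ?case using d(1) by (auto simp: s distrib_right min_def max_def)
  qed
  have apply_sum: "apply_bcontfun (\<Sum>k<m. s k) x = (\<Sum>k<m. apply_bcontfun (s k) x)" for m x
    by (induction m) simp_all
  have "f = (\<Sum>k<Suc n. s k)"
    by (rule bcontfun_eqI) (simp only: apply_sum sum_s d(3) min_absorb1[OF f(2)])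
  then have cf: "c f = (\<Sum>k<Suc n. c (s k))" by (simp only: sum)
  have c0: "c (s 0) \<le> d" using mono[of "s 0" "const_bcontfun d"] by (simp add: s const)
  have step: "c (s (Suc k)) \<le> (\<integral>x. apply_bcontfun (s k) x \<partial>repr)" for k
  proof -
    define U where "U = {x. real (Suc k) * d < apply_bcontfun f x}"
    have U: "open U" unfolding U_def by (intro open_Collect_less) auto
    have "(1 / d) *\<^sub>R s (Suc k) \<in> below U"
      using d by (auto simp: below_def s U_def indicator_def field_simps)
    then have "ennreal (c ((1 / d) *\<^sub>R s (Suc k))) \<le> emeasure repr U"
      using le_inner U by (simp add: emeasure_repr outer_open)
    then have "c ((1 / d) *\<^sub>R s (Suc k)) \<le> measure repr U"
      by (simp add: repr.emeasure_eq_measure)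
    then have "c (s (Suc k)) \<le> d * measure repr U"
      using d by (simp add: scale field_simps)
    also have "\<dots> = (\<integral>x. d * indicator U x \<partial>repr)"
      using U by (simp add: sets_repr)
    also have "\<dots> \<le> (\<integral>x. apply_bcontfun (s k) x \<partial>repr)"
    proof (rule integral_mono)
      show "integrable repr (\<lambda>x. d * indicator U x)"
        using U by (intro integrable_mult_right integrable_real_indicator) (simp_all add: sets_repr repr.emeasure_eq_measure)
      show "integrable repr (apply_bcontfun (s k))" by (rule integrable_repr)
      show "d * indicator U x \<le> apply_bcontfun (s k) x" for x
        using d by (auto simp: s U_def indicator_def algebra_simps)
    qed
    finally show ?thesis .
  qed
  have "c f = c (s 0) + (\<Sum>k<n. c (s (Suc k)))"
    unfolding cf by (rule sum.lessThan_Suc_shift)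
  also have "\<dots> \<le> d + (\<Sum>k<n. (\<integral>x. apply_bcontfun (s k) x \<partial>repr))"
    by (intro add_mono c0 sum_mono step)
  also have "(\<Sum>k<n. (\<integral>x. apply_bcontfun (s k) x \<partial>repr)) = (\<integral>x. (\<Sum>k<n. apply_bcontfun (s k) x) \<partial>repr)"
    by (intro Bochner_Integration.integral_sum[symmetric] integrable_repr)
  also have "\<dots> \<le> (\<integral>x. apply_bcontfun f x \<partial>repr)"
  proof (rule integral_mono)
    show "integrable repr (\<lambda>x. \<Sum>k<n. apply_bcontfun (s k) x)"
      by (intro Bochner_Integration.integrable_sum integrable_repr)
    show "(\<Sum>k<n. apply_bcontfun (s k) x) \<le> apply_bcontfun f x" for x by (simp add: sum_s)
  qed (rule integrable_repr)
  finally show "c f \<le> (\<integral>x. apply_bcontfun f x \<partial>repr) + e" using d by simp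
qed

text \<open>For values in \<open>[0, 1]\<close> the reverse inequality comes from applying
  \<open>c_le_integral\<close> to \<open>1 - f\<close>; a general \<open>f\<close> is moved into
  \<open>[0, 1]\<close> by an affine change.\<close>

lemma integral_repr: "(\<integral>x. apply_bcontfun f x \<partial>repr) = c f"
proof -
  have eq01: "(\<integral>x. apply_bcontfun f x \<partial>repr) = c f"
    if f: "\<And>x. 0 \<le> apply_bcontfun f x" "\<And>x. apply_bcontfun f x \<le> 1" for f
  proof (rule antisym)
    show "c f \<le> (\<integral>x. apply_bcontfun f x \<partial>repr)" by (rule c_le_integral[OF f])
    have "c (const_bcontfun 1 - f) \<le> (\<integral>x. apply_bcontfun (const_bcontfun 1 - f) x \<partial>repr)"
      by (rule c_le_integral) (use f in simp_all)
    also have "\<dots> = 1 - (\<integral>x. apply_bcontfun f x \<partial>repr)"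
      by (simp add: Bochner_Integration.integral_diff integrable_repr repr.prob_space[unfolded space_repr] space_repr)
    finally show "(\<integral>x. apply_bcontfun f x \<partial>repr) \<le> c f" by (simp add: diff unit)
  qed
  define M where "M = norm f + 1"
  have M: "M > 0" by (simp add: M_def add_nonneg_pos)
  define g where "g = (1 / (2 * M)) *\<^sub>R (f + const_bcontfun M)"
  have f01: "- M \<le> apply_bcontfun f x" "apply_bcontfun f x \<le> M" for x
    using norm_bounded[of f x] by (auto simp: M_def abs_le_iff)
  have f_eq: "f = (2 * M) *\<^sub>R g - const_bcontfun M"
    using M by (intro bcontfun_eqI) (simp add: g_def)
  have "(\<integral>x. apply_bcontfun g x \<partial>repr) = c g"
    proof (rule eq01)
    fix x show "0 \<le> apply_bcontfun g x" "apply_bcontfun g x \<le> 1"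
      using M f01[of x] by (simp_all add: g_def field_simps)
  qed
  moreover have "(\<integral>x. apply_bcontfun f x \<partial>repr) = 2 * M * (\<integral>x. apply_bcontfun g x \<partial>repr) - M"
    by (subst f_eq) (simp add: Bochner_Integration.integral_diff integrable_repr repr.prob_space[unfolded space_repr] space_repr)
  moreover have "c f = 2 * M * c g - M"
    by (subst f_eq) (simp add: diff scale const)
  ultimately show ?thesis by simp
qed

end

section \<open>Resolvents in the complexification\<close>

text \<open>The hypothesis bounds powers and allows \<open>K > 1\<close>, because a decay rate
  controls the powers of an operator and not its norm.\<close>

lemma neumann_series:
  fixes L :: "'a::banach \<Rightarrow> 'a"
  assumes L: "bounded_linear L" and \<theta>: "0 \<le> \<theta>" "\<theta> < 1"
    and bound: "\<And>n x. norm ((L ^^ n) x) \<le> K * \<theta> ^ n * norm x"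
  shows "\<exists>R. bounded_linear R \<and> (\<forall>x. R (x - L x) = x) \<and> (\<forall>x. R x - L (R x) = x)"
proof -
  interpret L: bounded_linear L by (rule L)
  have lin: "(L ^^ n) (x + y) = (L ^^ n) x + (L ^^ n) y" "(L ^^ n) (a *\<^sub>R x) = a *\<^sub>R (L ^^ n) x" for n x y a
    by (induction n) (simp_all add: L.add L.scaleR)
  have geo: "summable (\<lambda>n. K * \<theta> ^ n * norm x)" for x :: 'a
    using \<theta> by (intro summable_mult2 summable_mult summable_geometric) simp
  have sum: "summable (\<lambda>n. (L ^^ n) x)" for x
    by (rule summable_comparison_test'[OF geo]) (rule bound)
  have sumn: "summable (\<lambda>n. norm ((L ^^ n) x))" for x
    by (rule summable_comparison_test'[OF geo]) (use bound in simp)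
  define R where "R x = (\<Sum>n. (L ^^ n) x)" for x
  have R_shift: "R x = x + (\<Sum>n. (L ^^ Suc n) x)" for x
    unfolding R_def using suminf_split_head[OF sum, of x] by simp
  have LR: "L (R x) = (\<Sum>n. (L ^^ Suc n) x)" for x
    unfolding R_def by (simp add: L.suminf[OF sum])
  have RL: "R (L x) = (\<Sum>n. (L ^^ Suc n) x)" for x
    unfolding R_def by (simp add: funpow_swap1)
  have add: "R (x + y) = R x + R y" for x y
    unfolding R_def lin by (rule suminf_add[OF sum sum, symmetric])
  have "bounded_linear R"
  proof (rule bounded_linear_intro[where K = "(\<Sum>n. K * \<theta> ^ n)"])
    show "R (x + y) = R x + R y" for x y by (rule add)
    show "R (a *\<^sub>R x) = a *\<^sub>R R x" for a x
      unfolding R_def lin by (rule suminf_scaleR_right[OF sum, symmetric])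
    show "norm (R x) \<le> norm x * (\<Sum>n. K * \<theta> ^ n)" for x
    proof -
      have "norm (R x) \<le> (\<Sum>n. norm ((L ^^ n) x))" unfolding R_def by (rule summable_norm[OF sumn])
      also have "\<dots> \<le> (\<Sum>n. K * \<theta> ^ n * norm x)" by (rule suminf_le[OF bound sumn geo])
      also have "\<dots> = (\<Sum>n. K * \<theta> ^ n) * norm x"
        using \<theta> by (intro suminf_mult2[symmetric] summable_mult summable_geometric) simp
      finally show ?thesis by (simp add: mult.commute)
    qed
  qed
  moreover have "R (x - L x) = x" for x
  proof -
    have "R x = R ((x - L x) + L x)" by simp
    then have "R (x - L x) = R x - R (L x)" unfolding add by simp
    then show ?thesis using R_shift[of x] RL[of x] by simp
  qed
  moreover have "R x - L (R x) = x" for x using R_shift[of x] LR[of x] by simp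
  ultimately show ?thesis by blast
qed

section \<open>Complex scalars and inverses on the complexification\<close>

lemma complex_scale_zero [simp]: "complex_scale z 0 = 0" "complex_scale 0 p = 0"
  by (simp_all add: complex_scale_def prod_eq_iff)

lemma complex_scale_one [simp]: "complex_scale 1 p = p"
  by (simp add: complex_scale_def prod_eq_iff)

lemma complex_scale_mult: "complex_scale (z * w) p = complex_scale z (complex_scale w p)"
  by (simp add: complex_scale_def prod_eq_iff algebra_simps)

lemma complex_scale_add: "complex_scale z (p + p') = complex_scale z p + complex_scale z p'"
  by (simp add: complex_scale_def prod_eq_iff algebra_simps)

lemma complex_scale_diff: "complex_scale z (p - p') = complex_scale z p - complex_scale z p'"
  by (simp add: complex_scale_def prod_eq_iff algebra_simps)

lemma complex_scale_scaleR: "complex_scale z (a *\<^sub>R p) = a *\<^sub>R complex_scale z p"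
  by (simp add: complex_scale_def prod_eq_iff algebra_simps)

lemma complex_scale_diff_left: "complex_scale (z - w) p = complex_scale z p - complex_scale w p"
  by (simp add: complex_scale_def prod_eq_iff algebra_simps)

lemma complex_scale_of_real: "complex_scale (of_real a) p = a *\<^sub>R p"
  by (simp add: complex_scale_def prod_eq_iff)

lemma complex_scale_eq_0: "complex_scale z p = 0 \<Longrightarrow> z \<noteq> 0 \<Longrightarrow> p = 0"
  by (metis complex_scale_mult complex_scale_one complex_scale_zero(1) left_inverse)

text \<open>The product norm need not be homogeneous under complex scalars; the crude constant 4
  counts two components with two terms each.\<close>

lemma norm_complex_scale: "norm (complex_scale z p) \<le> 4 * cmod z * norm p"
proof -
  obtain f g where p: "p = (f, g)" by (cases p)
  have fg: "norm f \<le> norm p" "norm g \<le> norm p"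
    using norm_fst_le[of f g] norm_snd_le[of g f] by (auto simp: p)
  have ab: "\<bar>Re z\<bar> * norm h \<le> cmod z * norm p" "\<bar>Im z\<bar> * norm h \<le> cmod z * norm p" if "norm h \<le> norm p" for h :: 'a
    using that abs_Re_le_cmod[of z] abs_Im_le_cmod[of z] by (auto intro!: mult_mono)
  have 1: "norm (Re z *\<^sub>R f - Im z *\<^sub>R g) \<le> 2 * (cmod z * norm p)"
    using norm_triangle_ineq4[of "Re z *\<^sub>R f" "Im z *\<^sub>R g"] ab(1)[OF fg(1)] ab(2)[OF fg(2)] by simp
  have 2: "norm (Im z *\<^sub>R f + Re z *\<^sub>R g) \<le> 2 * (cmod z * norm p)"
    using norm_triangle_ineq[of "Im z *\<^sub>R f" "Re z *\<^sub>R g"] ab(2)[OF fg(1)] ab(1)[OF fg(2)] by simp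
  show ?thesis
    using norm_Pair_le[of "Re z *\<^sub>R f - Im z *\<^sub>R g" "Im z *\<^sub>R f + Re z *\<^sub>R g"] 1 2
    by (simp add: complex_scale_def p)
qed

lemma bounded_linear_complex_scale: "bounded_linear (complex_scale z)"
proof (rule bounded_linear_intro[where K = "4 * cmod z"])
  show "norm (complex_scale z p) \<le> norm p * (4 * cmod z)" for p :: "'a \<times> 'a"
    using norm_complex_scale[of z p] by (simp add: mult_ac)
qed (rule complex_scale_add complex_scale_scaleR)+

lemma bounded_linear_map_prod:
  assumes "bounded_linear F" "bounded_linear F'"
  shows "bounded_linear (map_prod F F')"
proof -
  have "bounded_linear (\<lambda>p. (F (fst p), F' (snd p)))"
    by (intro bounded_linear_Pair bounded_linear_compose[OF assms(1)] bounded_linear_compose[OF assms(2)]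
        bounded_linear_fst bounded_linear_snd)
  then show ?thesis by (simp add: map_prod_def case_prod_beta')
qed

lemma map_prod_complex_scale:
  assumes "linear F"
  shows "map_prod F F (complex_scale z p) = complex_scale z (map_prod F F p)"
  using assms by (simp add: complex_scale_def prod_eq_iff linear_add linear_diff linear_scale)

text \<open>A right inverse \<open>R\<close> of \<open>z - A\<close> is two-sided once
  \<open>z - A\<close> is injective, since \<open>z - A\<close> annihilates
  \<open>R ((z - A) p) - p\<close>.\<close>

lemma not_in_complex_spectrumI:
  assumes A: "linear A" and R: "bounded_linear R"
    and right: "\<And>p. complex_scale z (R p) - map_prod A A (R p) = p"
    and inj: "\<And>p. complex_scale z p - map_prod A A p = 0 \<Longrightarrow> p = 0"
  shows "z \<notin> complex_spectrum A"
proof -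
  have "R (complex_scale z p - map_prod A A p) = p" for p
  proof -
    define d where "d = R (complex_scale z p - map_prod A A p)"
    have "map_prod A A (d - p) = map_prod A A d - map_prod A A p"
      using A by (simp add: prod_eq_iff linear_diff)
    then have "complex_scale z (d - p) - map_prod A A (d - p) =
        (complex_scale z d - map_prod A A d) - (complex_scale z p - map_prod A A p)"
      by (simp add: complex_scale_diff)
    also have "\<dots> = 0" unfolding d_def right by simp
    finally have "d - p = 0" by (rule inj)
    then show ?thesis by (simp add: d_def)
  qed
  then show ?thesis using R right by (auto simp: complex_spectrum_def)
qed

text \<open>
  On the kernel of \<open>P\<close> the perturbed operator is still \<open>A\<close>, on its range it is the scalar \<open>a + b\<close>.
\<close>

lemma complex_spectrum_add_projection:
  assumes A: "bounded_linear A" and P: "bounded_linear P"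
    and PP: "\<And>x. P (P x) = P x" and AP: "\<And>x. A (P x) = a *\<^sub>R P x" and PA: "\<And>x. P (A x) = a *\<^sub>R P x"
    and z: "z \<noteq> of_real a" "z \<noteq> of_real (a + b)" "z \<notin> complex_spectrum A"
  shows "z \<notin> complex_spectrum (\<lambda>x. A x + b *\<^sub>R P x)"
proof -
  let ?B = "\<lambda>x. A x + b *\<^sub>R P x"
  let ?A = "map_prod A A" and ?P = "map_prod P P"
  note linA = bounded_linear.linear[OF A] and linP = bounded_linear.linear[OF P]
  have linB: "linear ?B"
    using linA linP by (intro linearI) (simp_all add: linear_add linear_scale algebra_simps)
  obtain R where R: "bounded_linear R" and "\<And>p. R (complex_scale z p - ?A p) = p"
    and right: "\<And>p. complex_scale z (R p) - ?A (R p) = p"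
    using z(3) unfolding complex_spectrum_def by blast
  then have injA: "p = 0" if "complex_scale z p - ?A p = 0" for p
    using that bounded_linear.linear[OF R] by (metis linear_0)
  have eqs: "?P (?P p) = ?P p" "?A (?P p) = a *\<^sub>R ?P p" "?P (?A p) = a *\<^sub>R ?P p"
    "map_prod ?B ?B p = ?A p + b *\<^sub>R ?P p"
    "?P (p - p') = ?P p - ?P p'" "?A (p + p') = ?A p + ?A p'" "?P (p + p') = ?P p + ?P p'"
    "?P (complex_scale w p) = complex_scale w (?P p)" "?A (complex_scale w p) = complex_scale w (?A p)" for p p' w
    using linP linA by (simp_all add: prod_eq_iff PP AP PA linear_add linear_diff map_prod_complex_scale)
  have za: "complex_scale z p - a *\<^sub>R p = complex_scale (z - of_real a) p" for p :: "'a \<times> 'a"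
    by (simp add: complex_scale_diff_left complex_scale_of_real)
  have zab: "complex_scale z p - (a *\<^sub>R p + b *\<^sub>R p) = complex_scale (z - of_real (a + b)) p" for p :: "'a \<times> 'a"
    by (simp only: complex_scale_diff_left complex_scale_of_real scaleR_left_distrib)
  \<comment> \<open>The inverse acts through the resolvent of \<open>A\<close> on the kernel of
    \<open>P\<close> and as the scalar \<open>w\<close> on its range.\<close>
  define w where "w = inverse (z - of_real (a + b))"
  define R' where "R' p = R (p - ?P p) + complex_scale w (?P p)" for p
  have Pc: "bounded_linear ?P" by (rule bounded_linear_map_prod[OF P P])
  have "bounded_linear R'"
    unfolding R'_def
    by (intro bounded_linear_add bounded_linear_compose[OF R] bounded_linear_sub bounded_linear_ident Pc
        bounded_linear_compose[OF bounded_linear_complex_scale])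
  moreover have "complex_scale z (R' p) - map_prod ?B ?B (R' p) = p" for p
  proof -
    define y where "y = R (p - ?P p)"
    have y: "complex_scale z y - ?A y = p - ?P p" unfolding y_def by (rule right)
    \<comment> \<open>Applying \<open>P\<close> gives \<open>(z - a) P y = 0\<close>, so
      \<open>y\<close> stays in the kernel of \<open>P\<close>, where the perturbation is
      invisible.\<close>
    have "?P (complex_scale z y - ?A y) = 0" unfolding y by (simp add: eqs)
    then have "complex_scale z (?P y) - a *\<^sub>R ?P y = 0" by (simp only: eqs)
    then have Py: "?P y = 0" unfolding za by (rule complex_scale_eq_0) (use z in simp)
    have "complex_scale z (complex_scale w (?P p)) - map_prod ?B ?B (complex_scale w (?P p)) =
        complex_scale w (complex_scale z (?P p) - (a *\<^sub>R ?P p + b *\<^sub>R ?P p))"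
      by (simp add: eqs complex_scale_diff complex_scale_add mult.commute
          complex_scale_scaleR flip: complex_scale_mult)
    also have "\<dots> = ?P p"
      unfolding zab complex_scale_mult[symmetric] w_def using z by simp
    finally have 2: "complex_scale z (complex_scale w (?P p)) - map_prod ?B ?B (complex_scale w (?P p)) = ?P p" .
    have 1: "complex_scale z y - map_prod ?B ?B y = p - ?P p"
      using y Py by (simp add: eqs(4))
    have "complex_scale z (R' p) - map_prod ?B ?B (R' p) =
       (complex_scale z y - map_prod ?B ?B y) + (complex_scale z (complex_scale w (?P p)) - map_prod ?B ?B (complex_scale w (?P p)))"
      unfolding R'_def y_def[symmetric] complex_scale_add
      using linear_add[OF linB] by (simp add: prod_eq_iff)
    then show ?thesis unfolding 1 2 by simp
  qed
  moreover have "p = 0" if "complex_scale z p - map_prod ?B ?B p = 0" for p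
  proof -
    have "?P (complex_scale z p - (?A p + b *\<^sub>R ?P p)) = 0"
      using that bounded_linear.linear[OF Pc] by (simp only: eqs(4) linear_0)
    then have "complex_scale z (?P p) - (a *\<^sub>R ?P p + b *\<^sub>R ?P p) = 0"
      by (simp only: eqs linear_scale[OF bounded_linear.linear[OF Pc]])
    then have "?P p = 0" unfolding zab by (rule complex_scale_eq_0) (use z in simp)
    then show ?thesis using that injA[of p] by (simp only: eqs(4) scaleR_zero_right add_0_right)
  qed
  ultimately show ?thesis by (rule not_in_complex_spectrumI[OF linB])
qed

text \<open>Factor \<open>z - N = z (1 - N / z)\<close>. The powers of \<open>N / z\<close> decay
  like \<open>(\<theta> / cmod z)^n\<close> whatever the norm of \<open>N\<close>, so the Neumann
  series converges.\<close>

lemma not_in_complex_spectrum_decay: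
  fixes N :: "'a::banach \<Rightarrow> 'a"
  assumes N: "bounded_linear N" and \<theta>: "0 \<le> \<theta>" "\<theta> < cmod z"
    and bound: "\<And>n x. norm ((N ^^ n) x) \<le> K * \<theta> ^ n * norm x" and "K \<ge> 0"
  shows "z \<notin> complex_spectrum N"
proof -
  define w where "w = inverse z"
  have z: "z \<noteq> 0" using \<theta> by auto
  note linN = bounded_linear.linear[OF N]
  define L where "L p = complex_scale w (map_prod N N p)" for p
  have L: "bounded_linear L" unfolding L_def
    by (intro bounded_linear_compose[OF bounded_linear_complex_scale] bounded_linear_map_prod N)
  have Ln: "(L ^^ n) p = complex_scale (w ^ n) (map_prod (N ^^ n) (N ^^ n) p)" for n p
  proof (induction n)
    case 0 then show ?case by (simp add: prod_eq_iff)
  next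
    case (Suc n)
    have "(L ^^ Suc n) p = L (complex_scale (w ^ n) (map_prod (N ^^ n) (N ^^ n) p))"
      by (simp add: Suc)
    also have "\<dots> = complex_scale w (complex_scale (w ^ n) (map_prod N N (map_prod (N ^^ n) (N ^^ n) p)))"
      by (simp only: L_def map_prod_complex_scale[OF linN])
    also have "map_prod N N (map_prod (N ^^ n) (N ^^ n) p) = map_prod (N ^^ Suc n) (N ^^ Suc n) p"
      by (simp add: prod_eq_iff)
    finally show ?case by (simp only: power_Suc complex_scale_mult)
  qed
  have cw: "cmod w = 1 / cmod z" by (simp add: w_def norm_inverse divide_inverse)
  have "\<exists>R. bounded_linear R \<and> (\<forall>x. R (x - L x) = x) \<and> (\<forall>x. R x - L (R x) = x)"
  \<comment> \<open>The 8 combines the factor 4 of \<open>norm_complex_scale\<close> with a 2 from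
    the two components.\<close>
  proof (rule neumann_series[OF L, of "\<theta> / cmod z" "8 * K"])
    show "0 \<le> \<theta> / cmod z" "\<theta> / cmod z < 1" using \<theta> z by (auto simp: divide_simps)
    fix n p
    have "norm (map_prod (N ^^ n) (N ^^ n) p) \<le> norm ((N ^^ n) (fst p)) + norm ((N ^^ n) (snd p))"
      using norm_Pair_le[of "(N ^^ n) (fst p)" "(N ^^ n) (snd p)"] by (simp add: map_prod_def case_prod_beta')
    also have "\<dots> \<le> K * \<theta> ^ n * norm (fst p) + K * \<theta> ^ n * norm (snd p)"
      by (intro add_mono bound)
    also have "\<dots> \<le> K * \<theta> ^ n * norm p + K * \<theta> ^ n * norm p"
      using norm_fst_le[of "fst p" "snd p"] norm_snd_le[of "snd p" "fst p"] \<theta> \<open>K \<ge> 0\<close>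
      by (intro add_mono mult_left_mono) auto
    finally have "norm (map_prod (N ^^ n) (N ^^ n) p) \<le> 2 * K * \<theta> ^ n * norm p" by (simp add: mult_ac)
    then have "4 * cmod (w ^ n) * norm (map_prod (N ^^ n) (N ^^ n) p) \<le> 4 * cmod (w ^ n) * (2 * K * \<theta> ^ n * norm p)"
      by (intro mult_left_mono) auto
    also have "\<dots> = 8 * K * (\<theta> / cmod z) ^ n * norm p"
      by (simp add: norm_power cw power_divide power_one_over field_simps)
    finally show "norm ((L ^^ n) p) \<le> 8 * K * (\<theta> / cmod z) ^ n * norm p"
      unfolding Ln using norm_complex_scale order_trans by blast
  qed
  then obtain R where R: "bounded_linear R" "\<And>p. R (p - L p) = p" "\<And>p. R p - L (R p) = p" by blast
  have zL: "complex_scale z (p - L p) = complex_scale z p - map_prod N N p" for p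
    using z by (simp add: complex_scale_diff L_def w_def flip: complex_scale_mult)
  show ?thesis
  proof (rule not_in_complex_spectrumI[OF linN, of "\<lambda>p. R (complex_scale w p)"])
    show "bounded_linear (\<lambda>p. R (complex_scale w p))"
      by (rule bounded_linear_compose[OF R(1) bounded_linear_complex_scale])
    show "complex_scale z (R (complex_scale w p)) - map_prod N N (R (complex_scale w p)) = p" for p
      unfolding zL[symmetric] R(3) using z by (simp add: w_def flip: complex_scale_mult)
    show "p = 0" if "complex_scale z p - map_prod N N p = 0" for p
    proof -
      have "p - L p = 0" using that z unfolding zL[symmetric] by (rule complex_scale_eq_0)
      then show ?thesis using R(2)[of p] bounded_linear.linear[OF R(1)] by (simp add: linear_0)
    qed
  qed
qed

instance bcontfun :: (metric_space, banach) banach ..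

lemma not_in_complex_spectrumE:
  assumes "z \<notin> complex_spectrum N" "linear N"
  obtains R where "bounded_linear R" "\<And>p. R (complex_scale z p - map_prod N N p) = p"
    "\<And>p. complex_scale z (R p) - map_prod N N (R p) = p"
  using assms(1) unfolding complex_spectrum_def by blast

text \<open>
  The coefficients of the Taylor series of \<open>w \<mapsto> ((1 - w N)\<^sup>-\<^sup>1 p) x\<close> are \<open>(N\<^sup>n p) x\<close>, so that
  Cauchy's estimate bounds them on every disc on which the resolvent exists.
\<close>

lemma power_bound_of_spectral_bound:
  fixes N :: "('a::metric_space \<Rightarrow>\<^sub>C real) \<Rightarrow> ('a \<Rightarrow>\<^sub>C real)"
  assumes N: "bounded_linear N" and r: "r > 0" and spec: "\<And>z. r < cmod z \<Longrightarrow> z \<notin> complex_spectrum N"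
    and \<rho>: "r < \<rho>"
  shows "\<exists>B. \<forall>n \<phi>. norm ((N ^^ n) \<phi>) \<le> B * \<rho> ^ n * norm \<phi>"
proof -
  note linN = bounded_linear.linear[OF N]
  let ?N = "map_prod N N"
  have Nc: "bounded_linear ?N" by (intro bounded_linear_map_prod N)
  \<comment> \<open>The image of \<open>cmod z > r\<close> under \<open>w = 1 / z\<close>, completed
    by \<open>w = 0\<close>; on it \<open>1 - w N\<close> is invertible, with inverse
    \<open>S w\<close> below.\<close>
  define D where "D = ball (0::complex) (1 / r)"
  have "\<exists>S. bounded_linear S \<and> (\<forall>p. S (p - complex_scale w (?N p)) = p) \<and> (\<forall>p. S p - complex_scale w (?N (S p)) = p)"
    if w: "w \<in> D" for w
  proof (cases "w = 0")
    case True
    then show ?thesis by (intro exI[of _ "\<lambda>p. p"]) (simp add: bounded_linear_ident)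
  next
    case False
    define z where "z = inverse w"
    have z: "z \<noteq> 0" "z * w = 1" "w * z = 1" using False by (simp_all add: z_def)
    have "cmod w < 1 / r" using w by (simp add: D_def)
    moreover have "cmod z = 1 / cmod w" by (simp add: z_def norm_inverse divide_inverse)
    ultimately have "r < cmod z" using r False by (simp add: pos_less_divide_eq mult.commute)
    then obtain R where R: "bounded_linear R" "\<And>p. R (complex_scale z p - ?N p) = p"
      "\<And>p. complex_scale z (R p) - ?N (R p) = p"
      using not_in_complex_spectrumE[OF spec linN] by blast
    have eq: "complex_scale z (p - complex_scale w (?N p)) = complex_scale z p - ?N p" for p
      by (simp add: complex_scale_diff z flip: complex_scale_mult)
    have eq': "p - complex_scale w (?N p) = complex_scale w (complex_scale z p - ?N p)" for p
      by (simp add: complex_scale_diff z flip: complex_scale_mult)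
    show ?thesis
    proof (intro exI[of _ "\<lambda>p. R (complex_scale z p)"] conjI allI)
      show "bounded_linear (\<lambda>p. R (complex_scale z p))"
        by (rule bounded_linear_compose[OF R(1) bounded_linear_complex_scale])
      show "R (complex_scale z (p - complex_scale w (?N p))) = p" for p
        unfolding eq by (rule R(2))
      show "R (complex_scale z p) - complex_scale w (?N (R (complex_scale z p))) = p" for p
        unfolding eq' R(3) by (simp add: z flip: complex_scale_mult)
    qed
  qed
  then have "\<forall>w. \<exists>S. w \<in> D \<longrightarrow> bounded_linear S \<and> (\<forall>p. S (p - complex_scale w (?N p)) = p) \<and> (\<forall>p. S p - complex_scale w (?N (S p)) = p)"
    by meson
  from choice[OF this] obtain S' where S': "\<forall>w. w \<in> D \<longrightarrow>
      bounded_linear (S' w) \<and> (\<forall>p. S' w (p - complex_scale w (?N p)) = p) \<and> (\<forall>p. S' w p - complex_scale w (?N (S' w p)) = p)"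
    by (rule exE)
  define S where "S w = Blinfun (S' w)" for w
  have S_eq: "blinfun_apply (S w) = S' w" if "w \<in> D" for w
    unfolding S_def using S' that by (intro bounded_linear_Blinfun_apply) simp
  have S_left: "blinfun_apply (S w) (p - complex_scale w (?N p)) = p"
    and S_right: "blinfun_apply (S w) p - complex_scale w (?N (blinfun_apply (S w) p)) = p"
    if w: "w \<in> D" for w p
    unfolding S_eq[OF w]
    by (rule S'[rule_format, OF w, THEN conjunct2, THEN conjunct1, rule_format])
       (rule S'[rule_format, OF w, THEN conjunct2, THEN conjunct2, rule_format])
  define C where "C = 4 * (onorm ?N + 1)"
  have C: "C > 0" using onorm_pos_le[OF Nc] by (simp add: C_def add_nonneg_pos)
  have norm_sN: "norm (complex_scale w (?N p)) \<le> cmod w * C * norm p" for w p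
  proof -
    have "norm (complex_scale w (?N p)) \<le> 4 * cmod w * norm (?N p)" by (rule norm_complex_scale)
    also have "\<dots> \<le> 4 * cmod w * ((onorm ?N + 1) * norm p)"
      using onorm[OF Nc, of p] by (intro mult_left_mono) (auto simp: distrib_right intro: order_trans)
    finally show ?thesis by (simp add: C_def mult_ac)
  qed
  have scale: "blinfun_apply (S w) (complex_scale z p) = complex_scale z (blinfun_apply (S w) p)" if w: "w \<in> D" for w z p
  proof -
    have "complex_scale z p = complex_scale z (blinfun_apply (S w) p) - complex_scale w (?N (complex_scale z (blinfun_apply (S w) p)))"
      by (subst S_right[OF w, of p, symmetric])
         (simp add: complex_scale_diff map_prod_complex_scale[OF linN] mult.commute flip: complex_scale_mult)
    then show ?thesis using S_left[OF w, of "complex_scale z (blinfun_apply (S w) p)"] by simp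
  qed
  have resolvent: "blinfun_apply (S w) p - blinfun_apply (S v) p = blinfun_apply (S w) (complex_scale (w - v) (?N (blinfun_apply (S v) p)))"
    if w: "w \<in> D" and v: "v \<in> D" for w v p
  proof -
    let ?y = "blinfun_apply (S v) p"
    have "complex_scale (w - v) (?N ?y) = p - (?y - complex_scale w (?N ?y))"
      using S_right[OF v, of p] by (simp add: complex_scale_diff_left algebra_simps)
    then show ?thesis using S_left[OF w, of ?y] by (simp add: blinfun.diff_right)
  qed
  have diff_bound: "norm (S w - S v) \<le> norm (S w) * (cmod (w - v) * C * norm (S v))" if w: "w \<in> D" and v: "v \<in> D" for w v
  proof (rule norm_blinfun_bound)
    show "0 \<le> norm (S w) * (cmod (w - v) * C * norm (S v))" using C by simp
    fix p
    have "norm (blinfun_apply (S w - S v) p) \<le> norm (S w) * norm (complex_scale (w - v) (?N (blinfun_apply (S v) p)))"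
      unfolding blinfun.diff_left resolvent[OF w v] by (rule norm_blinfun)
    also have "\<dots> \<le> norm (S w) * (cmod (w - v) * C * norm (blinfun_apply (S v) p))"
      by (intro mult_left_mono norm_sN) simp
    also have "\<dots> \<le> norm (S w) * (cmod (w - v) * C * (norm (S v) * norm p))"
      using C by (intro mult_left_mono norm_blinfun) auto
    finally show "norm (blinfun_apply (S w - S v) p) \<le> norm (S w) * (cmod (w - v) * C * norm (S v)) * norm p"
      by (simp add: mult_ac)
  qed
  have openD: "open D" by (simp add: D_def)
  \<comment> \<open>No bound for \<open>S w\<close> near \<open>v\<close> is known in advance. The
    resolvent identity gives \<open>norm (S w) \<le> norm (S v) + norm (S w) / 2\<close> for
    \<open>w\<close> close to \<open>v\<close>, and the last term is absorbed.\<close>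
  have contS: "isCont S v" if v: "v \<in> D" for v
  proof -
    define a where "a = C * norm (S v)"
    have a: "a \<ge> 0" using C by (simp add: a_def)
    have near: "\<forall>\<^sub>F w in at v. w \<in> D \<and> cmod (w - v) * a \<le> 1 / 2"
    proof (rule eventually_conj)
      show "\<forall>\<^sub>F w in at v. w \<in> D"
        using openD v by (auto simp: eventually_at_topological)
      have "((\<lambda>w. cmod (w - v) * a) \<longlongrightarrow> cmod (v - v) * a) (at v)" by (intro tendsto_intros)
      then have "\<forall>\<^sub>F w in at v. cmod (w - v) * a < 1 / 2" by (intro order_tendstoD(2)) auto
      then show "\<forall>\<^sub>F w in at v. cmod (w - v) * a \<le> 1 / 2" by eventually_elim simp
    qed
    have le: "\<forall>\<^sub>F w in at v. norm (S w - S v) \<le> 2 * norm (S v) * (cmod (w - v) * a)"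
      using near
    proof eventually_elim
      case (elim w)
      have d: "norm (S w - S v) \<le> norm (S w) * (cmod (w - v) * a)"
        using diff_bound[of w v] elim v by (simp add: a_def mult_ac)
      also have "\<dots> \<le> norm (S w) * (1 / 2)" using elim by (intro mult_left_mono) auto
      finally have "norm (S w) \<le> 2 * norm (S v)"
        using norm_triangle_sub[of "S w" "S v"] by simp
      then have "norm (S w) * (cmod (w - v) * a) \<le> 2 * norm (S v) * (cmod (w - v) * a)"
        using a by (intro mult_right_mono) auto
      with d show ?case by simp
    qed
    have "((\<lambda>w. 2 * norm (S v) * (cmod (w - v) * a)) \<longlongrightarrow> 2 * norm (S v) * (cmod (v - v) * a)) (at v)"
      by (intro tendsto_intros)
    then have "((\<lambda>w. 2 * norm (S v) * (cmod (w - v) * a)) \<longlongrightarrow> 0) (at v)" by simp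
    with le have "((\<lambda>w. S w - S v) \<longlongrightarrow> 0) (at v)" by (rule Lim_null_comparison)
    then show ?thesis unfolding isCont_def by (rule LIM_zero_cancel)
  qed
  \<comment> \<open>Complex evaluation at \<open>x\<close> reduces the operator-valued resolvent to
    scalar holomorphic functions.\<close>
  define ev where "ev x p = Complex (apply_bcontfun (fst p) x) (apply_bcontfun (snd p) x)"
    for x and p :: "('a \<Rightarrow>\<^sub>C real) \<times> ('a \<Rightarrow>\<^sub>C real)"
  have ev_scale: "ev x (complex_scale z p) = z * ev x p" for x z p
    by (simp add: ev_def complex_scale_def complex_eq_iff algebra_simps)
  have ev_diff: "ev x (p - p') = ev x p - ev x p'" and ev_add: "ev x (p + p') = ev x p + ev x p'" for x p p'
    by (simp_all add: ev_def complex_eq_iff)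
  have ev_bound: "cmod (ev x p) \<le> 2 * norm p" for x p
  proof -
    have "cmod (ev x p) \<le> \<bar>apply_bcontfun (fst p) x\<bar> + \<bar>apply_bcontfun (snd p) x\<bar>"
      using cmod_le[of "ev x p"] by (simp add: ev_def)
    also have "\<dots> \<le> norm (fst p) + norm (snd p)"
      using norm_bounded[of "fst p" x] norm_bounded[of "snd p" x] by simp
    also have "\<dots> \<le> 2 * norm p"
      using norm_fst_le[of "fst p" "snd p"] norm_snd_le[of "snd p" "fst p"] by simp
    finally show ?thesis .
  qed
  have bl_ev: "bounded_linear (ev x)" for x
  proof (rule bounded_linear_intro[where K = 2])
    show "ev x (a *\<^sub>R p) = a *\<^sub>R ev x p" for a p by (simp add: ev_def complex_eq_iff)
    show "cmod (ev x p) \<le> norm p * 2" for p using ev_bound[of x p] by simp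
  qed (rule ev_add)
  define f where "f x p w = ev x (blinfun_apply (S w) p)" for x p w
  have f_cont: "isCont (f x p) v" if "v \<in> D" for x p v
    unfolding f_def by (intro bounded_linear.isCont[OF bl_ev] bounded_bilinear.isCont[OF bounded_bilinear_blinfun_apply] contS[OF that] continuous_const)
  have f_deriv: "(f x p has_field_derivative f x (?N (blinfun_apply (S v) p)) v) (at v)" if v: "v \<in> D" for x p v
    unfolding has_field_derivative_iff
  proof (rule Lim_transform_eventually)
    show "(f x (?N (blinfun_apply (S v) p)) \<longlongrightarrow> f x (?N (blinfun_apply (S v) p)) v) (at v)"
      using f_cont[OF v] by (simp add: isCont_def)
    have "\<forall>\<^sub>F w in at v. w \<in> D \<and> w \<noteq> v"
      using openD v by (auto simp: eventually_at_topological)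
    then show "\<forall>\<^sub>F w in at v. f x (?N (blinfun_apply (S v) p)) w = (f x p w - f x p v) / (w - v)"
    proof eventually_elim
      case (elim w)
      have "f x p w - f x p v = (w - v) * f x (?N (blinfun_apply (S v) p)) w"
        using elim v by (simp add: f_def ev_diff[symmetric] resolvent scale ev_scale)
      then show ?case using elim by simp
    qed
  qed
  have f_hol: "f x p holomorphic_on D" for x p
    unfolding holomorphic_on_def
    using f_deriv field_differentiable_at_within field_differentiable_def by blast
  have D0: "0 \<in> D" using r by (simp add: D_def)
  have f_fps: "f x p has_fps_expansion fps_expansion (f x p) 0" for x p
    by (rule analytic_at_imp_has_fps_expansion_0)
       (unfold analytic_at, intro exI[of _ D] conjI openD D0 f_hol)
  \<comment> \<open>This is \<open>S w (1 - w N) p = p\<close> evaluated at \<open>x\<close>;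
    multiplication by \<open>w\<close> shifts Taylor coefficients by one, which drives the induction
    in \<open>coeff\<close>.\<close>
  have f_rec: "f x p w = ev x p + w * f x (?N p) w" if w: "w \<in> D" for x p w
  proof -
    have "blinfun_apply (S w) p - blinfun_apply (S w) (complex_scale w (?N p)) = p"
      using S_left[OF w, of p] by (simp add: blinfun.diff_right)
    then have "blinfun_apply (S w) p = p + complex_scale w (blinfun_apply (S w) (?N p))"
      using scale[OF w] by (simp add: algebra_simps)
    then show ?thesis by (simp add: f_def ev_add ev_scale)
  qed
  have f_fps': "f x p has_fps_expansion fps_const (ev x p) + fps_X * fps_expansion (f x (?N p)) 0" for x p
  proof (rule has_fps_expansion_cong[THEN iffD1])
    show "(\<lambda>w. ev x p + w * f x (?N p) w) has_fps_expansion fps_const (ev x p) + fps_X * fps_expansion (f x (?N p)) 0"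
      by (intro has_fps_expansion_add has_fps_expansion_mult has_fps_expansion_const has_fps_expansion_fps_X f_fps)
    show "\<forall>\<^sub>F w in nhds 0. ev x p + w * f x (?N p) w = f x p w"
      using eventually_nhds_in_open[OF openD D0] by eventually_elim (rule f_rec[symmetric])
  qed simp
  have coeff: "(deriv ^^ n) (f x p) 0 / fact n = ev x (map_prod (N ^^ n) (N ^^ n) p)" for n x p
  proof (induction n arbitrary: p)
    case 0
    show ?case using f_rec[OF D0, of x p] by (simp add: ev_def)
  next
    case (Suc n)
    have "(deriv ^^ Suc n) (f x p) 0 / fact (Suc n) = fps_nth (fps_const (ev x p) + fps_X * fps_expansion (f x (?N p)) 0) (Suc n)"
      by (rule fps_nth_fps_expansion[OF f_fps', symmetric])
    also have "\<dots> = fps_nth (fps_expansion (f x (?N p)) 0) n" by simp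
    also have "\<dots> = (deriv ^^ n) (f x (?N p)) 0 / fact n" by (rule fps_nth_fps_expansion[OF f_fps])
    also have "\<dots> = ev x (map_prod (N ^^ n) (N ^^ n) (?N p))" by (rule Suc)
    also have "map_prod (N ^^ n) (N ^^ n) (?N p) = map_prod (N ^^ Suc n) (N ^^ Suc n) p"
      by (simp add: prod_eq_iff funpow_swap1)
    finally show ?case .
  qed
  define s where "s = 1 / \<rho>"
  have s: "s > 0" "s < 1 / r" using r \<rho> by (auto simp: s_def divide_strict_left_mono)
  have cballD: "cball 0 s \<subseteq> D" using s by (auto simp: D_def)
  \<comment> \<open>Continuity of \<open>S\<close> in operator norm on a compact disc makes the
    bound \<open>B\<close> independent of \<open>x\<close>, \<open>\<phi>\<close> and
    \<open>n\<close>.\<close>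
  have "compact (S ` cball 0 s)"
    using contS cballD by (intro compact_continuous_image continuous_at_imp_continuous_on) auto
  then have "bounded (S ` cball 0 s)" by (rule compact_imp_bounded)
  then obtain B where SB: "\<forall>y\<in>S ` cball 0 s. norm y \<le> B" unfolding bounded_iff by (rule exE)
  have B: "norm (S w) \<le> B" if "w \<in> cball 0 s" for w by (rule bspec[OF SB imageI[OF that]])
  have "B \<ge> 0" using order_trans[OF norm_ge_zero B[of 0]] s by simp
  have "norm ((N ^^ n) \<phi>) \<le> 2 * B * \<rho> ^ n * norm \<phi>" for n \<phi>
  proof (rule norm_bound)
    fix x
    define p :: "('a \<Rightarrow>\<^sub>C real) \<times> ('a \<Rightarrow>\<^sub>C real)" where "p = (\<phi>, 0)"
    have np: "norm p = norm \<phi>" by (simp add: p_def norm_Pair)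
    have "cmod ((deriv ^^ n) (f x p) 0) \<le> fact n * (2 * B * norm \<phi>) / s ^ n"
    proof (rule Cauchy_inequality)
      show "f x p holomorphic_on ball 0 s" by (rule holomorphic_on_subset[OF f_hol]) (use cballD in auto)
      show "continuous_on (cball 0 s) (f x p)"
        by (rule holomorphic_on_imp_continuous_on, rule holomorphic_on_subset[OF f_hol cballD])
      show "s > 0" by (rule s)
      fix w :: complex assume "cmod (0 - w) = s"
      then have "norm (S w) \<le> B" by (intro B) simp
      then have "norm (blinfun_apply (S w) p) \<le> B * norm p"
        by (meson norm_blinfun mult_right_mono norm_ge_zero order_trans)
      then show "cmod (f x p w) \<le> 2 * B * norm \<phi>"
        using ev_bound[of x "blinfun_apply (S w) p"] by (simp add: f_def np)
    qed
    then have "cmod ((deriv ^^ n) (f x p) 0 / fact n) \<le> 2 * B * norm \<phi> / s ^ n"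
      by (simp add: norm_divide field_simps)
    then have "cmod (ev x (map_prod (N ^^ n) (N ^^ n) p)) \<le> 2 * B * norm \<phi> * \<rho> ^ n"
      unfolding coeff by (simp add: s_def power_inverse divide_inverse)
    moreover have "\<bar>apply_bcontfun ((N ^^ n) \<phi>) x\<bar> \<le> cmod (ev x (map_prod (N ^^ n) (N ^^ n) p))"
      using abs_Re_le_cmod[of "ev x (map_prod (N ^^ n) (N ^^ n) p)"] by (simp add: ev_def p_def)
    ultimately show "norm (apply_bcontfun ((N ^^ n) \<phi>) x) \<le> 2 * B * \<rho> ^ n * norm \<phi>"
      by (simp add: mult_ac)
  qed
  then show ?thesis by blast
qed

section \<open>Convergence to the mean\<close>

lemma linear_funpow: "linear F \<Longrightarrow> linear (F ^^ n)" for F :: "'a::real_vector \<Rightarrow> 'a"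
  by (induction n) (simp_all add: linear_iff)

text \<open>A band of values survives every further step, because \<open>V\<close> is monotone and
  fixes constants, and \<open>m\<close> steps shrink its width by the factor \<open>\<rho>\<close>.
  The iterates are therefore Cauchy, and a limit lying in bands of arbitrarily small width is
  constant.\<close>

lemma markov_convergence:
  fixes V :: "('a::metric_space \<Rightarrow>\<^sub>C real) \<Rightarrow> ('a \<Rightarrow>\<^sub>C real)"
  assumes V: "linear V" and const: "\<And>c. V (const_bcontfun c) = const_bcontfun c"
    and mono: "\<And>\<phi> \<psi> x. (\<And>x. apply_bcontfun \<phi> x \<le> apply_bcontfun \<psi> x) \<Longrightarrow> apply_bcontfun (V \<phi>) x \<le> apply_bcontfun (V \<psi>) x"
    and \<rho>: "0 < \<rho>" "\<rho> < 1"
    and osc: "\<forall>\<phi>. (\<forall>x. 0 \<le> apply_bcontfun \<phi> x \<and> apply_bcontfun \<phi> x \<le> 1) \<longrightarrow>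
        (\<exists>a. \<forall>x. a \<le> apply_bcontfun ((V ^^ m) \<phi>) x \<and> apply_bcontfun ((V ^^ m) \<phi>) x \<le> a + \<rho>)"
    and m: "m > 0"
  shows "\<exists>c \<theta> K. 0 < \<theta> \<and> \<theta> < 1 \<and> 0 \<le> K \<and> (\<forall>n \<phi>. norm ((V ^^ n) \<phi> - const_bcontfun (c \<phi>)) \<le> K * \<theta> ^ n * norm \<phi>)"
proof -
  have Vn_const: "(V ^^ n) (const_bcontfun c) = const_bcontfun c" for n c
    by (induction n) (simp_all add: const)
  have Vn_mono: "apply_bcontfun ((V ^^ n) \<phi>) x \<le> apply_bcontfun ((V ^^ n) \<psi>) x"
    if "\<And>x. apply_bcontfun \<phi> x \<le> apply_bcontfun \<psi> x" for n \<phi> \<psi> x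
    by (induction n arbitrary: x) (simp_all add: that mono)
  have Vn_linear: "linear (V ^^ n)" for n
    using V by (rule linear_funpow)
  define in_band where "in_band a L \<phi> \<longleftrightarrow> (\<forall>x. a \<le> apply_bcontfun \<phi> x \<and> apply_bcontfun \<phi> x \<le> a + L)"
    for a L and \<phi> :: "'a \<Rightarrow>\<^sub>C real"
  have in_band_pow: "in_band a L ((V ^^ n) \<phi>)" if "in_band a L \<phi>" for a L n \<phi>
    using Vn_mono[of "const_bcontfun a" \<phi> n] Vn_mono[of \<phi> "const_bcontfun (a + L)" n] that
    by (simp add: in_band_def Vn_const)
  have step: "\<exists>a'. in_band a' (\<rho> * L) ((V ^^ m) \<phi>)" if w: "in_band a L \<phi>" and L: "L \<ge> 0" for a L \<phi>
  proof (cases "L = 0")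
    case True
    then show ?thesis using in_band_pow[OF w] by auto
  next
    case False
    with L have L: "L > 0" by simp
    \<comment> \<open>Affine normalisation to values in \<open>[0, 1]\<close>, where
      \<open>osc\<close> applies.\<close>
    define \<psi> where "\<psi> = (1 / L) *\<^sub>R (\<phi> - const_bcontfun a)"
    have \<phi>: "\<phi> = L *\<^sub>R \<psi> + const_bcontfun a" using L by (simp add: \<psi>_def)
    have "\<forall>x. 0 \<le> apply_bcontfun \<psi> x \<and> apply_bcontfun \<psi> x \<le> 1"
      using w L by (simp add: \<psi>_def in_band_def field_simps)
    then obtain d where d: "\<forall>x. d \<le> apply_bcontfun ((V ^^ m) \<psi>) x \<and> apply_bcontfun ((V ^^ m) \<psi>) x \<le> d + \<rho>"
      using osc by blast
    have "(V ^^ m) \<phi> = L *\<^sub>R (V ^^ m) \<psi> + const_bcontfun a"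
      unfolding \<phi> using Vn_linear[of m] by (simp add: linear_add linear_scale Vn_const)
    moreover have "L * d \<le> L * apply_bcontfun ((V ^^ m) \<psi>) x" "L * apply_bcontfun ((V ^^ m) \<psi>) x \<le> L * (d + \<rho>)" for x
      using d L by (auto intro!: mult_left_mono)
    ultimately have "in_band (L * d + a) (\<rho> * L) ((V ^^ m) \<phi>)"
      by (simp add: in_band_def algebra_simps)
    then show ?thesis ..
  qed
  have iter: "\<exists>a. in_band a (\<rho> ^ n * (2 * norm \<phi>)) ((V ^^ (m * n)) \<phi>)" for n \<phi>
  proof (induction n)
    case 0
    have "in_band (- norm \<phi>) (2 * norm \<phi>) \<phi>" by (simp add: in_band_def bcontfun_le_norm)
    then show ?case by auto
  next
    case (Suc n)
    then obtain a where "in_band a (\<rho> ^ n * (2 * norm \<phi>)) ((V ^^ (m * n)) \<phi>)" ..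
    from step[OF this] \<rho> show ?case by (simp add: funpow_add mult.assoc)
  qed
  have tail: "\<exists>a. \<forall>k\<ge>m * n. in_band a (\<rho> ^ n * (2 * norm \<phi>)) ((V ^^ k) \<phi>)" for n \<phi>
  proof -
    obtain a where a: "in_band a (\<rho> ^ n * (2 * norm \<phi>)) ((V ^^ (m * n)) \<phi>)" using iter by blast
    have "in_band a (\<rho> ^ n * (2 * norm \<phi>)) ((V ^^ k) \<phi>)" if "k \<ge> m * n" for k
    proof -
      have "(V ^^ k) \<phi> = (V ^^ (k - m * n)) ((V ^^ (m * n)) \<phi>)"
        using that by (simp flip: funpow_add[THEN fun_cong, unfolded o_def])
      then show ?thesis using in_band_pow[OF a] by simp
    qed
    then show ?thesis by blast
  qed
  have in_band_norm: "norm (\<phi> - \<psi>) \<le> L" if "in_band a L \<phi>" "in_band a L \<psi>" for a L \<phi> \<psi>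
  proof (rule norm_bound)
    fix x
    have "a \<le> apply_bcontfun \<phi> x" "apply_bcontfun \<phi> x \<le> a + L" "a \<le> apply_bcontfun \<psi> x" "apply_bcontfun \<psi> x \<le> a + L"
      using that by (simp_all add: in_band_def)
    then show "norm (apply_bcontfun (\<phi> - \<psi>) x) \<le> L" by simp
  qed
  have pow_small: "\<exists>n. \<rho> ^ n * C < e" if "e > 0" for C e :: real
  proof -
    have "(\<lambda>n. \<rho> ^ n * C) \<longlonglongrightarrow> 0 * C" using \<rho> by (intro tendsto_intros LIMSEQ_power_zero) simp
    then have "\<forall>\<^sub>F n in sequentially. \<rho> ^ n * C < e" using that by (intro order_tendstoD(2)) auto
    then show ?thesis by (auto simp: eventually_sequentially)
  qed
  have lim: "\<exists>\<gamma>. \<forall>n k. m * n \<le> k \<longrightarrow> norm ((V ^^ k) \<phi> - const_bcontfun \<gamma>) \<le> \<rho> ^ n * (2 * norm \<phi>)" for \<phi>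
  proof -
    have "Cauchy (\<lambda>k. (V ^^ k) \<phi>)"
    proof (rule CauchyI)
      fix e :: real assume "e > 0"
      then obtain n where n: "\<rho> ^ n * (2 * norm \<phi>) < e" using pow_small by blast
      obtain a where a: "\<forall>k\<ge>m * n. in_band a (\<rho> ^ n * (2 * norm \<phi>)) ((V ^^ k) \<phi>)" using tail by blast
      show "\<exists>M. \<forall>k\<ge>M. \<forall>l\<ge>M. norm ((V ^^ k) \<phi> - (V ^^ l) \<phi>) < e"
      proof (intro exI[of _ "m * n"] allI impI)
        fix k l assume "m * n \<le> k" "m * n \<le> l"
        then have "norm ((V ^^ k) \<phi> - (V ^^ l) \<phi>) \<le> \<rho> ^ n * (2 * norm \<phi>)" using a by (intro in_band_norm) auto
        then show "norm ((V ^^ k) \<phi> - (V ^^ l) \<phi>) < e" using n by simp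
      qed
    qed
    then obtain g where g: "(\<lambda>k. (V ^^ k) \<phi>) \<longlonglongrightarrow> g"
      using Cauchy_convergent convergent_def by blast
    have glim: "(\<lambda>k. apply_bcontfun ((V ^^ k) \<phi>) x) \<longlonglongrightarrow> apply_bcontfun g x" for x
      by (rule tendsto_uniform_limitI[OF tendsto_bcontfun_uniform_limit[OF g]]) simp
    have g_in_band: "in_band a L g" if "\<forall>k\<ge>N. in_band a L ((V ^^ k) \<phi>)" for a L N
      unfolding in_band_def
    proof (intro allI conjI)
      fix x
      show "a \<le> apply_bcontfun g x"
        by (rule LIMSEQ_le_const[OF glim]) (use that in \<open>auto simp: in_band_def\<close>)
      show "apply_bcontfun g x \<le> a + L"
        by (rule LIMSEQ_le_const2[OF glim]) (use that in \<open>auto simp: in_band_def\<close>)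
    qed
    have gconst: "apply_bcontfun g x \<le> apply_bcontfun g y" for x y
    proof (rule field_le_epsilon)
      fix e :: real assume "e > 0"
      then obtain n where n: "\<rho> ^ n * (2 * norm \<phi>) < e" using pow_small by blast
      obtain a where "\<forall>k\<ge>m * n. in_band a (\<rho> ^ n * (2 * norm \<phi>)) ((V ^^ k) \<phi>)" using tail by blast
      from g_in_band[OF this] have "a \<le> apply_bcontfun g y" "apply_bcontfun g x \<le> a + \<rho> ^ n * (2 * norm \<phi>)"
        by (simp_all add: in_band_def)
      then show "apply_bcontfun g x \<le> apply_bcontfun g y + e" using n by linarith
    qed
    \<comment> \<open>\<open>undefined\<close> stands for an arbitrary point of the space.\<close>
    have g_eq: "g = const_bcontfun (apply_bcontfun g undefined)"
      by (rule bcontfun_eqI) (simp add: antisym[OF gconst gconst])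
    show ?thesis
    proof (intro exI[of _ "apply_bcontfun g undefined"] allI impI)
      fix n k assume k: "m * n \<le> k"
      obtain a where a: "\<forall>k\<ge>m * n. in_band a (\<rho> ^ n * (2 * norm \<phi>)) ((V ^^ k) \<phi>)" using tail by blast
      show "norm ((V ^^ k) \<phi> - const_bcontfun (apply_bcontfun g undefined)) \<le> \<rho> ^ n * (2 * norm \<phi>)"
        unfolding g_eq[symmetric] by (rule in_band_norm[OF a[rule_format, OF k] g_in_band[OF a]])
    qed
  qed
  have "\<forall>\<phi>. \<exists>\<gamma>. \<forall>n k. m * n \<le> k \<longrightarrow> norm ((V ^^ k) \<phi> - const_bcontfun \<gamma>) \<le> \<rho> ^ n * (2 * norm \<phi>)"
    using lim by (rule allI)
  from choice[OF this] obtain c where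
    c: "\<forall>\<phi> n k. m * n \<le> k \<longrightarrow> norm ((V ^^ k) \<phi> - const_bcontfun (c \<phi>)) \<le> \<rho> ^ n * (2 * norm \<phi>)"
    by (rule exE)
  \<comment> \<open>The root converts decay per block of \<open>m\<close> steps into decay per step;
    the incomplete block costs a factor \<open>1 / \<rho>\<close>, and the 2 below comes from the
    initial width \<open>2 * norm \<phi>\<close>.\<close>
  define \<theta> where "\<theta> = root m \<rho>"
  have \<theta>: "0 < \<theta>" "\<theta> < 1" "\<theta> ^ m = \<rho>" using \<rho> m by (simp_all add: \<theta>_def)
  have "norm ((V ^^ k) \<phi> - const_bcontfun (c \<phi>)) \<le> (2 / \<rho>) * \<theta> ^ k * norm \<phi>" for k \<phi>
  proof -
    have "\<theta> ^ m \<le> \<theta> ^ (k mod m)" using \<theta> m by (intro power_decreasing) (auto intro: less_imp_le)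
    then have "\<rho> ^ (k div m) * \<theta> ^ m \<le> \<rho> ^ (k div m) * \<theta> ^ (k mod m)" using \<rho> by (intro mult_left_mono) auto
    also have "\<rho> ^ (k div m) * \<theta> ^ (k mod m) = \<theta> ^ k"
      unfolding \<theta>(3)[symmetric] by (simp flip: power_mult power_add)
    finally have "\<rho> ^ (k div m) \<le> \<theta> ^ k / \<rho>" using \<rho> \<theta> by (simp add: field_simps)
    then have "\<rho> ^ (k div m) * (2 * norm \<phi>) \<le> \<theta> ^ k / \<rho> * (2 * norm \<phi>)" by (intro mult_right_mono) auto
    moreover have "norm ((V ^^ k) \<phi> - const_bcontfun (c \<phi>)) \<le> \<rho> ^ (k div m) * (2 * norm \<phi>)"
      using c by simp
    ultimately show ?thesis by (simp add: mult_ac)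
  qed
  then have "\<forall>n \<phi>. norm ((V ^^ n) \<phi> - const_bcontfun (c \<phi>)) \<le> (2 / \<rho>) * \<theta> ^ n * norm \<phi>" by blast
  moreover have "0 \<le> 2 / \<rho>" using \<rho> by simp
  ultimately show ?thesis using \<theta>(1,2) by (intro exI[of _ c] exI[of _ \<theta>] exI[of _ "2 / \<rho>"] conjI)
qed

section \<open>The limiting mean and its transport along the evolution\<close>

context periodic_parabolic
begin

lemma G_period_funpow: "(G (s + T) s ^^ n) \<phi> = G (s + real n * T) s \<phi>"
proof (induction n)
  case 0
  then show ?case by (simp add: G_refl)
next
  case (Suc n)
  have "G (s + T + real n * T) (s + real n * T) (G (s + real n * T) s \<phi>) = G (s + T + real n * T) s \<phi>"
    using T_pos by (intro G_comp) auto
  then show ?case using Suc T_pos G_shift_nat[of s "s + T" n "G (s + real n * T) s \<phi>"]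
    by (simp add: algebra_simps)
qed

lemma V_funpow: "(V ^^ n) \<phi> = G (of_int k * T + real n * T) (of_int k * T) \<phi>"
  unfolding V_G[of k] by (rule G_period_funpow)

text \<open>The choice is harmless: any admissible \<open>c\<close> gives the limit of
  \<open>(V ^^ n) \<phi>\<close>, so there is only one.\<close>

definition mean0 :: "'n Cb \<Rightarrow> real" where
  "mean0 = (SOME c. \<exists>\<theta> K. 0 < \<theta> \<and> \<theta> < 1 \<and> 0 \<le> K \<and>
     (\<forall>n \<phi>. norm ((V ^^ n) \<phi> - const_bcontfun (c \<phi>)) \<le> K * \<theta> ^ n * norm \<phi>))"

lemma mean0_decay:
  "\<exists>\<theta> K. 0 < \<theta> \<and> \<theta> < 1 \<and> 0 \<le> K \<and> (\<forall>n \<phi>. norm ((V ^^ n) \<phi> - const_bcontfun (mean0 \<phi>)) \<le> K * \<theta> ^ n * norm \<phi>)"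
proof -
  obtain \<rho> where \<rho>: "0 < \<rho>" "\<rho> < 1" and osc:
    "\<forall>\<phi>. (\<forall>x. 0 \<le> apply_bcontfun \<phi> x \<and> apply_bcontfun \<phi> x \<le> 1) \<longrightarrow>
        (\<exists>a. \<forall>x. a \<le> apply_bcontfun (V (V (V \<phi>))) x \<and> apply_bcontfun (V (V (V \<phi>))) x \<le> a + \<rho>)"
    using V_oscillation by (elim exE conjE)
  have "V (V (V \<phi>)) = (V ^^ 3) \<phi>" for \<phi> by (simp add: numeral_3_eq_3)
  from osc[unfolded this]
  have "\<exists>c \<theta> K. 0 < \<theta> \<and> \<theta> < 1 \<and> 0 \<le> K \<and> (\<forall>n \<phi>. norm ((V ^^ n) \<phi> - const_bcontfun (c \<phi>)) \<le> K * \<theta> ^ n * norm \<phi>)"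
    by (intro markov_convergence[OF bounded_linear.linear[OF V_linear] V_const V_mono \<rho>, where m = 3]) simp_all
  then show ?thesis unfolding mean0_def by (rule someI_ex)
qed

lemma V_funpow_tendsto: "(\<lambda>n. (V ^^ n) \<phi>) \<longlonglongrightarrow> const_bcontfun (mean0 \<phi>)"
proof -
  obtain \<theta> K where \<theta>: "0 < \<theta>" "\<theta> < 1" "0 \<le> K"
    and dec: "\<forall>n \<phi>. norm ((V ^^ n) \<phi> - const_bcontfun (mean0 \<phi>)) \<le> K * \<theta> ^ n * norm \<phi>"
    using mean0_decay by (elim exE conjE)
  have "(\<lambda>n. K * \<theta> ^ n * norm \<phi>) \<longlonglongrightarrow> K * 0 * norm \<phi>"
    using \<theta> by (intro tendsto_intros LIMSEQ_power_zero) simp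
  then have "(\<lambda>n. K * \<theta> ^ n * norm \<phi>) \<longlonglongrightarrow> 0" by simp
  then have "(\<lambda>n. (V ^^ n) \<phi> - const_bcontfun (mean0 \<phi>)) \<longlonglongrightarrow> 0"
    by (rule Lim_null_comparison[rotated]) (use dec in simp)
  then show ?thesis by (rule LIM_zero_cancel)
qed

text \<open>Linearity, normalisation and invariance of \<open>mean0\<close> are read off from the
  corresponding properties of the powers of \<open>V\<close>.\<close>

lemma mean0_unique:
  assumes "(\<lambda>n. (V ^^ n) \<phi>) \<longlonglongrightarrow> const_bcontfun \<gamma>"
  shows "mean0 \<phi> = \<gamma>"
proof -
  have "const_bcontfun (mean0 \<phi>) = (const_bcontfun \<gamma> :: 'n Cb)"
    by (rule LIMSEQ_unique[OF V_funpow_tendsto assms])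
  then have "apply_bcontfun (const_bcontfun (mean0 \<phi>) :: 'n Cb) 0 = apply_bcontfun (const_bcontfun \<gamma> :: 'n Cb) 0" by simp
  then show ?thesis by simp
qed

lemma V_funpow_linear: "linear (V ^^ n)"
  by (rule linear_funpow[OF bounded_linear.linear[OF V_linear]])

lemma mean0_add_scale: "mean0 (\<phi> + a *\<^sub>R \<psi>) = mean0 \<phi> + a * mean0 \<psi>"
proof (rule mean0_unique)
  have "(\<lambda>n. (V ^^ n) \<phi> + a *\<^sub>R (V ^^ n) \<psi>) \<longlonglongrightarrow> const_bcontfun (mean0 \<phi>) + a *\<^sub>R const_bcontfun (mean0 \<psi>)"
    by (intro tendsto_intros V_funpow_tendsto)
  moreover have "const_bcontfun (mean0 \<phi>) + a *\<^sub>R const_bcontfun (mean0 \<psi>) = (const_bcontfun (mean0 \<phi> + a * mean0 \<psi>) :: 'n Cb)"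
    by (rule bcontfun_eqI) simp
  ultimately show "(\<lambda>n. (V ^^ n) (\<phi> + a *\<^sub>R \<psi>)) \<longlonglongrightarrow> const_bcontfun (mean0 \<phi> + a * mean0 \<psi>)"
    by (simp add: linear_add[OF V_funpow_linear] linear_scale[OF V_funpow_linear])
qed

lemma mean0_const: "mean0 (const_bcontfun a) = a"
proof (rule mean0_unique)
  have "(V ^^ n) (const_bcontfun a) = const_bcontfun a" for n by (induction n) (simp_all add: V_const)
  then show "(\<lambda>n. (V ^^ n) (const_bcontfun a)) \<longlonglongrightarrow> const_bcontfun a" by simp
qed

lemma mean0_V_funpow: "mean0 ((V ^^ n) \<phi>) = mean0 \<phi>"
proof (rule mean0_unique)
  show "(\<lambda>k. (V ^^ k) ((V ^^ n) \<phi>)) \<longlonglongrightarrow> const_bcontfun (mean0 \<phi>)"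
    using LIMSEQ_ignore_initial_segment[OF V_funpow_tendsto[of \<phi>], of n] by (simp add: funpow_add)
qed

lemma mean0_nonneg:
  assumes "\<And>x. 0 \<le> apply_bcontfun \<phi> x"
  shows "0 \<le> mean0 \<phi>"
proof -
  have "(\<lambda>n. apply_bcontfun ((V ^^ n) \<phi>) 0) \<longlonglongrightarrow> apply_bcontfun (const_bcontfun (mean0 \<phi>) :: 'n Cb) 0"
    by (rule tendsto_uniform_limitI[OF tendsto_bcontfun_uniform_limit[OF V_funpow_tendsto]]) simp
  then have lim: "(\<lambda>n. apply_bcontfun ((V ^^ n) \<phi>) 0) \<longlonglongrightarrow> mean0 \<phi>" by simp
  have "0 \<le> apply_bcontfun ((V ^^ n) \<phi>) x" for n x
    unfolding V_funpow[of n \<phi> 0] using T_pos assms by (intro G_nonneg) auto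
  then show ?thesis by (intro LIMSEQ_le_const[OF lim]) auto
qed

lemma mean0_abs_le: "\<bar>mean0 \<phi>\<bar> \<le> norm \<phi>"
proof -
  have "0 \<le> mean0 (const_bcontfun (norm \<phi>) + a *\<^sub>R \<phi>)" if "\<bar>a\<bar> = 1" for a
  proof (rule mean0_nonneg)
    fix x
    have "\<bar>a * apply_bcontfun \<phi> x\<bar> \<le> norm \<phi>" using norm_bounded[of \<phi> x] that by (simp add: abs_mult)
    then show "0 \<le> apply_bcontfun (const_bcontfun (norm \<phi>) + a *\<^sub>R \<phi>) x" by simp
  qed
  from this[of 1] this[of "-1"] show ?thesis unfolding mean0_add_scale mean0_const by simp
qed

text \<open>The floor plus 1 makes the multiple of \<open>T\<close> strictly later than
  \<open>s\<close>, even when \<open>s\<close> is a multiple itself, so that compactness of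
  \<open>G\<close> over a positive time step is available in \<open>mean_daniell\<close>.\<close>

definition mean :: "real \<Rightarrow> 'n Cb \<Rightarrow> real" where
  "mean s \<phi> = mean0 (G (of_int (\<lfloor>s / T\<rfloor> + 1) * T) s \<phi>)"

lemma next_multiple: "s < of_int (\<lfloor>s / T\<rfloor> + 1) * T"
proof -
  have "s / T < of_int (\<lfloor>s / T\<rfloor> + 1)" by linarith
  then show ?thesis by (simp only: pos_divide_less_eq[OF T_pos])
qed

text \<open>Passing to a later multiple of \<open>T\<close> applies a power of \<open>V\<close>,
  which leaves \<open>mean0\<close> unchanged.\<close>

lemma mean_eq:
  assumes "s \<le> of_int k * T"
  shows "mean0 (G (of_int k * T) s \<phi>) = mean s \<phi>"
proof -
  have le: "mean0 (G (of_int l * T) s \<phi>) = mean0 (G (of_int k * T) s \<phi>)" if "s \<le> of_int k * T" "k \<le> l" for k l :: int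
  proof -
    have "of_int k * T \<le> of_int l * T" using that T_pos by (intro mult_right_mono) auto
    then have "G (of_int l * T) s \<phi> = G (of_int l * T) (of_int k * T) (G (of_int k * T) s \<phi>)"
      using that by (intro G_comp[symmetric])
    also have "\<dots> = (V ^^ nat (l - k)) (G (of_int k * T) s \<phi>)"
      unfolding V_funpow[of _ _ k] using that by (simp add: algebra_simps)
    finally show ?thesis by (simp add: mean0_V_funpow)
  qed
  let ?m = "\<lfloor>s / T\<rfloor> + 1"
  show ?thesis
    unfolding mean_def using le[of k ?m] le[of ?m k] assms next_multiple[of s] by (cases "k \<le> ?m") auto
qed

lemma mean_G: "s \<le> t \<Longrightarrow> mean t (G t s \<phi>) = mean s \<phi>"
  using next_multiple[of t] G_comp[of s t "of_int (\<lfloor>t / T\<rfloor> + 1) * T" \<phi>]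
    mean_eq[of s "\<lfloor>t / T\<rfloor> + 1" \<phi>] by (simp add: mean_def)

lemma mean_periodic: "mean (s + T) \<phi> = mean s \<phi>"
proof -
  let ?m = "\<lfloor>s / T\<rfloor> + 1"
  have "mean (s + T) \<phi> = mean0 (G (of_int (?m + 1) * T) (s + T) \<phi>)"
    using next_multiple[of s] by (intro mean_eq[symmetric]) (simp add: distrib_right)
  also have "G (of_int (?m + 1) * T) (s + T) \<phi> = G (of_int ?m * T) s \<phi>"
    using next_multiple[of s] G_shift[of s "of_int ?m * T" \<phi>] by (simp add: distrib_right)
  finally show ?thesis by (simp add: mean_def)
qed

text \<open>Only the Daniell condition needs work: Dini's theorem makes the convergence locally
  uniform, and \<open>G_tendsto_zero\<close> turns this into norm convergence.\<close>

lemma mean_daniell: "daniell_functional (mean s)"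
proof
  let ?t = "of_int (\<lfloor>s / T\<rfloor> + 1) * T"
  have t: "s < ?t" by (rule next_multiple)
  show "mean s (f + a *\<^sub>R g) = mean s f + a * mean s g" for f a g
    using t by (simp only: mean_def G_add_scale[OF less_imp_le] mean0_add_scale)
  show "0 \<le> mean s f" if "\<And>x. 0 \<le> apply_bcontfun f x" for f
    unfolding mean_def by (intro mean0_nonneg G_nonneg less_imp_le[OF t] that)
  show "mean s (const_bcontfun 1) = 1"
    using t by (simp only: mean_def G_const[OF less_imp_le] mean0_const)
  fix F :: "nat \<Rightarrow> 'n Cb"
  assume dec: "\<And>n x. apply_bcontfun (F (Suc n)) x \<le> apply_bcontfun (F n) x"
    and lim: "\<And>x. (\<lambda>n. apply_bcontfun (F n) x) \<longlonglongrightarrow> 0"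
  have "(\<lambda>n. G ?t s (F n)) \<longlonglongrightarrow> 0"
  proof (rule G_tendsto_zero[OF t])
    show "uniform_limit (cball 0 R) (\<lambda>n. apply_bcontfun (F n)) (\<lambda>_. 0) sequentially" for R
      by (rule dini_zero[OF _ dec lim]) auto
    show "norm (F n) \<le> norm (F 0)" for n
    proof (rule norm_bound)
      fix x
      have anti: "decseq (\<lambda>n. apply_bcontfun (F n) x)" by (rule decseq_SucI) (rule dec)
      have "0 \<le> apply_bcontfun (F n) x" by (rule decseq_ge[OF anti lim])
      moreover have "apply_bcontfun (F n) x \<le> apply_bcontfun (F 0) x" by (rule decseqD[OF anti]) simp
      moreover have "apply_bcontfun (F 0) x \<le> norm (F 0)" by (rule bcontfun_le_norm)
      ultimately show "norm (apply_bcontfun (F n) x) \<le> norm (F 0)" by simp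
    qed
  qed
  then have "(\<lambda>n. norm (G ?t s (F n))) \<longlonglongrightarrow> 0" by (rule tendsto_norm_zero)
  then show "(\<lambda>n. mean s (F n)) \<longlonglongrightarrow> 0"
    by (rule Lim_null_comparison[rotated]) (simp only: mean_def real_norm_def mean0_abs_le always_eventually simp_thms)
qed

text \<open>The interval from \<open>s\<close> to \<open>t\<close> is split at the first multiple of
  \<open>T\<close> at or after \<open>s\<close>, followed by \<open>n\<close> full periods and a
  remainder. The end pieces are contractions and together shorter than two periods, whence
  \<open>\<rho>\<^sup>2\<close> in the denominator. If \<open>t\<close> precedes that multiple, less
  than one period passes and the trivial bound 2 is enough.\<close>

lemma decay_of_power_bound:
  assumes B: "\<And>n \<psi>. norm ((V ^^ n) \<psi> - const_bcontfun (mean0 \<psi>)) \<le> B * \<rho> ^ n * norm \<psi>"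
    and \<rho>: "0 < \<rho>" "\<rho> < 1" and B0: "B \<ge> 0" and "s < t"
  shows "norm (G t s \<phi> - const_bcontfun (mean s \<phi>)) \<le> (2 / \<rho> + B / \<rho>\<^sup>2) * exp (ln \<rho> / T * (t - s)) * norm \<phi>"
proof -
  define k where "k = \<lceil>s / T\<rceil>"
  have "s / T \<le> of_int k" "of_int k < s / T + 1" unfolding k_def by linarith+
  then have k: "s \<le> of_int k * T" "of_int k * T < s + T"
    using T_pos by (simp_all add: field_simps)
  define E where "E = exp (ln \<rho> / T * (t - s))"
  have low: "\<rho> ^ j \<le> E" if "t - s \<le> real j * T" for j
  proof -
    have "(t - s) / T \<le> real j" using that T_pos by (simp add: pos_divide_le_eq)
    then have "ln \<rho> * real j \<le> ln \<rho> * ((t - s) / T)"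
      using \<rho> by (intro mult_left_mono_neg) auto
    then have "exp (ln \<rho> * real j) \<le> E" by (simp add: E_def)
    moreover have "exp (ln \<rho> * real j) = \<rho> ^ j"
      using \<rho> by (simp add: exp_of_nat2_mult)
    ultimately show ?thesis by simp
  qed
  have E: "E > 0" by (simp add: E_def)
  have "norm (G t s \<phi> - const_bcontfun (mean s \<phi>)) \<le> (2 / \<rho> + B / \<rho>\<^sup>2) * E * norm \<phi>"
  proof (cases "t < of_int k * T")
    case True
    have "norm (const_bcontfun (mean s \<phi>) :: 'n Cb) \<le> norm \<phi>"
    proof (rule norm_bound)
      have "\<bar>mean s \<phi>\<bar> \<le> norm (G (of_int k * T) s \<phi>)"
        unfolding mean_eq[OF k(1), symmetric] by (rule mean0_abs_le)
      also have "\<dots> \<le> norm \<phi>" by (rule G_norm_le[OF k(1)])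
      finally show "norm (apply_bcontfun (const_bcontfun (mean s \<phi>) :: 'n Cb) x) \<le> norm \<phi>" for x by simp
    qed
    then have "norm (G t s \<phi> - const_bcontfun (mean s \<phi>)) \<le> 2 * norm \<phi>"
      using norm_triangle_ineq4[of "G t s \<phi>" "const_bcontfun (mean s \<phi>)"] G_norm_le[of s t \<phi>] \<open>s < t\<close> by simp
    also have "2 * norm \<phi> \<le> (2 / \<rho>) * E * norm \<phi>"
    proof -
      have "\<rho> \<le> E" using low[of 1] True k by simp
      then have "2 \<le> (2 / \<rho>) * E" using \<rho> by (simp add: field_simps)
      then show ?thesis by (rule mult_right_mono) simp
    qed
    also have "\<dots> \<le> (2 / \<rho> + B / \<rho>\<^sup>2) * E * norm \<phi>"
      using E B0 by (intro mult_right_mono) auto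
    finally show ?thesis .
  next
    case False
    define n where "n = nat \<lfloor>(t - of_int k * T) / T\<rfloor>"
    have nn: "(t - of_int k * T) / T \<ge> 0" using False T_pos by simp
    then have "real n \<le> (t - of_int k * T) / T" "(t - of_int k * T) / T < real n + 1"
      unfolding n_def by (simp_all add: of_nat_nat)
    then have n: "real n * T \<le> t - of_int k * T" "t - of_int k * T < (real n + 1) * T"
      using T_pos by (simp_all add: pos_le_divide_eq pos_divide_less_eq)
    define \<psi> where "\<psi> = G (of_int k * T) s \<phi>"
    define r where "r = of_int k * T + real n * T"
    have r: "r \<le> t" "of_int k * T \<le> r" using n T_pos by (simp_all add: r_def)
    have "G t s \<phi> = G t r ((V ^^ n) \<psi>)"
      unfolding V_funpow[of n \<psi> k] r_def[symmetric] unfolding \<psi>_def using k r by (simp add: G_comp)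
    then have "G t s \<phi> - const_bcontfun (mean s \<phi>) = G t r ((V ^^ n) \<psi> - const_bcontfun (mean0 \<psi>))"
      using r mean_eq[OF k(1), of \<phi>] by (simp add: G_diff G_const \<psi>_def)
    then have "norm (G t s \<phi> - const_bcontfun (mean s \<phi>)) \<le> norm ((V ^^ n) \<psi> - const_bcontfun (mean0 \<psi>))"
      using G_norm_le[OF r(1)] by simp
    also have "\<dots> \<le> B * \<rho> ^ n * norm \<psi>" by (rule B)
    also have "\<dots> \<le> B * \<rho> ^ n * norm \<phi>"
      using B0 \<rho> G_norm_le[OF k(1), of \<phi>] by (intro mult_left_mono) (auto simp: \<psi>_def)
    also have "\<dots> \<le> B / \<rho>\<^sup>2 * E * norm \<phi>"
    proof (rule mult_right_mono)
      have "t - s \<le> real (n + 2) * T" using n k by (simp add: algebra_simps)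
      from low[OF this] have "\<rho> ^ n * \<rho>\<^sup>2 \<le> E" by (simp only: power_add)
      then have "\<rho> ^ n \<le> E / \<rho>\<^sup>2" using \<rho> by (simp add: pos_le_divide_eq)
      then have "B * \<rho> ^ n \<le> B * (E / \<rho>\<^sup>2)" using B0 by (rule mult_left_mono)
      then show "B * \<rho> ^ n \<le> B / \<rho>\<^sup>2 * E" by simp
    qed simp
    also have "\<dots> \<le> (2 / \<rho> + B / \<rho>\<^sup>2) * E * norm \<phi>"
      using E \<rho> by (intro mult_right_mono) auto
    finally show ?thesis .
  qed
  then show ?thesis by (simp add: E_def)
qed

end

section \<open>Spectrum and decay rate\<close>

text \<open>An inverse would write the cutoffs as \<open>- V (u n)\<close> with bounded
  \<open>u n\<close>, and compactness would give them a norm-convergent subsequence; but distinct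
  cutoffs have distance 1.\<close>

lemma zero_in_complex_spectrum_compact:
  fixes V :: "'n::finite Cb \<Rightarrow> 'n Cb"
  assumes V: "bounded_linear V" and comp: "compact_map V"
  shows "0 \<in> complex_spectrum V"
proof (rule ccontr)
  assume "0 \<notin> complex_spectrum V"
  then obtain R where R: "bounded_linear R" "\<And>p. complex_scale 0 (R p) - map_prod V V (R p) = p"
    by (rule not_in_complex_spectrumE[OF _ bounded_linear.linear[OF V]]) (rule that)
  define u where "u n = fst (R (cutoff n, 0))" for n
  have Vu: "V (u n) = - cutoff n" for n
  proof -
    have "- map_prod V V (R (cutoff n, 0)) = (cutoff n, 0)" using R(2)[of "(cutoff n, 0)"] by simp
    then have "- V (u n) = cutoff n" by (auto simp: u_def prod_eq_iff)
    then show ?thesis by (metis minus_minus)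
  qed
  have cut1: "norm (cutoff n :: 'n Cb) \<le> 1" for n
    by (rule norm_bound) (simp add: apply_cutoff)
  have "norm (u n) \<le> onorm R * 1" for n
  proof -
    have "norm (u n) \<le> norm (R (cutoff n, 0))"
      unfolding u_def using norm_fst_le[of "fst (R (cutoff n, 0))" "snd (R (cutoff n, 0))"] by simp
    also have "\<dots> \<le> onorm R * norm (cutoff n :: 'n Cb, 0 :: 'n Cb)" by (rule onorm[OF R(1)])
    also have "\<dots> \<le> onorm R * 1"
      using cut1[of n] onorm_pos_le[OF R(1)] by (intro mult_left_mono) (simp_all add: norm_Pair)
    finally show ?thesis .
  qed
  then obtain l r where r: "strict_mono (r :: nat \<Rightarrow> nat)" "(\<lambda>n. V (u (r n))) \<longlonglongrightarrow> l"
    by (rule compact_map_subsequence[OF comp])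
  then have "Cauchy (\<lambda>n. V (u (r n)))" by (intro LIMSEQ_imp_Cauchy)
  then obtain M where M: "\<forall>m\<ge>M. \<forall>n\<ge>M. dist (V (u (r m))) (V (u (r n))) < 1"
    unfolding Cauchy_def by (metis zero_less_one)
  have "r M < r (Suc M)" using r(1) by (simp add: strict_mono_Suc_iff)
  \<comment> \<open>Since \<open>r M + 1 \<le> r (Suc M)\<close>, at this radius one cutoff has
    reached 1 while the other still vanishes.\<close>
  define x :: "real ^ 'n" where "x = real (r (Suc M)) *\<^sub>R axis undefined 1"
  have "norm x = real (r (Suc M))" by (simp add: x_def)
  then have "apply_bcontfun (cutoff (r M)) x = 1" "apply_bcontfun (cutoff (r (Suc M))) x = 0"
    using \<open>r M < r (Suc M)\<close> by (simp_all add: apply_cutoff)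
  then have "dist (apply_bcontfun (V (u (r M))) x) (apply_bcontfun (V (u (r (Suc M)))) x) = 1"
    by (simp add: Vu dist_real_def)
  moreover have "dist (apply_bcontfun (V (u (r M))) x) (apply_bcontfun (V (u (r (Suc M)))) x) \<le> dist (V (u (r M))) (V (u (r (Suc M))))"
    by (rule dist_bounded)
  moreover have "dist (V (u (r M))) (V (u (r (Suc M)))) < 1" using M by simp
  ultimately show False by linarith
qed

section \<open>Splitting off the eigenvalue 1\<close>

context periodic_parabolic
begin

definition mean_proj :: "real \<Rightarrow> 'n Cb \<Rightarrow> 'n Cb" where
  "mean_proj s \<phi> = const_bcontfun (mean s \<phi>)"

lemma mean_const: "mean s (const_bcontfun a) = a"
  using daniell_functional.const[OF mean_daniell] .

lemma mean_abs_le: "\<bar>mean s \<phi>\<bar> \<le> norm \<phi>"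
  unfolding mean_def by (rule order_trans[OF mean0_abs_le G_norm_le[OF less_imp_le[OF next_multiple]]])

lemma mean_proj_bounded_linear: "bounded_linear (mean_proj s)"
proof (rule bounded_linear_intro[where K = 1])
  show "mean_proj s (\<phi> + \<psi>) = mean_proj s \<phi> + mean_proj s \<psi>" for \<phi> \<psi>
    by (rule bcontfun_eqI) (simp add: mean_proj_def daniell_functional.add[OF mean_daniell])
  show "mean_proj s (a *\<^sub>R \<phi>) = a *\<^sub>R mean_proj s \<phi>" for a \<phi>
    by (rule bcontfun_eqI) (simp add: mean_proj_def daniell_functional.scale[OF mean_daniell])
  show "norm (mean_proj s \<phi>) \<le> norm \<phi> * 1" for \<phi>
    by (rule norm_bound) (simp add: mean_proj_def mean_abs_le)
qed

lemma mean_proj_idem: "mean_proj s (mean_proj s \<phi>) = mean_proj s \<phi>"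
  by (simp add: mean_proj_def mean_const)

lemma G_mean_proj: "s \<le> t \<Longrightarrow> G t s (mean_proj s \<phi>) = mean_proj s \<phi>"
  by (simp add: mean_proj_def G_const)

lemma mean_proj_period: "mean_proj s (G (s + T) s \<phi>) = mean_proj s \<phi>"
  using mean_G[of s "s + T" \<phi>] mean_periodic[of s "G (s + T) s \<phi>"] T_pos by (simp add: mean_proj_def)

lemma period_bounded_linear: "bounded_linear (G (s + T) s)"
  using T_pos by (intro G_bounded_linear) simp

text \<open>The period map with its eigenvalue 1 removed: it vanishes on constants and agrees with
  the period map on the kernel of \<open>mean_proj s\<close>.\<close>

definition defect :: "real \<Rightarrow> 'n Cb \<Rightarrow> 'n Cb" where
  "defect s \<phi> = G (s + T) s \<phi> - mean_proj s \<phi>"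

lemma defect_bounded_linear: "bounded_linear (defect s)"
  unfolding defect_def by (intro bounded_linear_sub period_bounded_linear mean_proj_bounded_linear)

lemma mean_proj_defect: "mean_proj s (defect s \<phi>) = 0"
  by (simp add: defect_def linear_diff[OF bounded_linear.linear[OF mean_proj_bounded_linear]] mean_proj_period mean_proj_idem)

lemma defect_mean_proj: "defect s (mean_proj s \<phi>) = 0"
  using T_pos by (simp add: defect_def G_mean_proj mean_proj_idem)

text \<open>The case \<open>n = 0\<close> is excluded because the zeroth power is the identity and
  not the complementary projection.\<close>

lemma defect_funpow: "n > 0 \<Longrightarrow> (defect s ^^ n) \<phi> = G (s + real n * T) s \<phi> - mean_proj s \<phi>"
proof (induction n)
  case (Suc n)
  show ?case
  proof (cases "n = 0")
    case True
    then show ?thesis by (simp add: defect_def)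
  next
    case False
    then have "(defect s ^^ Suc n) \<phi> = defect s (G (s + real n * T) s \<phi> - mean_proj s \<phi>)"
      using Suc by simp
    also have "\<dots> = defect s (G (s + real n * T) s \<phi>)"
      by (simp add: linear_diff[OF bounded_linear.linear[OF defect_bounded_linear]] defect_mean_proj)
    also have "\<dots> = (G (s + T) s ^^ Suc n) \<phi> - mean_proj s ((G (s + T) s ^^ n) \<phi>)"
      by (simp add: defect_def G_period_funpow[of n s])
    also have "mean_proj s ((G (s + T) s ^^ n) \<phi>) = mean_proj s \<phi>"
      by (induction n) (simp_all add: mean_proj_period)
    finally show ?thesis unfolding G_period_funpow .
  qed
qed simp

text \<open>Both directions are instances of \<open>complex_spectrum_add_projection\<close>, with
  \<open>a = 1\<close>, \<open>b = -1\<close> and with \<open>a = 0\<close>, \<open>b = 1\<close>.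
  The scalars by which the two operators act on constants are 0 and 1, hence the exclusions.\<close>

lemma spectrum_defect:
  assumes "z \<noteq> 0" "z \<noteq> 1"
  shows "z \<in> complex_spectrum (defect s) \<longleftrightarrow> z \<in> complex_spectrum (G (s + T) s)"
proof
  assume "z \<in> complex_spectrum (defect s)"
  moreover have "z \<notin> complex_spectrum (\<lambda>\<phi>. G (s + T) s \<phi> + (-1) *\<^sub>R mean_proj s \<phi>)"
    if "z \<notin> complex_spectrum (G (s + T) s)"
    by (rule complex_spectrum_add_projection[where a = 1])
       (use assms that T_pos in \<open>simp_all add: period_bounded_linear mean_proj_bounded_linear mean_proj_idem G_mean_proj mean_proj_period\<close>)
  moreover have "(\<lambda>\<phi>. G (s + T) s \<phi> + (-1) *\<^sub>R mean_proj s \<phi>) = defect s"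
    by (simp add: defect_def fun_eq_iff)
  ultimately show "z \<in> complex_spectrum (G (s + T) s)" by auto
next
  assume "z \<in> complex_spectrum (G (s + T) s)"
  moreover have "z \<notin> complex_spectrum (\<lambda>\<phi>. defect s \<phi> + 1 *\<^sub>R mean_proj s \<phi>)"
    if "z \<notin> complex_spectrum (defect s)"
    by (rule complex_spectrum_add_projection[where a = 0])
       (use assms that in \<open>simp_all add: defect_bounded_linear mean_proj_bounded_linear mean_proj_idem defect_mean_proj mean_proj_defect\<close>)
  moreover have "(\<lambda>\<phi>. defect s \<phi> + 1 *\<^sub>R mean_proj s \<phi>) = G (s + T) s"
    by (simp add: defect_def fun_eq_iff)
  ultimately show "z \<in> complex_spectrum (defect s)" by auto
qed

lemma norm_diff_mean_le: "norm (\<phi> - mean_proj s \<psi>) \<le> norm \<phi> + norm \<psi>"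
proof -
  have "norm (mean_proj s \<psi>) \<le> norm \<psi>"
    by (rule norm_bound) (simp add: mean_proj_def mean_abs_le)
  then show ?thesis using norm_triangle_ineq4[of \<phi> "mean_proj s \<psi>"] by simp
qed

text \<open>Decay at whole periods bounds the powers of \<open>defect s\<close> by multiples of
  \<open>exp (\<omega> * T) ^ n\<close>, so every point outside that disc lies in its resolvent
  set.\<close>

lemma spectrum_le_of_decay:
  assumes dec: "\<And>t \<phi>. s < t \<Longrightarrow> norm (G t s \<phi> - mean_proj s \<phi>) \<le> M * exp (\<omega> * (t - s)) * norm \<phi>"
    and z: "z \<in> complex_spectrum (G (s + T) s)" "cmod z < 1"
  shows "cmod z \<le> exp (\<omega> * T)"
proof (rule ccontr)
  assume "\<not> ?thesis"
  then have gt: "exp (\<omega> * T) < cmod z" by simp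
  then have "z \<noteq> 0" by (smt (verit) exp_gt_zero norm_zero)
  moreover have "z \<noteq> 1" using z(2) by auto
  moreover have "z \<notin> complex_spectrum (defect s)"
  proof (rule not_in_complex_spectrum_decay[OF defect_bounded_linear])
    show "0 \<le> exp (\<omega> * T)" by simp
    show "exp (\<omega> * T) < cmod z" by (rule gt)
    \<comment> \<open>The maximum with 1 covers the zeroth power.\<close>
    show "0 \<le> max 1 M" by simp
    fix n \<phi>
    show "norm ((defect s ^^ n) \<phi>) \<le> max 1 M * exp (\<omega> * T) ^ n * norm \<phi>"
    proof (cases "n = 0")
      case True
      then show ?thesis using mult_right_mono[of 1 "max 1 M" "norm \<phi>"] by simp
    next
      case False
      have "exp (\<omega> * (real n * T)) = exp (\<omega> * T) ^ n"
        by (simp add: exp_of_nat_mult[symmetric] mult_ac)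
      then have "norm ((defect s ^^ n) \<phi>) \<le> M * exp (\<omega> * T) ^ n * norm \<phi>"
        using dec[of "s + real n * T" \<phi>] False T_pos by (simp add: defect_funpow)
      also have "\<dots> \<le> max 1 M * exp (\<omega> * T) ^ n * norm \<phi>"
        by (intro mult_right_mono) auto
      finally show ?thesis .
    qed
  qed
  ultimately show False using z(1) spectrum_defect by blast
qed

lemma defect0_funpow: "n > 0 \<Longrightarrow> (defect 0 ^^ n) \<phi> = (V ^^ n) \<phi> - const_bcontfun (mean0 \<phi>)"
  using mean_eq[of 0 0 \<phi>] V_funpow[of n \<phi> 0] by (simp add: defect_funpow mean_proj_def G_refl)

lemma defect0_decay:
  "\<exists>\<theta> K. 0 < \<theta> \<and> \<theta> < 1 \<and> 0 \<le> K \<and> (\<forall>n \<phi>. norm ((defect 0 ^^ n) \<phi>) \<le> K * \<theta> ^ n * norm \<phi>)"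
proof -
  obtain \<theta> K where \<theta>: "0 < \<theta>" "\<theta> < 1" "0 \<le> K"
    and dec: "\<forall>n \<phi>. norm ((V ^^ n) \<phi> - const_bcontfun (mean0 \<phi>)) \<le> K * \<theta> ^ n * norm \<phi>"
    using mean0_decay by (elim exE conjE)
  have "norm ((defect 0 ^^ n) \<phi>) \<le> (K + 1) * \<theta> ^ n * norm \<phi>" for n \<phi>
  proof (cases "n = 0")
    case True
    then show ?thesis using \<theta> by (simp add: distrib_right)
  next
    case False
    then have "norm ((defect 0 ^^ n) \<phi>) \<le> K * \<theta> ^ n * norm \<phi>" using dec by (simp add: defect0_funpow)
    also have "\<dots> \<le> (K + 1) * \<theta> ^ n * norm \<phi>" using \<theta> by (intro mult_right_mono) auto
    finally show ?thesis .
  qed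
  then have "\<forall>n \<phi>. norm ((defect 0 ^^ n) \<phi>) \<le> (K + 1) * \<theta> ^ n * norm \<phi>" by blast
  then show ?thesis using \<theta> by (intro exI[of _ \<theta>] exI[of _ "K + 1"] conjI) auto
qed

lemma decay_of_defect0_bound:
  assumes B: "\<And>n \<phi>. norm ((defect 0 ^^ n) \<phi>) \<le> B * \<rho> ^ n * norm \<phi>" and \<rho>: "0 < \<rho>" "\<rho> < 1"
  shows "\<exists>M>0. \<forall>s t \<phi>. s < t \<longrightarrow> norm (G t s \<phi> - mean_proj s \<phi>) \<le> M * exp (ln \<rho> / T * (t - s)) * norm \<phi>"
proof -
  \<comment> \<open>The 2 serves \<open>n = 0\<close>, where a function minus its mean has at most
    twice its norm.\<close>
  define B' where "B' = max 2 B"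
  have B': "norm ((V ^^ n) \<psi> - const_bcontfun (mean0 \<psi>)) \<le> B' * \<rho> ^ n * norm \<psi>" for n \<psi>
  proof (cases "n = 0")
    case True
    have "norm (\<psi> - const_bcontfun (mean0 \<psi>)) \<le> 2 * norm \<psi>"
      using norm_diff_mean_le[of \<psi> 0 \<psi>] mean_eq[of 0 0 \<psi>] by (simp add: mean_proj_def G_refl)
    also have "\<dots> \<le> B' * norm \<psi>" by (intro mult_right_mono) (auto simp: B'_def)
    finally show ?thesis using True by simp
  next
    case False
    then have "norm ((V ^^ n) \<psi> - const_bcontfun (mean0 \<psi>)) \<le> B * \<rho> ^ n * norm \<psi>"
      using B[of n \<psi>] by (simp add: defect0_funpow)
    also have "\<dots> \<le> B' * \<rho> ^ n * norm \<psi>" using \<rho> by (intro mult_right_mono) (auto simp: B'_def)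
    finally show ?thesis .
  qed
  have "B' \<ge> 0" by (simp add: B'_def)
  then have "norm (G t s \<phi> - mean_proj s \<phi>) \<le> (2 / \<rho> + B' / \<rho>\<^sup>2) * exp (ln \<rho> / T * (t - s)) * norm \<phi>" if "s < t" for s t \<phi>
    unfolding mean_proj_def using decay_of_power_bound[OF B' \<rho> _ that] by blast
  moreover have "2 / \<rho> + B' / \<rho>\<^sup>2 > 0" using \<rho> \<open>B' \<ge> 0\<close> by (intro add_pos_nonneg) auto
  ultimately show ?thesis by blast
qed

section \<open>The spectral bound and the two rate statements\<close>

definition spectral_set :: "real set" where
  "spectral_set = {cmod z | z s. z \<in> complex_spectrum (G (s + T) s) \<and> cmod z < 1}"

lemma spectral_set_iff:
  "x \<in> spectral_set \<longleftrightarrow> (\<exists>z s. x = cmod z \<and> z \<in> complex_spectrum (G (s + T) s) \<and> cmod z < 1)"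
  by (simp add: spectral_set_def)

lemma spectral_r_eq: "spectral_r T G = Sup spectral_set"
  by (simp add: spectral_r_def spectral_set_def)

text \<open>The supremum defining \<open>r\<close> is taken in the reals, so nonemptiness is needed
  to make it meaningful and nonnegative.\<close>

lemma zero_in_spectral_set: "0 \<in> spectral_set"
proof -
  have "0 \<in> complex_spectrum (G (0 + T) 0)"
    using T_pos by (intro zero_in_complex_spectrum_compact period_bounded_linear compact) simp
  then show ?thesis unfolding spectral_set_iff by (intro exI[of _ 0] conjI) simp_all
qed

lemma spectral_set_bdd: "bdd_above spectral_set"
  unfolding bdd_above_def spectral_set_def by (intro exI[of _ 1]) auto

lemma spectral_r_nonneg: "0 \<le> spectral_r T G"
  unfolding spectral_r_eq by (rule cSup_upper[OF zero_in_spectral_set spectral_set_bdd])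

text \<open>The qualitative rate \<open>\<theta>\<close> found at \<open>s = 0\<close> holds for all
  starting times after transport, and it bounds every spectral value of modulus below 1 by
  \<open>\<theta>\<close>.\<close>

lemma spectral_r_less_one: "spectral_r T G < 1"
proof -
  obtain \<theta> K where \<theta>: "0 < \<theta>" "\<theta> < 1" "0 \<le> K"
    and dec: "\<forall>n \<phi>. norm ((defect 0 ^^ n) \<phi>) \<le> K * \<theta> ^ n * norm \<phi>"
    using defect0_decay by (elim exE conjE)
  obtain M where M: "\<forall>s t \<phi>. s < t \<longrightarrow> norm (G t s \<phi> - mean_proj s \<phi>) \<le> M * exp (ln \<theta> / T * (t - s)) * norm \<phi>"
    using decay_of_defect0_bound[OF dec[rule_format] \<theta>(1,2)] by (elim exE conjE)
  have "x \<le> \<theta>" if x: "x \<in> spectral_set" for x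
  proof -
    obtain z s where "x = cmod z" and z: "z \<in> complex_spectrum (G (s + T) s)" "cmod z < 1"
      using x unfolding spectral_set_iff by (elim exE conjE)
    have "cmod z \<le> exp (ln \<theta> / T * T)"
      by (rule spectrum_le_of_decay[OF _ z]) (rule M[rule_format])
    then show ?thesis using T_pos \<theta> \<open>x = cmod z\<close> by simp
  qed
  then have "spectral_r T G \<le> \<theta>" unfolding spectral_r_eq using zero_in_spectral_set by (intro cSup_least) auto
  then show ?thesis using \<theta> by simp
qed

lemma decay_above:
  assumes "ereal \<omega> > omega0 T G"
  shows "\<exists>M>0. \<forall>s t \<phi>. s < t \<longrightarrow> norm (G t s \<phi> - mean_proj s \<phi>) \<le> M * exp (\<omega> * (t - s)) * norm \<phi>"
proof (cases "\<omega> \<ge> 0")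
  \<comment> \<open>For nonnegative rates contractivity is enough.\<close>
  case True
  have "norm (G t s \<phi> - mean_proj s \<phi>) \<le> 2 * exp (\<omega> * (t - s)) * norm \<phi>" if "s < t" for s t \<phi>
  proof -
    have "norm (G t s \<phi> - mean_proj s \<phi>) \<le> 2 * 1 * norm \<phi>"
      using norm_diff_mean_le[of "G t s \<phi>" s \<phi>] G_norm_le[of s t \<phi>] that by simp
    also have "\<dots> \<le> 2 * exp (\<omega> * (t - s)) * norm \<phi>"
      using True that by (intro mult_right_mono mult_left_mono) auto
    finally show ?thesis .
  qed
  then show ?thesis by (intro exI[of _ 2]) simp
next
  case False
  define \<rho> where "\<rho> = exp (\<omega> * T)"
  have \<rho>: "0 < \<rho>" "\<rho> < 1" "ln \<rho> / T = \<omega>" using False T_pos by (simp_all add: \<rho>_def mult_neg_pos)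
  define r where "r = spectral_r T G"
  have r0: "r \<ge> 0" by (simp add: r_def spectral_r_nonneg)
  have r: "r < \<rho>"
  proof (cases "r = 0")
    case False
    then have "ln r / T < \<omega>" using assms by (simp add: omega0_def r_def)
    then have "ln r < \<omega> * T" using T_pos by (simp add: pos_divide_less_eq)
    then have "exp (ln r) < \<rho>" by (simp add: \<rho>_def)
    then show ?thesis using False r0 by simp
  qed (use \<rho> in simp)
  \<comment> \<open>A radius strictly between \<open>r\<close> and \<open>\<rho>\<close>: it is
    positive even if \<open>r = 0\<close>, and leaves room for Cauchy's estimate.\<close>
  define r1 where "r1 = (r + \<rho>) / 2"
  have r1: "0 < r1" "r < r1" "r1 < \<rho>" using r r0 by (simp_all add: r1_def)
  obtain \<theta> K where \<theta>: "0 < \<theta>" "\<theta> < 1" "0 \<le> K"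
    and dec: "\<forall>n \<phi>. norm ((defect 0 ^^ n) \<phi>) \<le> K * \<theta> ^ n * norm \<phi>"
    using defect0_decay by (elim exE conjE)
  have "z \<notin> complex_spectrum (defect 0)" if z: "r1 < cmod z" for z
  proof (cases "cmod z < 1")
    case True
    have "z \<noteq> 0" "z \<noteq> 1" using z r1 True by auto
    moreover have "z \<notin> complex_spectrum (G (0 + T) 0)"
    proof
      assume "z \<in> complex_spectrum (G (0 + T) 0)"
      then have "cmod z \<in> spectral_set" using True unfolding spectral_set_iff by (intro exI[of _ z] exI[of _ 0] conjI refl)
      then have "cmod z \<le> r" unfolding r_def spectral_r_eq by (rule cSup_upper[OF _ spectral_set_bdd])
      then show False using z r1 by simp
    qed
    ultimately show ?thesis using spectrum_defect by blast
  next
    \<comment> \<open>For modulus at least 1, including \<open>z = 1\<close>, the definition of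
      \<open>r\<close> gives no information; the qualitative decay with \<open>\<theta> < 1\<close>
      excludes such points.\<close>
    case False
    show ?thesis
      by (rule not_in_complex_spectrum_decay[OF defect_bounded_linear _ _ dec[rule_format] \<theta>(3)])
         (use \<theta> False in auto)
  qed
  then obtain B where B: "\<forall>n \<phi>. norm ((defect 0 ^^ n) \<phi>) \<le> B * \<rho> ^ n * norm \<phi>"
    using power_bound_of_spectral_bound[OF defect_bounded_linear r1(1) _ r1(3)] by blast
  show ?thesis
    using decay_of_defect0_bound[OF B[rule_format] \<rho>(1,2)] unfolding \<rho>(3) .
qed

text \<open>Some spectral value has modulus above \<open>exp (\<omega> * T)\<close>, and the
  estimate at the corresponding \<open>s\<close> confines it to the smaller disc. If
  \<open>r = 0\<close>, then \<open>omega0\<close> is minus infinity and no such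
  \<open>\<omega>\<close> exists.\<close>

lemma no_decay_below:
  assumes "ereal \<omega> < omega0 T G"
    and "\<forall>s t \<phi>. s < t \<longrightarrow> norm (G t s \<phi> - mean_proj s \<phi>) \<le> M * exp (\<omega> * (t - s)) * norm \<phi>"
  shows False
proof -
  define r where "r = spectral_r T G"
  have "r \<noteq> 0" using assms(1) by (auto simp: omega0_def r_def)
  then have r: "r > 0" using spectral_r_nonneg by (simp add: r_def)
  have "\<omega> < ln r / T" using assms(1) \<open>r \<noteq> 0\<close> by (simp add: omega0_def r_def)
  then have "\<omega> * T < ln r" using T_pos by (simp add: pos_less_divide_eq)
  then have "exp (\<omega> * T) < exp (ln r)" by simp
  then have "exp (\<omega> * T) < Sup spectral_set" by (simp only: exp_ln[OF r]) (simp only: r_def spectral_r_eq)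
  then have "\<exists>x\<in>spectral_set. exp (\<omega> * T) < x"
    using zero_in_spectral_set by (intro less_cSupD) auto
  then obtain x where x: "x \<in> spectral_set" "exp (\<omega> * T) < x" by (elim bexE)
  from x(1) obtain z s where "x = cmod z" and z: "z \<in> complex_spectrum (G (s + T) s)" "cmod z < 1"
    unfolding spectral_set_iff by (elim exE conjE)
  have "cmod z \<le> exp (\<omega> * T)"
    by (rule spectrum_le_of_decay[OF _ z]) (rule assms(2)[rule_format])
  then show False using x \<open>x = cmod z\<close> by simp
qed

section \<open>Existence and uniqueness of the periodic system\<close>

lemma mean_system: "periodic_evolution_system T G (\<lambda>s. daniell_functional.repr (mean s))"
  unfolding periodic_evolution_system_def evolution_system_of_measures_def
proof (intro conjI allI impI)
  show "sets (daniell_functional.repr (mean s)) = sets borel" for s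
    by (rule daniell_functional.sets_repr[OF mean_daniell])
  show "prob_space (daniell_functional.repr (mean s))" for s
    by (rule daniell_functional.prob_space_repr[OF mean_daniell])
  show "(\<integral>x. apply_bcontfun (G t s \<phi>) x \<partial>daniell_functional.repr (mean t)) = (\<integral>x. apply_bcontfun \<phi> x \<partial>daniell_functional.repr (mean s))"
    if "s < t" for s t \<phi>
    using that by (simp add: daniell_functional.integral_repr[OF mean_daniell] mean_G)
  have "mean (s + T) = mean s" for s by (rule ext) (rule mean_periodic)
  then show "daniell_functional.repr (mean (s + T)) = daniell_functional.repr (mean s)" for s by simp
qed

text \<open>Invariance and periodicity make the integral of
  \<open>G (s + real n * T) s \<phi>\<close> against \<open>\<mu> s\<close> independent of
  \<open>n\<close>, while these functions converge in norm to the constant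
  \<open>mean s \<phi>\<close>. This gives uniqueness and identifies the mean in the decay
  estimate.\<close>

lemma integral_periodic_system:
  assumes \<mu>: "periodic_evolution_system T G \<mu>"
  shows "(\<integral>x. apply_bcontfun \<phi> x \<partial>\<mu> s) = mean s \<phi>"
proof -
  have sets: "sets (\<mu> s) = sets borel" and "prob_space (\<mu> s)"
    and inv: "\<And>s t \<phi>. s < t \<Longrightarrow> (\<integral>x. apply_bcontfun (G t s \<phi>) x \<partial>\<mu> t) = (\<integral>x. apply_bcontfun \<phi> x \<partial>\<mu> s)"
    and per: "\<And>s. \<mu> (s + T) = \<mu> s"
    using \<mu> by (simp_all add: periodic_evolution_system_def evolution_system_of_measures_def)
  interpret prob_space "\<mu> s" by fact
  have integrable: "integrable (\<mu> s) (apply_bcontfun f)" for f :: "'n Cb"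
  proof (rule integrable_const_bound[where B = "norm f"])
    show "AE x in \<mu> s. norm (apply_bcontfun f x) \<le> norm f" by (simp add: norm_bounded[of f, simplified])
    show "apply_bcontfun f \<in> borel_measurable (\<mu> s)"
      by (subst measurable_cong_sets[OF sets refl]) (intro borel_measurable_continuous_onI continuous_on_apply_bcontfun)
  qed
  have step: "(\<integral>x. apply_bcontfun (G (s + real n * T) s \<phi>) x \<partial>\<mu> s) = (\<integral>x. apply_bcontfun \<phi> x \<partial>\<mu> s)" for n
  proof -
    have "\<mu> (s + real n * T) = \<mu> s"
    proof (induction n)
      case (Suc n)
      then show ?case using per[of "s + real n * T"] by (simp add: algebra_simps)
    qed simp
    then show ?thesis using inv[of s "s + real n * T" \<phi>] T_pos by (cases "n = 0") (simp_all add: G_refl)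
  qed
  obtain \<theta> K where \<theta>: "0 < \<theta>" "\<theta> < 1" "0 \<le> K"
    and dec: "\<forall>n \<phi>. norm ((defect 0 ^^ n) \<phi>) \<le> K * \<theta> ^ n * norm \<phi>"
    using defect0_decay by (elim exE conjE)
  obtain M where M: "\<forall>s t \<phi>. s < t \<longrightarrow> norm (G t s \<phi> - mean_proj s \<phi>) \<le> M * exp (ln \<theta> / T * (t - s)) * norm \<phi>"
    using decay_of_defect0_bound[OF dec[rule_format] \<theta>(1,2)] by (elim exE conjE)
  have bound: "\<bar>(\<integral>x. apply_bcontfun \<phi> x \<partial>\<mu> s) - mean s \<phi>\<bar> \<le> M * \<theta> ^ Suc n * norm \<phi>" for n
  proof -
    let ?g = "G (s + real (Suc n) * T) s \<phi>"
    have "norm (?g - mean_proj s \<phi>) \<le> M * exp (ln \<theta> / T * (s + real (Suc n) * T - s)) * norm \<phi>"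
      by (rule M[rule_format]) (use T_pos in simp)
    also have "exp (ln \<theta> / T * (s + real (Suc n) * T - s)) = exp (ln \<theta> * real (Suc n))" using T_pos by simp
    also have "\<dots> = \<theta> ^ Suc n" using \<theta> by (subst exp_of_nat2_mult) simp
    finally have g: "norm (?g - mean_proj s \<phi>) \<le> M * \<theta> ^ Suc n * norm \<phi>" .
    have "(\<integral>x. apply_bcontfun \<phi> x \<partial>\<mu> s) - mean s \<phi> = (\<integral>x. apply_bcontfun (?g - mean_proj s \<phi>) x \<partial>\<mu> s)"
      using step[of "Suc n"] by (simp add: Bochner_Integration.integral_diff integrable mean_proj_def prob_space)
    also have "\<bar>\<dots>\<bar> \<le> (\<integral>x. norm (?g - mean_proj s \<phi>) \<partial>\<mu> s)"
    proof -
      have "\<bar>\<integral>x. apply_bcontfun (?g - mean_proj s \<phi>) x \<partial>\<mu> s\<bar> \<le> (\<integral>x. \<bar>apply_bcontfun (?g - mean_proj s \<phi>) x\<bar> \<partial>\<mu> s)"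
        by (rule integral_abs_bound)
      also have "\<dots> \<le> (\<integral>x. norm (?g - mean_proj s \<phi>) \<partial>\<mu> s)"
        by (intro integral_mono integrable_abs integrable) (use norm_bounded[of "?g - mean_proj s \<phi>"] in simp_all)
      finally show ?thesis .
    qed
    also have "\<dots> = norm (?g - mean_proj s \<phi>)" by (simp add: prob_space)
    finally show ?thesis using g by linarith
  qed
  have "(\<lambda>n. M * \<theta> ^ Suc n * norm \<phi>) \<longlonglongrightarrow> M * 0 * norm \<phi>"
    using \<theta> by (intro tendsto_intros LIMSEQ_Suc LIMSEQ_power_zero) simp
  then have "\<bar>(\<integral>x. apply_bcontfun \<phi> x \<partial>\<mu> s) - mean s \<phi>\<bar> \<le> M * 0 * norm \<phi>"
    by (rule LIMSEQ_le_const) (use bound in blast)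
  then show ?thesis by simp
qed

lemma periodic_system_unique:
  assumes \<mu>: "periodic_evolution_system T G \<mu>" and \<nu>: "periodic_evolution_system T G \<nu>"
  shows "\<mu> = \<nu>"
proof
  fix s
  show "\<mu> s = \<nu> s"
  proof (rule prob_measure_eqI_bcontfun)
    show "sets (\<mu> s) = sets borel" "prob_space (\<mu> s)" "sets (\<nu> s) = sets borel" "prob_space (\<nu> s)"
      using \<mu> \<nu> by (simp_all add: periodic_evolution_system_def evolution_system_of_measures_def)
    show "(\<integral>x. apply_bcontfun f x \<partial>\<mu> s) = (\<integral>x. apply_bcontfun f x \<partial>\<nu> s)" for f :: "'n Cb"
      by (simp add: integral_periodic_system[OF \<mu>] integral_periodic_system[OF \<nu>])
  qed
qed

lemma decay_estimate_iff:
  assumes "periodic_evolution_system T G \<mu>"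
  shows "decay_estimate G \<mu> \<omega> M \<longleftrightarrow>
    (\<forall>s t \<phi>. s < t \<longrightarrow> norm (G t s \<phi> - mean_proj s \<phi>) \<le> M * exp (\<omega> * (t - s)) * norm \<phi>)"
  unfolding decay_estimate_def integral_periodic_system[OF assms] mean_proj_def by blast

end

theorem corollary4p3:
  fixes q :: "real \<Rightarrow> real ^ 'n \<Rightarrow> real ^ 'n ^ 'n::finite"
    and b :: "real \<Rightarrow> real ^ 'n \<Rightarrow> real ^ 'n"
    and G :: "real \<Rightarrow> real \<Rightarrow> 'n Cb \<Rightarrow> 'n Cb"
    and T :: real
  assumes "T > 0"
    and "\<And>s x. q (s + T) x = q s x"
    and "\<And>s x. b (s + T) x = b s x"
    and "H1 q b" and "H2 q" and "H3 q b"
    and "evolution_operator q b G"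
    and "\<And>s t. s < t \<Longrightarrow> compact_map (G t s)"
  shows "(\<exists>!\<mu>. periodic_evolution_system T G \<mu>) \<and>
    spectral_r T G < 1 \<and>
    (\<forall>\<mu>. periodic_evolution_system T G \<mu> \<longrightarrow>
      (\<forall>\<omega>::real. ereal \<omega> > omega0 T G \<longrightarrow> (\<exists>M>0. decay_estimate G \<mu> \<omega> M)) \<and>
      (\<forall>\<omega>::real. ereal \<omega> < omega0 T G \<longrightarrow> \<not> (\<exists>M. decay_estimate G \<mu> \<omega> M)))"
proof -
  interpret periodic_parabolic q b G T
    by unfold_locales (fact assms)+
  show ?thesis
  proof (intro conjI allI impI)
    show "\<exists>!\<mu>. periodic_evolution_system T G \<mu>"
    proof (rule ex1I)
      show "periodic_evolution_system T G (\<lambda>s. daniell_functional.repr (mean s))" by (rule mean_system)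
      show "\<mu> = (\<lambda>s. daniell_functional.repr (mean s))" if "periodic_evolution_system T G \<mu>" for \<mu>
        using that mean_system by (rule periodic_system_unique)
    qed
    show "spectral_r T G < 1" by (rule spectral_r_less_one)
    fix \<mu> assume \<mu>: "periodic_evolution_system T G \<mu>"
    show "\<exists>M>0. decay_estimate G \<mu> \<omega> M" if "ereal \<omega> > omega0 T G" for \<omega>
      unfolding decay_estimate_iff[OF \<mu>] by (rule decay_above[OF that])
    show "\<not> (\<exists>M. decay_estimate G \<mu> \<omega> M)" if "ereal \<omega> < omega0 T G" for \<omega>
      unfolding decay_estimate_iff[OF \<mu>] using no_decay_below[OF that] by blast
  qed
qed

end
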